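(* Let $X$ be a Banach space, $K\subset X$ compact, and $\{\Pi^c_m\}_{m\in K}$ a family of bounded projections of $X$; set $\Pi^h_m=\mathrm{id}-\Pi^c_m$ and let $X^\kappa_m$ be the range of $\Pi^\kappa_m$, $\kappa=c,h$. Assume: (a) the map $m\mapsto\Pi^c_m$ is continuous and $T_mK\subset X^c_m$ for all $m\in K$; (b) for each $m\in K$, the pair $(X^c_m,X^h_m)$ has property $( * )$. Then: (1) There is a $C^1$ submanifold $\Sigma$ of $X$ such that $K\subset\Sigma$ and $T_m\Sigma=X^c_m$ for all $m\in K$. Moreover, there are projections $\widetilde\Pi^c_m$, $m\in\Sigma$, such that the range of $\widetilde\Pi^c_m$ is $T_m\Sigma$ and $m\mapsto\widetilde\Pi^c_m$ is continuous; in addition $\widetilde\Pi^c_m=\Pi^c_m$ if $m\in K$. (2) For any $\epsilon>0$ there are projections $\widehat\Pi^c_m$ such that $m\mapsto\widehat\Pi^c_m:\Sigma\to L(X)$ is $C^1$ and $\sup_{m\in\Sigma}|\widehat\Pi^c_m-\widetilde\Pi^c_m|\le\epsilon$. In particular, there are $r>0$ and $C_2>0$ such that for any $m\in K$, $|\widehat\Pi^c_{m_1}-\widehat\Pi^c_{m_2}|\le C_2|m_1-m_2|$ for all $m_1,m_2\in\Sigma\cap\mathbb B_r(m)$.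
   Context: $L(X)$ is the space of bounded operators, $\mathbb B_r(m)$ the open ball. Whitney (pre-)tangent spaces: for $U\subset X$, $m\in U$, $P$ a bounded projection onto a complemented closed subspace $E$: $T_mU\subset E$ means $\sup\{|m_1-m_2-P(m_1-m_2)|/|m_1-m_2|:m_1\ne m_2\in U\cap\mathbb B_\epsilon(m)\}\to0$ as $\epsilon\to0^+$; $T_mU=E$ means that, in addition, there are $\delta,\epsilon>0$ with $\{x\in E:|x|<\delta\}\subset P(U\cap\mathbb B_\epsilon(m)-m)$. Property $( * )$: the pair of Banach spaces $(X_1,Z)$ has property $( * )$ if there is $C_*\ge1$ (depending only on $X_1$ and $Z$) such that for each closed $A\subset X_1$, each Lipschitz $f:A\to Z$ and each $\varepsilon>0$ there is a $C^1$ Lipschitz $g:X_1\to Z$ with $|f(x)-g(x)|<\varepsilon$ for all $x\in A$ and $\mathrm{Lip}\,g\le C_*\mathrm{Lip}\,f$. *)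

theory Defs
  imports "HOL-Analysis.Analysis"
begin

definition bounded_projection :: "('a::real_normed_vector \<Rightarrow>\<^sub>L 'a) \<Rightarrow> bool" where
  "bounded_projection P \<longleftrightarrow> P o\<^sub>L P = P"

text \<open>
  Whitney (pre-)tangent spaces. The complemented subspace \<open>E\<close> of the definition is
  represented by a bounded projection \<open>P\<close> with range \<open>E\<close>, so the two predicates below
  read \<open>T\<^sub>m U \<subseteq> range P\<close> and \<open>T\<^sub>m U = range P\<close>. The supremum is taken in
  \<^typ>\<open>ennreal\<close>, where the supremum over the empty set (\<open>m\<close> isolated in \<open>U\<close>) is 0.
\<close>

definition whitney_tangent_subset ::
    "'a::real_normed_vector set \<Rightarrow> 'a \<Rightarrow> ('a \<Rightarrow>\<^sub>L 'a) \<Rightarrow> bool" where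
  "whitney_tangent_subset U m P \<longleftrightarrow>
     ((\<lambda>\<epsilon>. SUP (m1, m2) \<in> {(m1, m2). m1 \<in> U \<inter> ball m \<epsilon> \<and> m2 \<in> U \<inter> ball m \<epsilon> \<and> m1 \<noteq> m2}.
             ennreal (norm (m1 - m2 - P (m1 - m2)) / norm (m1 - m2)))
        \<longlongrightarrow> 0) (at_right (0::real))"

definition whitney_tangent_eq ::
    "'a::real_normed_vector set \<Rightarrow> 'a \<Rightarrow> ('a \<Rightarrow>\<^sub>L 'a) \<Rightarrow> bool" where
  "whitney_tangent_eq U m P \<longleftrightarrow>
     whitney_tangent_subset U m P \<and>
     (\<exists>\<delta>>0. \<exists>\<epsilon>>0. {x \<in> range (blinfun_apply P). norm x < \<delta>}
                    \<subseteq> (\<lambda>x. P (x - m)) ` (U \<inter> ball m \<epsilon>))"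

text \<open>
  \<open>C1_on S f\<close> is meant for \<open>S\<close> a relatively open subset of a complemented closed
  subspace \<open>E\<close> (possibly the whole space). It says that \<open>f\<close> is continuously
  Frechet differentiable on \<open>S\<close> as a function on the Banach space \<open>E\<close>: only the restriction
  of \<open>f' x\<close> to \<open>E\<close> matters, and a derivative \<open>S \<rightarrow> L(E, Y)\<close> extends to
  \<open>S \<rightarrow> L(X, Y)\<close>, with the same continuity, by composing with a bounded projection onto \<open>E\<close>.
\<close>

definition C1_on ::
    "'a::real_normed_vector set \<Rightarrow> ('a \<Rightarrow> 'b::real_normed_vector) \<Rightarrow> bool" where
  "C1_on S f \<longleftrightarrow>
     (\<exists>f' :: 'a \<Rightarrow> 'a \<Rightarrow>\<^sub>L 'b. continuous_on S f' \<and>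
        (\<forall>x\<in>S. (f has_derivative blinfun_apply (f' x)) (at x within S)))"

definition Lip :: "'a::metric_space set \<Rightarrow> ('a \<Rightarrow> 'b::metric_space) \<Rightarrow> real" where
  "Lip A f = Inf {L. L-lipschitz_on A f}"

text \<open>
  Property \<open>(*)\<close> for a pair of Banach spaces given as closed subspaces \<open>X1\<close> (complemented,
  see \<open>C1_on\<close>) and \<open>Z\<close> of one ambient space. Functions are total; only their values on
  \<open>A\<close>, respectively \<open>X1\<close>, are constrained.
\<close>

definition property_star ::
    "'a::real_normed_vector set \<Rightarrow> 'a set \<Rightarrow> bool" where
  "property_star X1 Z \<longleftrightarrow>
     (\<exists>C\<ge>1. \<forall>A (f :: 'a \<Rightarrow> 'a) \<epsilon>.
        A \<subseteq> X1 \<and> closed A \<and> f ` A \<subseteq> Z \<and> (\<exists>L. L-lipschitz_on A f) \<and> \<epsilon> > 0 \<longrightarrow>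
        (\<exists>g :: 'a \<Rightarrow> 'a. g ` X1 \<subseteq> Z \<and> C1_on X1 g \<and> (\<exists>L. L-lipschitz_on X1 g) \<and>
            (\<forall>x\<in>A. norm (f x - g x) < \<epsilon>) \<and> Lip X1 g \<le> C * Lip A f))"

text \<open>
  A submanifold chart: a \<open>C\<^sup>1\<close> diffeomorphism \<open>\<phi>\<close> between open subsets of the ambient space
  which flattens \<open>S\<close> to the complemented subspace \<open>range P\<close>.
\<close>

definition slice_chart ::
    "'a::real_normed_vector set \<Rightarrow> ('a \<Rightarrow>\<^sub>L 'a) \<Rightarrow> 'a set \<Rightarrow> ('a \<Rightarrow> 'a) \<Rightarrow> bool" where
  "slice_chart S P U \<phi> \<longleftrightarrow>
     bounded_projection P \<and> open U \<and> inj_on \<phi> U \<and> open (\<phi> ` U) \<and>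
     C1_on U \<phi> \<and> C1_on (\<phi> ` U) (inv_into U \<phi>) \<and>
     \<phi> ` (U \<inter> S) = \<phi> ` U \<inter> range (blinfun_apply P)"

definition C1_submanifold :: "'a::real_normed_vector set \<Rightarrow> bool" where
  "C1_submanifold S \<longleftrightarrow> (\<forall>m\<in>S. \<exists>P U \<phi>. m \<in> U \<and> slice_chart S P U \<phi>)"

definition C1_map_on_submanifold ::
    "'a::real_normed_vector set \<Rightarrow> ('a \<Rightarrow> 'b::real_normed_vector) \<Rightarrow> bool" where
  "C1_map_on_submanifold S f \<longleftrightarrow>
     (\<forall>m\<in>S. \<exists>P U \<phi>. m \<in> U \<and> slice_chart S P U \<phi> \<and>
        C1_on (\<phi> ` (U \<inter> S)) (f \<circ> inv_into U \<phi>))"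

end

theory Submission
  imports Defs
begin

text \<open>
  Near each point \<open>p\<close> of \<open>K\<close> where \<open>Pic p\<close> is not the identity, \<open>K\<close> is a graph of small slope over
  \<open>range (Pic p)\<close>. Property \<open>(*)\<close> yields a Whitney extension theorem for such graphs: smooth
  approximations that are good at scale \<open>\<rho> n\<close> around the graph are glued along annuli, and the
  gluing error stays small because the radii \<open>\<rho> n\<close> are fixed before the accuracy on the graph itself
  is chosen. This produces local maps vanishing on \<open>K\<close> whose derivative at \<open>m\<close> has kernel
  \<open>range (Pic m)\<close>. Composing them with a smooth field of projections close to \<open>id_blinfun - Pic\<close> and
  averaging gives one map \<open>\<Phi>\<close>, with \<open>\<Phi> x\<close> in the range of the projection at \<open>x\<close>; the zero set of \<open>\<Phi>\<close>
  near \<open>K\<close> is the manifold by the inverse function theorem. The whole space need not admit smooth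
  bump functions, but functions of \<open>Pic p x\<close>, cut off by balls, serve as such near \<open>K\<close>. The same
  functions give the uniform smooth approximation of the continuous projection field, and a smooth
  retraction turns operators that are nearly projections into projections.
\<close>

text \<open>Three obstacles shape the proof. Where \<open>Pic m\<close> is the identity, property
  star only concerns maps into {0} and yields no bump functions. A nonzero projection has norm at
  least 1, so these points keep a positive distance from the rest of K; near them
  \<open>\<Phi>\<close> vanishes identically and the manifold is open. Elsewhere a vector of the
  complement and a functional with value 1 on it turn vector-valued extension into scalar extension.
  The complements move with m, so an average of local defining maps has no fixed target, and its
  derivative could gain rank away from K. Forcing the values into the range of a smooth projection
  \<open>H x\<close> prevents this: at zeros near K the derivative \<open>\<Theta>\<close> has the
  range of \<open>H\<close>, and a continuous \<open>T\<close> with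
  \<open>\<Theta> T \<Theta> = \<Theta>\<close> and \<open>T \<Theta> T = T\<close> exists. Finally,
  \<open>H\<close> only approximates \<open>Pih\<close>, while the projections of part (1) must
  equal \<open>Pic\<close> on K. Hence \<open>T\<close> is built from an exact, merely continuous
  extension of \<open>Pih\<close>, and \<open>id - T \<Theta>\<close> is exact on K but only
  continuous; this is why part (2) needs a separate smoothing.\<close>

interpretation blinfun_compose: bounded_bilinear "(o\<^sub>L)"
  by (rule bounded_bilinear_blinfun_compose)

section \<open>Calculus of C1 maps with a named derivative field\<close>

definition C1_with ::
    "'a::real_normed_vector set \<Rightarrow> ('a \<Rightarrow> 'b::real_normed_vector) \<Rightarrow> ('a \<Rightarrow> 'a \<Rightarrow>\<^sub>L 'b) \<Rightarrow> bool" where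
  "C1_with U f f' \<longleftrightarrow> continuous_on U f' \<and> (\<forall>x\<in>U. (f has_derivative f' x) (at x))"

lemma C1_withD:
  "C1_with U f f' \<Longrightarrow> x \<in> U \<Longrightarrow> (f has_derivative f' x) (at x)"
  "C1_with U f f' \<Longrightarrow> continuous_on U f'"
  by (auto simp: C1_with_def)

lemma C1_with_continuous_on: "C1_with U f f' \<Longrightarrow> continuous_on U f"
  by (rule continuous_at_imp_continuous_on) (auto dest: C1_withD(1) has_derivative_continuous)

text \<open>On an open set, derivatives within the set are derivatives in the space. Naming the
  derivative field is what lets its bounds and kernels be followed through products and
  compositions.\<close>

lemma C1_on_open: "open U \<Longrightarrow> C1_on U f \<longleftrightarrow> (\<exists>f'. C1_with U f f')"
proof -
  assume "open U"
  then have "at x within U = at x" if "x \<in> U" for x using at_within_open that by blast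
  then show ?thesis unfolding C1_on_def C1_with_def by auto
qed

lemma C1_with_subset: "C1_with U f f' \<Longrightarrow> V \<subseteq> U \<Longrightarrow> C1_with V f f'"
  by (auto simp: C1_with_def intro: continuous_on_subset)

lemma C1_with_imp_C1_on: "C1_with U f f' \<Longrightarrow> V \<subseteq> U \<Longrightarrow> C1_on V f"
  unfolding C1_on_def C1_with_def
  by (meson continuous_on_subset has_derivative_at_withinI subsetD)

lemma C1_with_cong:
  assumes "C1_with U f f'" "open U" "\<And>x. x \<in> U \<Longrightarrow> f x = g x"
  shows "C1_with U g f'"
  using assms unfolding C1_with_def
  by (metis has_derivative_transform_within_open)

text \<open>Derivatives at a point are unique, so all local derivative fields are restrictions of
  the one built from \<open>frechet_derivative\<close>.\<close>

lemma C1_with_local: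
  assumes "\<And>x. x \<in> U \<Longrightarrow> \<exists>V f'. open V \<and> x \<in> V \<and> C1_with V f f'"
  shows "\<exists>f'. C1_with U f f'"
proof -
  define d where "d x = Blinfun (frechet_derivative f (at x))" for x
  have d: "f' x = d x" if "C1_with V f f'" "x \<in> V" for V f' x
    using C1_withD(1)[OF that] unfolding d_def
    by (metis blinfun_apply_inverse frechet_derivative_at)
  have "continuous (at x within U) d \<and> (f has_derivative d x) (at x)" if x: "x \<in> U" for x
  proof -
    obtain V f' where V: "open V" "x \<in> V" "C1_with V f f'" using assms[OF x] by blast
    have "continuous_on V f'" using V C1_withD by blast
    then have "continuous_on V d" using d[OF V(3)] by (simp cong: continuous_on_cong)
    then have "continuous (at x) d" using V by (simp add: continuous_on_eq_continuous_at)
    then show ?thesis using d[OF V(3,2)] C1_withD(1)[OF V(3,2)] continuous_at_imp_continuous_within by metis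
  qed
  then show ?thesis unfolding C1_with_def continuous_on_eq_continuous_within by blast
qed

lemma C1_with_const: "C1_with U (\<lambda>x. c) (\<lambda>x. 0)"
  by (simp add: C1_with_def zero_blinfun.rep_eq)

lemma C1_with_linear: "C1_with U (blinfun_apply A) (\<lambda>x. A)"
  by (simp add: C1_with_def bounded_linear_imp_has_derivative blinfun.bounded_linear_right)

lemma C1_with_ident: "C1_with U (\<lambda>x. x) (\<lambda>x. id_blinfun)"
  by (simp add: C1_with_def)

lemma C1_with_add:
  "C1_with U f f' \<Longrightarrow> C1_with U g g' \<Longrightarrow> C1_with U (\<lambda>x. f x + g x) (\<lambda>x. f' x + g' x)"
  by (auto simp: C1_with_def plus_blinfun.rep_eq intro!: continuous_intros derivative_intros)

lemma C1_with_diff: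
  "C1_with U f f' \<Longrightarrow> C1_with U g g' \<Longrightarrow> C1_with U (\<lambda>x. f x - g x) (\<lambda>x. f' x - g' x)"
  by (auto simp: C1_with_def minus_blinfun.rep_eq intro!: continuous_intros derivative_intros)

lemma C1_with_sum:
  "(\<And>i. i \<in> I \<Longrightarrow> C1_with U (f i) (f' i)) \<Longrightarrow>
   C1_with U (\<lambda>x. \<Sum>i\<in>I. f i x) (\<lambda>x. \<Sum>i\<in>I. f' i x)"
  by (induction I rule: infinite_finite_induct) (auto simp: C1_with_const intro!: C1_with_add)

lemma C1_with_bilinear:
  assumes "bounded_bilinear B" "C1_with U f f'" "C1_with U g g'"
  shows "C1_with U (\<lambda>x. B (f x) (g x))
    (\<lambda>x. (bounded_bilinear.prod_right B (f x) o\<^sub>L g' x) + (bounded_bilinear.prod_left B (g x) o\<^sub>L f' x))"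
proof -
  interpret bounded_bilinear B by fact
  have "continuous_on U (\<lambda>x. (prod_right (f x) o\<^sub>L g' x) + (prod_left (g x) o\<^sub>L f' x))"
    using assms(2,3)[THEN C1_with_continuous_on] assms(2,3)[THEN C1_withD(2)]
    by (intro continuous_intros bounded_linear.continuous_on[OF bounded_linear_prod_left]
        bounded_linear.continuous_on[OF bounded_linear_prod_right])
  moreover have "((\<lambda>x. B (f x) (g x)) has_derivative
      ((prod_right (f x) o\<^sub>L g' x) + (prod_left (g x) o\<^sub>L f' x))) (at x)" if "x \<in> U" for x
    using FDERIV[OF C1_withD(1)[OF assms(2) that] C1_withD(1)[OF assms(3) that]]
    by (simp add: plus_blinfun.rep_eq prod_right.rep_eq prod_left.rep_eq)
  ultimately show ?thesis by (simp add: C1_with_def)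
qed

lemma C1_with_scaleR:
  fixes f :: "'a::real_normed_vector \<Rightarrow> 'b::real_normed_vector" and c' :: "'a \<Rightarrow> 'a \<Rightarrow>\<^sub>L real"
  assumes "C1_with U c c'" "C1_with U f f'"
  shows "C1_with U (\<lambda>x. c x *\<^sub>R f x)
     (\<lambda>x. c x *\<^sub>R f' x + (blinfun_scaleR_left (f x) o\<^sub>L c' x))"
proof -
  have "bounded_bilinear.prod_right (*\<^sub>R) c o\<^sub>L A = c *\<^sub>R A"
    for c and A :: "'a \<Rightarrow>\<^sub>L 'b"
    by (rule blinfun_eqI)
      (simp add: bounded_bilinear.prod_right.rep_eq[OF bounded_bilinear_scaleR] scaleR_blinfun.rep_eq)
  moreover have "bounded_bilinear.prod_left (*\<^sub>R) (v::'b) = blinfun_scaleR_left v" for v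
    by (rule blinfun_eqI)
      (simp add: bounded_bilinear.prod_left.rep_eq[OF bounded_bilinear_scaleR])
  ultimately show ?thesis
    using C1_with_bilinear[OF bounded_bilinear_scaleR assms] by simp
qed

lemma C1_with_mult:
  fixes c d :: "'a::real_normed_vector \<Rightarrow> real"
  assumes "C1_with U c c'" "C1_with U d d'"
  shows "C1_with U (\<lambda>x. c x * d x) (\<lambda>x. c x *\<^sub>R d' x + d x *\<^sub>R c' x)"
proof -
  have "blinfun_scaleR_left (r::real) o\<^sub>L A = r *\<^sub>R A" for r and A :: "'a \<Rightarrow>\<^sub>L real"
    by (rule blinfun_eqI) (simp add: scaleR_blinfun.rep_eq)
  then show ?thesis using C1_with_scaleR[OF assms] by simp
qed

lemma C1_with_compose:
  assumes "C1_with U f f'" "C1_with V g g'" "f ` U \<subseteq> V"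
  shows "C1_with U (\<lambda>x. g (f x)) (\<lambda>x. g' (f x) o\<^sub>L f' x)"
proof -
  have "continuous_on U (\<lambda>x. g' (f x))"
    using continuous_on_compose2[OF C1_withD(2)[OF assms(2)] C1_with_continuous_on[OF assms(1)] assms(3)] .
  then have "continuous_on U (\<lambda>x. g' (f x) o\<^sub>L f' x)"
    using C1_withD(2)[OF assms(1)] by (intro continuous_intros)
  moreover have "((\<lambda>x. g (f x)) has_derivative (g' (f x) o\<^sub>L f' x)) (at x)" if "x \<in> U" for x
    using diff_chain_at[OF C1_withD(1)[OF assms(1) that] C1_withD(1)[OF assms(2), of "f x"]] assms(3) that
    by (auto simp: o_def blinfun_compose.rep_eq)
  ultimately show ?thesis by (simp add: C1_with_def)
qed

lemma C1_with_blinfun_compose: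
  fixes A :: "'b::real_normed_vector \<Rightarrow>\<^sub>L 'c::real_normed_vector"
  assumes "C1_with U f f'"
  shows "C1_with U (\<lambda>x. A (f x)) (\<lambda>x. A o\<^sub>L f' x)"
  using C1_with_compose[OF assms C1_with_linear[of UNIV A]] by simp

lemma C1_with_Pair:
  fixes f :: "'a::real_normed_vector \<Rightarrow> 'b::real_normed_vector"
    and g :: "'a \<Rightarrow> 'c::real_normed_vector"
  assumes "C1_with U f f'" "C1_with U g g'"
  shows "\<exists>h'. C1_with U (\<lambda>x. (f x, g x)) h' \<and> (\<forall>x\<in>U. \<forall>v. h' x v = (f' x v, g' x v))"
proof -
  define E1 :: "'b \<Rightarrow>\<^sub>L ('b \<times> 'c)" where "E1 = Blinfun (\<lambda>u. (u, 0))"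
  define E2 :: "'c \<Rightarrow>\<^sub>L ('b \<times> 'c)" where "E2 = Blinfun (\<lambda>u. (0, u))"
  have E: "blinfun_apply E1 = (\<lambda>u. (u, 0))" "blinfun_apply E2 = (\<lambda>u. (0, u))"
    unfolding E1_def E2_def
    by (intro bounded_linear_Blinfun_apply bounded_linear_Pair bounded_linear_ident bounded_linear_zero)+
  show ?thesis
    using C1_with_add[OF C1_with_blinfun_compose[OF assms(1), of E1] C1_with_blinfun_compose[OF assms(2), of E2]]
    by (auto intro!: exI[of _ "\<lambda>x. (E1 o\<^sub>L f' x) + (E2 o\<^sub>L g' x)"] simp: E plus_blinfun.rep_eq)
qed

lemma C1_with_bound:
  assumes "C1_with U f f'" "convex S" "S \<subseteq> U" "\<And>x. x \<in> S \<Longrightarrow> norm (f' x) \<le> B" "x \<in> S" "y \<in> S"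
  shows "norm (f x - f y) \<le> B * norm (x - y)"
proof (rule differentiable_bound[OF assms(2) _ _ assms(5,6)])
  show "(f has_derivative f' x) (at x within S)" if "x \<in> S" for x
    using C1_withD(1)[OF assms(1), of x] assms(3) that has_derivative_at_withinI by blast
  show "onorm (f' x) \<le> B" if "x \<in> S" for x
    using assms(4)[OF that] by (simp add: norm_blinfun.rep_eq)
qed

lemma C1_with_bound_linear:
  assumes "C1_with U f f'" "convex S" "S \<subseteq> U" "\<And>x. x \<in> S \<Longrightarrow> norm (f' x - A) \<le> B" "x \<in> S" "y \<in> S"
  shows "norm (f x - f y - A (x - y)) \<le> B * norm (x - y)"
proof -
  have "C1_with U (\<lambda>x. f x - A x) (\<lambda>x. f' x - A)"
    using assms(1) C1_with_linear by (rule C1_with_diff)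
  from C1_with_bound[OF this assms(2-)] show ?thesis
    by (simp add: blinfun.bilinear_simps algebra_simps)
qed

section \<open>Neighbourhoods of uniform radius around a compact set\<close>

definition tube :: "'a::metric_space set \<Rightarrow> real \<Rightarrow> 'a set" where
  "tube K r = (\<Union>y\<in>K. ball y r)"

lemma open_tube [simp]: "open (tube K r)"
  by (auto simp: tube_def)

lemma tube_mono: "r \<le> s \<Longrightarrow> tube K r \<subseteq> tube K s"
  unfolding tube_def using subset_ball[of r s] by blast

lemma tubeI: "y \<in> K \<Longrightarrow> dist y x < r \<Longrightarrow> x \<in> tube K r"
  by (auto simp: tube_def)

lemma subset_tube: "r > 0 \<Longrightarrow> K \<subseteq> tube K r"
  by (auto simp: tube_def)

lemma compact_tube_subset:
  fixes K :: "'a::metric_space set"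
  assumes "compact K" "open U" "K \<subseteq> U"
  shows "\<exists>r>0. tube K r \<subseteq> U"
proof -
  obtain e where e: "e > 0" "(\<Union>x\<in>K. cball x e) \<subseteq> U"
    using compact_subset_open_imp_cball_epsilon_subset[OF assms] by blast
  have "tube K e \<subseteq> (\<Union>x\<in>K. cball x e)"
    unfolding tube_def using ball_subset_cball by blast
  with e show ?thesis by blast
qed

text \<open>Compactness bounds \<open>h\<close> on K only, since neighbourhoods of K need not be
  compact; the set where the norm stays below that bound plus 1 is open and contains K, hence a
  tube.\<close>

lemma compact_tube_bound:
  fixes K :: "'a::metric_space set" and h :: "'a \<Rightarrow> 'b::real_normed_vector"
  assumes "compact K" "open U" "K \<subseteq> U" "continuous_on U h"
  shows "\<exists>r>0. \<exists>M>0. tube K r \<subseteq> U \<and> (\<forall>x\<in>tube K r. norm (h x) \<le> M)"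
proof -
  have "bounded (h ` K)"
    using assms compact_continuous_image compact_imp_bounded continuous_on_subset by metis
  then obtain M where M: "M > 0" "\<And>x. x \<in> K \<Longrightarrow> norm (h x) \<le> M"
    unfolding bounded_pos by auto
  define V where "V = U \<inter> (\<lambda>x. norm (h x)) -` {..<M+1}"
  have "open V" unfolding V_def
    using assms by (intro continuous_open_preimage continuous_intros) auto
  moreover have "K \<subseteq> V" using M assms by (force simp: V_def)
  ultimately obtain r where "r > 0" "tube K r \<subseteq> V" using compact_tube_subset[OF assms(1)] by blast
  then show ?thesis using M by (intro exI[of _ r] conjI exI[of _ "M+1"]) (auto simp: V_def)
qed

subsection \<open>Inversion near the identity\<close>

text \<open>Solutions are the fixed points of \<open>y - R x\<close>, a contraction with factor 1/2.
  Half of the radius absorbs the variation of \<open>R\<close>, the other half the initial error, so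
  the closed ball is mapped into itself.\<close>

lemma Banach_perturbation:
  fixes R :: "'a::banach \<Rightarrow> 'a"
  assumes R: "\<And>x y. x \<in> cball a r \<Longrightarrow> y \<in> cball a r \<Longrightarrow> norm (R x - R y) \<le> norm (x - y) / 2"
    and y: "norm (y - (a + R a)) \<le> r / 2"
  shows "\<exists>x\<in>cball a r. x + R x = y"
proof -
  have r0: "r \<ge> 0" using y norm_ge_zero[of "y - (a + R a)"] by linarith
  have "\<exists>!x\<in>cball a r. y - R x = x"
  proof (rule Banach_fix[where c="1/2"])
    show "(\<lambda>x. y - R x) ` cball a r \<subseteq> cball a r"
    proof clarify
      fix x assume x: "x \<in> cball a r"
      have "norm (R x - R a) \<le> norm (x - a) / 2" using R[OF x] r0 by simp
      also have "\<dots> \<le> r / 2" using x by (simp add: dist_norm norm_minus_commute)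
      finally have "norm (R x - R a) \<le> r / 2" .
      then have "norm ((R x - R a) - (y - (a + R a))) \<le> r"
        using y norm_triangle_ineq4[of "R x - R a" "y - (a + R a)"] by linarith
      moreover have "a - (y - R x) = (R x - R a) - (y - (a + R a))" by simp
      ultimately show "y - R x \<in> cball a r"
        unfolding mem_cball dist_norm by metis
    qed
    show "dist (y - R x) (y - R z) \<le> 1/2 * dist x z" if "x \<in> cball a r" "z \<in> cball a r" for x z
      using R[OF that] by (simp add: dist_norm norm_minus_commute)
  qed (use r0 in \<open>auto simp: complete_eq_closed\<close>)
  then show ?thesis by (metis diff_add_cancel)
qed

text \<open>A total inverse, meaningful only for invertible operators; it is applied only within
  distance 1/2 of the identity.\<close>

definition binv :: "('a::real_normed_vector \<Rightarrow>\<^sub>L 'a) \<Rightarrow> ('a \<Rightarrow>\<^sub>L 'a)" where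
  "binv A = (SOME B. A o\<^sub>L B = id_blinfun \<and> B o\<^sub>L A = id_blinfun)"

lemma near_id_lower_bound:
  fixes A :: "'a::real_normed_vector \<Rightarrow>\<^sub>L 'a"
  assumes "norm (A - id_blinfun) \<le> 1/2"
  shows "norm x \<le> 2 * norm (A x)"
proof -
  have "norm (A x - x) \<le> 1/2 * norm x"
    using norm_blinfun[of "A - id_blinfun" x] mult_right_mono[OF assms norm_ge_zero[of x]]
    by (simp add: blinfun.bilinear_simps)
  then show ?thesis using norm_triangle_ineq2[of x "A x"] by (simp add: norm_minus_commute)
qed

text \<open>Surjectivity is the contraction argument with \<open>R = A - id\<close> on the ball of
  radius \<open>2 * norm y\<close>; injectivity and the norm bound 2 both come from
  \<open>near_id_lower_bound\<close>.\<close>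

lemma near_id_inverse:
  fixes A :: "'a::banach \<Rightarrow>\<^sub>L 'a"
  assumes A: "norm (A - id_blinfun) \<le> 1/2"
  shows "A o\<^sub>L binv A = id_blinfun" "binv A o\<^sub>L A = id_blinfun" "norm (binv A) \<le> 2"
proof -
  note lb = near_id_lower_bound[OF A]
  have surj: "\<exists>x. A x = y" for y
  proof -
    define R where "R x = (A - id_blinfun) x" for x
    have "\<exists>x\<in>cball 0 (2 * norm y). x + R x = y"
    proof (rule Banach_perturbation)
      show "norm (R x - R z) \<le> norm (x - z) / 2" for x z
        using norm_blinfun[of "A - id_blinfun" "x - z"] mult_right_mono[OF A norm_ge_zero[of "x - z"]]
        by (simp add: R_def blinfun.bilinear_simps)
    qed (simp add: R_def blinfun.bilinear_simps)
    then show ?thesis by (auto simp: R_def blinfun.bilinear_simps)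
  qed
  have inj: "x = z" if "A x = A z" for x z
    using lb[of "x - z"] that by (simp add: blinfun.bilinear_simps)
  define g where "g y = (THE x. A x = y)" for y
  have g: "A (g y) = y" for y
  proof -
    obtain x where "A x = y" using surj by blast
    then show ?thesis unfolding g_def by (rule theI) (use \<open>A x = y\<close> inj in auto)
  qed
  have gA: "g (A x) = x" for x using inj g by blast
  have gb: "norm (g y) \<le> 2 * norm y" for y using lb[of "g y"] g by simp
  have "bounded_linear g"
  proof (rule bounded_linear_intro[where K=2])
    show "g (x + y) = g x + g y" for x y by (rule inj) (simp add: g blinfun.bilinear_simps)
    show "g (r *\<^sub>R x) = r *\<^sub>R g x" for r x by (rule inj) (simp add: g blinfun.bilinear_simps)
  qed (use gb in \<open>simp add: mult.commute\<close>)
  then have G: "blinfun_apply (Blinfun g) = g" by (rule bounded_linear_Blinfun_apply)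
  have "\<exists>B. A o\<^sub>L B = id_blinfun \<and> B o\<^sub>L A = id_blinfun"
    by (rule exI[of _ "Blinfun g"]) (auto intro!: blinfun_eqI simp: G g gA)
  then have *: "A o\<^sub>L binv A = id_blinfun \<and> binv A o\<^sub>L A = id_blinfun"
    unfolding binv_def by (rule someI_ex)
  then show "A o\<^sub>L binv A = id_blinfun" "binv A o\<^sub>L A = id_blinfun" by auto
  show "norm (binv A) \<le> 2"
  proof (rule norm_blinfun_bound)
    fix x
    have "A (binv A x) = x" using * by (metis blinfun_apply_blinfun_compose blinfun_apply_id_blinfun)
    then show "norm (binv A x) \<le> 2 * norm x" using lb[of "binv A x"] by simp
  qed simp
qed

lemma near_id_inverse_apply:
  fixes A :: "'a::banach \<Rightarrow>\<^sub>L 'a"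
  assumes "norm (A - id_blinfun) \<le> 1/2"
  shows "A (binv A x) = x" "binv A (A x) = x"
  using near_id_inverse(1,2)[OF assms] by (metis blinfun_apply_blinfun_compose blinfun_apply_id_blinfun)+

text \<open>The resolvent identity
  \<open>A\<inverse> - B\<inverse> = A\<inverse> (B - A) B\<inverse>\<close> and the norm bound 2
  make inversion 4-Lipschitz.\<close>

lemma continuous_on_binv:
  fixes A :: "'b::topological_space \<Rightarrow> 'a::banach \<Rightarrow>\<^sub>L 'a"
  assumes cont: "continuous_on S A" and A: "\<And>x. x \<in> S \<Longrightarrow> norm (A x - id_blinfun) \<le> 1/2"
  shows "continuous_on S (\<lambda>x. binv (A x))"
proof -
  have d: "norm (binv (A x) - binv (A y)) \<le> 4 * norm (A x - A y)" if "x \<in> S" "y \<in> S" for x y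
  proof -
    have "binv (A x) - binv (A y) = binv (A x) o\<^sub>L (A y - A x) o\<^sub>L binv (A y)"
      by (rule blinfun_eqI)
        (simp add: blinfun.bilinear_simps near_id_inverse_apply[OF A] that)
    also have "norm \<dots> \<le> norm (binv (A x) o\<^sub>L (A y - A x)) * norm (binv (A y))" by (rule norm_blinfun_compose)
    also have "\<dots> \<le> (norm (binv (A x)) * norm (A y - A x)) * norm (binv (A y))"
      by (intro mult_right_mono norm_blinfun_compose) simp
    also have "\<dots> \<le> (2 * norm (A y - A x)) * 2"
      using near_id_inverse(3)[OF A] that by (intro mult_mono) auto
    finally show ?thesis by (simp add: norm_minus_commute)
  qed
  show ?thesis unfolding continuous_on
  proof
    fix x assume x: "x \<in> S"
    have "((\<lambda>y. 4 * norm (A y - A x)) \<longlongrightarrow> 4 * norm (A x - A x)) (at x within S)"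
      using cont x unfolding continuous_on by (intro tendsto_intros) auto
    then have "((\<lambda>y. 4 * norm (A y - A x)) \<longlongrightarrow> 0) (at x within S)" by simp
    moreover have "\<forall>\<^sub>F y in at x within S. norm (binv (A y) - binv (A x)) \<le> 4 * norm (A y - A x)"
      using d x by (auto simp: eventually_at_filter)
    ultimately show "((\<lambda>x. binv (A x)) \<longlongrightarrow> binv (A x)) (at x within S)"
      by (subst Lim_null) (rule Lim_null_comparison)
  qed
qed

text \<open>With derivative the identity at \<open>a\<close>, \<open>f\<close> is the identity plus
  a map with Lipschitz constant 1/2 on a small ball, so the contraction argument makes the image
  open. The later maps are all normalised to this case.\<close>

lemma inverse_function_near_id:
  fixes f :: "'a::banach \<Rightarrow> 'a"
  assumes f: "C1_with U f f'" and U: "open U" "a \<in> U" and id: "f' a = id_blinfun"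
  shows "\<exists>V g'. open V \<and> a \<in> V \<and> V \<subseteq> U \<and> inj_on f V \<and> open (f ` V) \<and> C1_with (f ` V) (inv_into V f) g'"
proof -
  have "continuous_on U (\<lambda>x. norm (f' x - id_blinfun))"
    using C1_withD(2)[OF f] by (intro continuous_intros)
  then have "open (U \<inter> (\<lambda>x. norm (f' x - id_blinfun)) -` {..<1/2})"
    using U by (intro continuous_open_preimage) auto
  moreover have "a \<in> U \<inter> (\<lambda>x. norm (f' x - id_blinfun)) -` {..<1/2}" using U id by auto
  ultimately obtain r where r: "r > 0" "ball a r \<subseteq> U \<inter> (\<lambda>x. norm (f' x - id_blinfun)) -` {..<1/2}"
    unfolding open_contains_ball by meson
  define V where "V = ball a r"
  have V: "open V" "a \<in> V" "V \<subseteq> U" using r by (auto simp: V_def)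
  have near: "norm (f' x - id_blinfun) \<le> 1/2" if "x \<in> V" for x
    using r that by (auto simp: V_def less_imp_le)
  define R where "R x = f x - x" for x
  have R: "norm (R x - R y) \<le> norm (x - y) / 2" if "x \<in> V" "y \<in> V" for x y
    using C1_with_bound_linear[OF f _ V(3) near that] by (simp add: V_def R_def algebra_simps)
  have lip: "norm (x - y) \<le> 2 * norm (f x - f y)" if "x \<in> V" "y \<in> V" for x y
  proof -
    have "x - y = (f x - f y) - (R x - R y)" by (simp add: R_def)
    then show ?thesis using R[OF that] norm_triangle_ineq4[of "f x - f y" "R x - R y"] by simp
  qed
  have inj: "inj_on f V" using lip by (force simp: inj_on_def)
  have op: "open (f ` V)" unfolding open_contains_ball
  proof clarify
    fix x assume x: "x \<in> V"
    obtain s where s: "s > 0" "cball x s \<subseteq> V" using V(1) x open_contains_cball by blast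
    have "ball (f x) (s/2) \<subseteq> f ` V"
    proof
      fix y assume y: "y \<in> ball (f x) (s/2)"
      have "\<exists>z\<in>cball x s. z + R z = y"
      proof (rule Banach_perturbation)
        show "norm (R u - R z) \<le> norm (u - z) / 2" if "u \<in> cball x s" "z \<in> cball x s" for u z
          using R s that by blast
        show "norm (y - (x + R x)) \<le> s / 2" using y by (simp add: R_def dist_norm norm_minus_commute)
      qed
      then show "y \<in> f ` V" using s by (auto simp: R_def)
    qed
    then show "\<exists>e>0. ball (f x) e \<subseteq> f ` V" using s by (intro exI[of _ "s/2"]) auto
  qed
  define g where "g = inv_into V f"
  have g: "g y \<in> V" "f (g y) = y" if "y \<in> f ` V" for y
    using that by (auto simp: g_def inv_into_into f_inv_into_f)
  have cg: "continuous_on (f ` V) g"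
  proof (rule continuous_on_iff[THEN iffD2], intro ballI allI impI)
    fix y and e :: real assume y: "y \<in> f ` V" "e > 0"
    show "\<exists>d>0. \<forall>x'\<in>f ` V. dist x' y < d \<longrightarrow> dist (g x') (g y) < e"
    proof (intro exI[of _ "e/2"] conjI ballI impI)
      fix z assume z: "z \<in> f ` V" "dist z y < e/2"
      then show "dist (g z) (g y) < e"
        using lip[OF g(1)[OF z(1)] g(1)[OF y(1)]] g(2) y by (simp add: dist_norm)
    qed (use y in auto)
  qed
  define g' where "g' y = binv (f' (g y))" for y
  have "continuous_on (f ` V) (\<lambda>y. f' (g y))"
    using C1_withD(2)[OF f] V g by (intro continuous_on_compose2[OF _ cg, of U]) auto
  then have "continuous_on (f ` V) g'" unfolding g'_def
    by (rule continuous_on_binv) (use near g in auto)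
  moreover have "(g has_derivative g' y) (at y)" if y: "y \<in> f ` V" for y
  proof (rule has_derivative_inverse_basic[OF _ _ _ _ op y])
    show "(f has_derivative f' (g y)) (at (g y))"
      using C1_withD(1)[OF f] g[OF y] V by blast
    show "blinfun_apply (g' y) \<circ> blinfun_apply (f' (g y)) = id"
      using near_id_inverse_apply(2)[OF near[OF g(1)[OF y]]] by (auto simp: g'_def)
    show "continuous (at y) g" using cg op y continuous_on_eq_continuous_at by blast
  qed (use g in \<open>auto intro: blinfun.bounded_linear_right\<close>)
  ultimately have "C1_with (f ` V) g g'" by (simp add: C1_with_def)
  then show ?thesis using V inj op unfolding g_def by blast
qed

subsection \<open>A retraction onto the projections\<close>

text \<open>If \<open>Y\<close> commutes with \<open>S\<close>, then
  \<open>P - P^2 = N + W (1 - 4 N)\<close>, because \<open>(1 - 2 S)^2 = 1 - 4 N\<close>. The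
  hypothesis \<open>eq\<close> is therefore the condition that \<open>P\<close> be idempotent, once
  commutation is known; smallness of \<open>N\<close> and \<open>Y\<close> forces the
  commutation.\<close>

lemma near_projection_correction:
  fixes S Y :: "'a::banach \<Rightarrow>\<^sub>L 'a"
  defines "N \<equiv> S - (S o\<^sub>L S)" and "W \<equiv> Y - (Y o\<^sub>L Y)"
  assumes N: "norm N \<le> 1/8" and Y: "norm Y \<le> 1/4" and eq: "W - 4 *\<^sub>R (N o\<^sub>L W) = - N"
  defines "P \<equiv> S + Y - 2 *\<^sub>R (S o\<^sub>L Y)"
  shows "P o\<^sub>L P = P"
proof -
  have E: "W x - 4 *\<^sub>R N (W x) = - N x" for x
    using arg_cong[OF eq, of "\<lambda>A. blinfun_apply A x"] by (simp add: blinfun.bilinear_simps)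
  have NS: "N (S x) = S (N x)" for x by (simp add: N_def blinfun.bilinear_simps)
  define A where "A = id_blinfun - 4 *\<^sub>R N"
  have A: "norm (A - id_blinfun) \<le> 1/2" using N by (simp add: A_def)
  \<comment> \<open>\<open>N\<close> commutes with \<open>S\<close>, so the commutator of
    \<open>W\<close> and \<open>S\<close> is annihilated by the invertible operator
    \<open>id - 4 N\<close>.\<close>
  have WS: "W (S x) = S (W x)" for x
  proof -
    have "A (W (S x) - S (W x)) = (W (S x) - 4 *\<^sub>R N (W (S x))) - S (W x - 4 *\<^sub>R N (W x))"
      by (simp add: A_def blinfun.bilinear_simps NS algebra_simps)
    also have "\<dots> = 0" unfolding E by (simp add: blinfun.bilinear_simps NS)
    finally show ?thesis using near_id_lower_bound[OF A, of "W (S x) - S (W x)"] by simp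
  qed
  \<comment> \<open>Commutation of \<open>W\<close> with \<open>S\<close> gives
    \<open>C = Y C + C Y\<close>; as \<open>Y\<close> has norm at most 1/4, \<open>C\<close> is at
    most half of itself and vanishes.\<close>
  define C where "C = (Y o\<^sub>L S) - (S o\<^sub>L Y)"
  have "C = (Y o\<^sub>L C) + (C o\<^sub>L Y)"
  proof (rule blinfun_eqI)
    fix x show "C x = ((Y o\<^sub>L C) + (C o\<^sub>L Y)) x"
      using WS[of x] by (simp add: C_def W_def blinfun.bilinear_simps algebra_simps)
  qed
  then have "norm C \<le> norm Y * norm C + norm C * norm Y"
    using norm_triangle_le[OF add_mono[OF norm_blinfun_compose[of Y C] norm_blinfun_compose[of C Y]]] by simp
  also have "\<dots> \<le> 1/4 * norm C + norm C * (1/4)"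
    using Y by (intro add_mono mult_right_mono mult_left_mono) auto
  finally have "C = 0" by simp
  then have YS: "Y (S x) = S (Y x)" for x
    unfolding C_def by (metis blinfun_apply_blinfun_compose right_minus_eq)
  show ?thesis
  proof (rule blinfun_eqI)
    fix x
    have four: "4 *\<^sub>R v = v + v + v + v" for v :: 'a
      using scaleR_left_distrib[of 2 2 v] by (simp add: scaleR_2 add.assoc)
    have "P (P x) - P x = - (W x - 4 *\<^sub>R N (W x) + N x)"
      using four by (simp add: P_def W_def N_def blinfun.bilinear_simps YS algebra_simps scaleR_2)
    then show "(P o\<^sub>L P) x = P x" using E[of x] by simp
  qed
qed

text \<open>The equation of \<open>near_projection_correction\<close> is solved for \<open>Y\<close>
  by inverting \<open>h\<close> near 0, where its derivative is the identity. It involves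
  \<open>S\<close> only through the defect \<open>S - S^2\<close>, so one threshold
  \<open>\<delta>\<close> serves operators of every norm; the norm of \<open>S\<close> enters only
  the error estimate.\<close>

lemma projection_retraction:
  fixes e :: real
  assumes "e > 0"
  shows "\<exists>\<delta>>0. \<exists>R R'. C1_with {S :: 'a::banach \<Rightarrow>\<^sub>L 'a. norm ((S o\<^sub>L S) - S) < \<delta>} R R' \<and>
    (\<forall>S. norm ((S o\<^sub>L S) - S) < \<delta> \<longrightarrow> bounded_projection (R S) \<and> norm (R S - S) \<le> e * (1 + 2 * norm S))"
proof -
  define h :: "('a \<Rightarrow>\<^sub>L 'a) \<times> ('a \<Rightarrow>\<^sub>L 'a) \<Rightarrow> ('a \<Rightarrow>\<^sub>L 'a) \<times> ('a \<Rightarrow>\<^sub>L 'a)" where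
    "h z = (fst z, (snd z - (snd z o\<^sub>L snd z)) - 4 *\<^sub>R (fst z o\<^sub>L (snd z - (snd z o\<^sub>L snd z))))" for z
  note lin = C1_with_linear[of UNIV fst_blinfun, simplified] C1_with_linear[of UNIV snd_blinfun, simplified]
  note comp = C1_with_bilinear[OF bounded_bilinear_blinfun_compose]
  obtain w' where w': "C1_with UNIV (\<lambda>z :: ('a \<Rightarrow>\<^sub>L 'a) \<times> ('a \<Rightarrow>\<^sub>L 'a). snd z - (snd z o\<^sub>L snd z)) w'"
    using C1_with_diff[OF lin(2) comp[OF lin(2) lin(2)]] by blast
  obtain u' where u': "C1_with UNIV (\<lambda>z :: ('a \<Rightarrow>\<^sub>L 'a) \<times> ('a \<Rightarrow>\<^sub>L 'a). (snd z - (snd z o\<^sub>L snd z)) -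
      4 *\<^sub>R (fst z o\<^sub>L (snd z - (snd z o\<^sub>L snd z)))) u'"
    using C1_with_diff[OF w' C1_with_scaleR[OF C1_with_const comp[OF lin(1) w']]] by blast
  obtain h' where h': "C1_with UNIV h h'"
    using C1_with_Pair[OF lin(1) u'] unfolding h_def by auto
  have "(h has_derivative (\<lambda>v. v)) (at 0)"
    unfolding h_def by (auto intro!: derivative_eq_intros simp: zero_prod_def)
  then have "blinfun_apply (h' 0) = (\<lambda>v. v)"
    using C1_withD(1)[OF h', of 0] has_derivative_unique by blast
  then have "h' 0 = id_blinfun" by (intro blinfun_eqI) simp
  then obtain V k' where V: "open V" "0 \<in> V" "inj_on h V" "open (h ` V)" and k': "C1_with (h ` V) (inv_into V h) k'"
    using inverse_function_near_id[OF h' open_UNIV UNIV_I] by blast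
  define k where "k = inv_into V h"
  have h0: "h 0 = 0" by (simp add: h_def zero_prod_def)
  have hV: "0 \<in> h ` V" using V h0 by force
  have k0: "k 0 = 0" using V h0 unfolding k_def by (metis inv_into_f_f)
  have hk: "h (k z) = z" if "z \<in> h ` V" for z using that by (simp add: k_def f_inv_into_f)
  have "open (h ` V \<inter> k -` ball 0 (min e (1/4)))"
    using C1_with_continuous_on[OF k'] V unfolding k_def[symmetric] by (intro continuous_open_preimage) auto
  moreover have "0 \<in> h ` V \<inter> k -` ball 0 (min e (1/4))" using hV k0 assms by simp
  ultimately obtain r where r: "r > 0" "ball 0 r \<subseteq> h ` V \<inter> k -` ball 0 (min e (1/4))"
    unfolding open_contains_ball by meson
  \<comment> \<open>The pair \<open>(N, -N)\<close> has norm at most twice that of \<open>N\<close>,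
    hence \<open>r/2\<close>; 1/8 is the smallness asked for by
    \<open>near_projection_correction\<close>.\<close>
  define \<delta> where "\<delta> = min (r/2) (1/8)"
  have \<delta>: "\<delta> > 0" using r by (simp add: \<delta>_def)
  define \<Omega> where "\<Omega> = {S :: 'a \<Rightarrow>\<^sub>L 'a. norm ((S o\<^sub>L S) - S) < \<delta>}"
  define N where "N S = S - (S o\<^sub>L S)" for S :: "'a \<Rightarrow>\<^sub>L 'a"
  have N: "norm (N S) < \<delta>" if "S \<in> \<Omega>" for S using that by (simp add: N_def \<Omega>_def norm_minus_commute)
  have inb: "(N S, - N S) \<in> ball 0 r" if "S \<in> \<Omega>" for S
    using N[OF that] norm_Pair_le[of "N S" "- N S"] by (simp add: \<delta>_def)
  define Y where "Y S = snd (k (N S, - N S))" for S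
  define R where "R S = S + Y S - 2 *\<^sub>R (S o\<^sub>L Y S)" for S
  obtain N' where N': "C1_with \<Omega> N N'"
    using C1_with_diff[OF C1_with_ident comp[OF C1_with_ident C1_with_ident]] unfolding N_def by blast
  obtain p' where p': "C1_with \<Omega> (\<lambda>S. (N S, - N S)) p'"
    using C1_with_Pair[OF N' C1_with_diff[OF C1_with_const[of _ 0] N']] by auto
  have "C1_with \<Omega> (\<lambda>S. k (N S, - N S)) (\<lambda>S. k' (N S, - N S) o\<^sub>L p' S)"
    using C1_with_compose[OF p' k'] inb r unfolding k_def[symmetric] by blast
  then obtain Y' where "C1_with \<Omega> Y Y'"
    using C1_with_blinfun_compose[of \<Omega> _ _ snd_blinfun] unfolding Y_def by fastforce
  then obtain R' where R': "C1_with \<Omega> R R'"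
    using C1_with_diff[OF C1_with_add[OF C1_with_ident] C1_with_scaleR[OF C1_with_const comp[OF C1_with_ident]]]
    unfolding R_def by blast
  have "bounded_projection (R S) \<and> norm (R S - S) \<le> e * (1 + 2 * norm S)" if S: "S \<in> \<Omega>" for S
  proof -
    have z: "(N S, - N S) \<in> h ` V" "k (N S, - N S) \<in> ball 0 (min e (1/4))" using inb[OF S] r by auto
    have Yn: "norm (Y S) < min e (1/4)"
      using z(2) norm_snd_le[of "Y S" "fst (k (N S, - N S))"] by (simp add: Y_def)
    have "fst (k (N S, - N S)) = N S" using hk[OF z(1)] by (simp add: h_def)
    then have "(Y S - (Y S o\<^sub>L Y S)) - 4 *\<^sub>R (N S o\<^sub>L (Y S - (Y S o\<^sub>L Y S))) = - N S"
      using hk[OF z(1)] by (simp add: h_def Y_def)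
    then have "R S o\<^sub>L R S = R S" unfolding R_def N_def
      using N[OF S] Yn by (intro near_projection_correction) (auto simp: N_def \<delta>_def)
    moreover have "norm (R S - S) \<le> e * (1 + 2 * norm S)"
    proof -
      have "norm (R S - S) \<le> norm (Y S) + 2 * norm (S o\<^sub>L Y S)"
        using norm_triangle_ineq4[of "Y S" "2 *\<^sub>R (S o\<^sub>L Y S)"] by (simp add: R_def algebra_simps)
      also have "\<dots> \<le> norm (Y S) + 2 * (norm S * norm (Y S))" using norm_blinfun_compose[of S "Y S"] by simp
      also have "\<dots> = norm (Y S) * (1 + 2 * norm S)" by (simp add: algebra_simps)
      also have "\<dots> \<le> e * (1 + 2 * norm S)" using Yn by (intro mult_right_mono) auto
      finally show ?thesis .
    qed
    ultimately show ?thesis by (simp add: bounded_projection_def)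
  qed
  then show ?thesis using \<delta> R' unfolding \<Omega>_def by blast
qed

subsection \<open>A norming functional\<close>

definition sublinear_le_norm :: "('a::real_normed_vector \<Rightarrow> real) \<Rightarrow> bool" where
  "sublinear_le_norm p \<longleftrightarrow> (\<forall>x y. p (x + y) \<le> p x + p y) \<and>
     (\<forall>t\<ge>0. \<forall>x. p (t *\<^sub>R x) \<le> t * p x) \<and> (\<forall>x. p x \<le> norm x)"

text \<open>The Hahn-Banach modification of \<open>p\<close> that is at most \<open>p\<close> and
  takes a value at most \<open>- p v\<close> at \<open>-v\<close>, which makes it additive in the
  direction \<open>v\<close>.\<close>

definition lower_along :: "('a::real_normed_vector \<Rightarrow> real) \<Rightarrow> 'a \<Rightarrow> 'a \<Rightarrow> real" where
  "lower_along p v x = (INF t\<in>{0..}. p (x + t *\<^sub>R v) - t * p v)"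

context
  fixes p :: "'a::real_normed_vector \<Rightarrow> real"
  assumes p: "sublinear_le_norm p"
begin

lemma sublinear_props:
  "p (x + y) \<le> p x + p y" "t \<ge> 0 \<Longrightarrow> p (t *\<^sub>R x) = t * p x" "p x \<le> norm x" "p 0 = 0" "- norm x \<le> p x" "- p (-x) \<le> p x"
proof -
  show sub: "p (x + y) \<le> p x + p y" for x y using p by (simp add: sublinear_le_norm_def)
  have hom: "p (t *\<^sub>R x) \<le> t * p x" if "t \<ge> 0" for t x using p that by (simp add: sublinear_le_norm_def)
  show le: "p x \<le> norm x" for x using p by (simp add: sublinear_le_norm_def)
  show 0: "p 0 = 0" using sub[of 0 0] le[of 0] by simp
  show m: "- p (-x) \<le> p x" for x using sub[of x "-x"] 0 by simp
  show "- norm x \<le> p x" using m[of x] le[of "-x"] by simp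
  show "p (t *\<^sub>R x) = t * p x" if "t \<ge> 0"
  proof (cases "t = 0")
    case False
    have "p x \<le> inverse t * p (t *\<^sub>R x)" using hom[of "inverse t" "t *\<^sub>R x"] that False by simp
    then have "t * p x \<le> p (t *\<^sub>R x)" using that False by (simp add: field_simps)
    then show ?thesis using hom[OF that, of x] by simp
  qed (simp add: 0)
qed

lemma lower_along_bdd: "bdd_below ((\<lambda>t. p (x + t *\<^sub>R v) - t * p v) ` {0..})"
proof (rule bdd_belowI2[where m="- p (- x)"])
  fix t :: real assume "t \<in> {0..}"
  then have "t * p v = p ((x + t *\<^sub>R v) + (- x))" using sublinear_props(2)[of t v] by simp
  also have "\<dots> \<le> p (x + t *\<^sub>R v) + p (- x)" by (rule sublinear_props(1))
  finally show "- p (- x) \<le> p (x + t *\<^sub>R v) - t * p v" by simp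
qed

lemma lower_along_le: "t \<ge> 0 \<Longrightarrow> lower_along p v x \<le> p (x + t *\<^sub>R v) - t * p v"
  unfolding lower_along_def by (rule cINF_lower[OF lower_along_bdd]) simp

lemma sublinear_lower_along: "sublinear_le_norm (lower_along p v)"
  unfolding sublinear_le_norm_def
proof (intro conjI allI impI)
  fix x y
  have "lower_along p v (x + y) - (p (x + t *\<^sub>R v) - t * p v) \<le> lower_along p v y" if t: "t \<ge> 0" for t
    unfolding lower_along_def[of p v y]
  proof (rule cINF_greatest)
    fix s :: real assume "s \<in> {0..}"
    then have "lower_along p v (x + y) \<le> p (x + y + (t + s) *\<^sub>R v) - (t + s) * p v"
      using t by (intro lower_along_le) simp
    also have "\<dots> \<le> (p (x + t *\<^sub>R v) - t * p v) + (p (y + s *\<^sub>R v) - s * p v)"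
      using sublinear_props(1)[of "x + t *\<^sub>R v" "y + s *\<^sub>R v"] by (simp add: algebra_simps)
    finally show "lower_along p v (x + y) - (p (x + t *\<^sub>R v) - t * p v) \<le> p (y + s *\<^sub>R v) - s * p v" by simp
  qed simp
  then have "lower_along p v (x + y) - lower_along p v y \<le> p (x + t *\<^sub>R v) - t * p v" if "t \<ge> 0" for t
    using that by (smt (verit))
  then have "lower_along p v (x + y) - lower_along p v y \<le> lower_along p v x"
    unfolding lower_along_def[of p v x] by (intro cINF_greatest) auto
  then show "lower_along p v (x + y) \<le> lower_along p v x + lower_along p v y" by simp
next
  fix c :: real and x assume c: "c \<ge> 0"
  show "lower_along p v (c *\<^sub>R x) \<le> c * lower_along p v x"
  proof (cases "c = 0")
    case True
    then show ?thesis using lower_along_le[of 0 v 0] sublinear_props(4) by simp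
  next
    case False
    have "lower_along p v (c *\<^sub>R x) / c \<le> lower_along p v x" unfolding lower_along_def[of p v x]
    proof (rule cINF_greatest)
      fix t :: real assume t: "t \<in> {0..}"
      have "lower_along p v (c *\<^sub>R x) \<le> p (c *\<^sub>R x + (c * t) *\<^sub>R v) - (c * t) * p v"
        using c t by (intro lower_along_le) simp
      also have "c *\<^sub>R x + (c * t) *\<^sub>R v = c *\<^sub>R (x + t *\<^sub>R v)" by (simp add: scaleR_add_right)
      also have "p \<dots> - (c * t) * p v = c * (p (x + t *\<^sub>R v) - t * p v)"
        by (subst sublinear_props(2)[OF c]) (simp add: algebra_simps)
      finally show "lower_along p v (c *\<^sub>R x) / c \<le> p (x + t *\<^sub>R v) - t * p v"
        using c False by (simp add: field_simps)
    qed simp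
    then show ?thesis using c False by (simp add: field_simps)
  qed
next
  show "lower_along p v x \<le> norm x" for x
    using lower_along_le[of 0 v x] sublinear_props(3)[of x] by simp
qed

end

lemma sublinear_norm: "sublinear_le_norm norm"
  by (simp add: sublinear_le_norm_def norm_triangle_ineq)

text \<open>A minimal sublinear functional is linear, because lowering it along any vector cannot change it.\<close>

lemma exists_norming_functional:
  fixes e :: "'a::real_normed_vector"
  assumes "e \<noteq> 0"
  shows "\<exists>l :: 'a \<Rightarrow>\<^sub>L real. l e = 1"
proof -
  \<comment> \<open>Starting the Zorn argument below \<open>p0\<close> instead of the norm forces
    every linear \<open>m \<le> p0\<close> to satisfy \<open>m e \<ge> norm e\<close>, so the
    minimal functional is not 0 at \<open>e\<close>.\<close>
  define p0 :: "'a \<Rightarrow> real" where "p0 = lower_along norm e"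
  have p0: "sublinear_le_norm p0" unfolding p0_def by (rule sublinear_lower_along[OF sublinear_norm])
  have p0e: "p0 (- e) \<le> - norm e"
    using lower_along_le[OF sublinear_norm, of 1 e "-e"] by (simp add: p0_def)
  define A where "A = {p. sublinear_le_norm p \<and> p \<le> p0}"
  define ge where "ge p q \<longleftrightarrow> q \<le> p" for p q :: "'a \<Rightarrow> real"
  have "\<exists>m\<in>A. \<forall>a\<in>A. ge m a \<longrightarrow> a = m"
  proof (rule predicate_Zorn)
    show "partial_order_on A (relation_of ge A)"
      by (rule partial_order_on_relation_ofI) (auto simp: ge_def)
  next
    fix C assume C: "C \<in> Chains (relation_of ge A)"
    then have CA: "C \<subseteq> A" by (auto simp: Chains_def relation_of_def)
    show "\<exists>u\<in>A. \<forall>a\<in>C. ge a u"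
    proof (cases "C = {}")
      case True
      then show ?thesis using p0 by (auto simp: A_def)
    next
      case False
      define u where "u x = (INF p\<in>C. p x)" for x
      have sC: "sublinear_le_norm p" if "p \<in> C" for p using CA that by (auto simp: A_def)
      have bdd: "bdd_below ((\<lambda>p. p x) ` C)" for x
        by (rule bdd_belowI2[where m="- norm x"]) (use sublinear_props(5)[OF sC] in auto)
      have ule: "u x \<le> p x" if "p \<in> C" for p x unfolding u_def by (rule cINF_lower[OF bdd that])
      have cmp: "(\<forall>x. p x \<le> q x) \<or> (\<forall>x. q x \<le> p x)" if "p \<in> C" "q \<in> C" for p q
        using C that unfolding Chains_def relation_of_def ge_def le_fun_def by blast
      have "u (x + y) \<le> u x + u y" for x y
      proof -
        have "u (x + y) - p x \<le> u y" if pC: "p \<in> C" for p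
          unfolding u_def[of y]
        proof (rule cINF_greatest[OF False])
          fix q assume q: "q \<in> C"
          \<comment> \<open>The smaller of \<open>p\<close> and \<open>q\<close> in the chain lies
            below \<open>p\<close> at \<open>x\<close> and below \<open>q\<close> at
            \<open>y\<close>, so subadditivity of one functional passes to the infimum.\<close>
          obtain s where s: "s \<in> C" "s x \<le> p x" "s y \<le> q y" using cmp[OF pC q] pC q by blast
          show "u (x + y) - p x \<le> q y"
            using ule[OF s(1), of "x + y"] sublinear_props(1)[OF sC[OF s(1)], of x y] s by simp
        qed
        then have "u (x + y) - u y \<le> p x" if "p \<in> C" for p using that by (smt (verit))
        then have "u (x + y) - u y \<le> u x" unfolding u_def[of x] by (intro cINF_greatest[OF False])
        then show ?thesis by simp
      qed
      moreover have "u (t *\<^sub>R x) \<le> t * u x" if t: "t \<ge> 0" for t x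
      proof (cases "t = 0")
        case True
        obtain p where "p \<in> C" using False by blast
        then show ?thesis using ule[of p 0] sublinear_props(4)[OF sC, of p] True by simp
      next
        case nz: False
        have "u (t *\<^sub>R x) / t \<le> u x" unfolding u_def[of x]
        proof (rule cINF_greatest[OF False])
          fix p assume "p \<in> C"
          then show "u (t *\<^sub>R x) / t \<le> p x"
            using ule[of p "t *\<^sub>R x"] sublinear_props(2)[OF sC t, of p x] t nz by (simp add: field_simps)
        qed
        then show ?thesis using t nz by (simp add: field_simps)
      qed
      moreover obtain p where p: "p \<in> C" using False by blast
      moreover have "u x \<le> norm x" for x
        using ule[OF p, of x] sublinear_props(3)[OF sC[OF p], of x] by simp
      ultimately have "sublinear_le_norm u" by (simp add: sublinear_le_norm_def)
      moreover have "u \<le> p0"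
        using ule[OF p] CA p unfolding A_def le_fun_def by (blast intro: order_trans)
      ultimately show ?thesis using ule unfolding A_def ge_def le_fun_def by blast
    qed
  qed
  then obtain m where m: "sublinear_le_norm m" "m \<le> p0" and
    min: "\<And>a. sublinear_le_norm a \<Longrightarrow> a \<le> p0 \<Longrightarrow> a \<le> m \<Longrightarrow> a = m"
    by (auto simp: A_def ge_def)
  have add: "m (x + v) = m x + m v" for x v
  proof -
    have "lower_along m v \<le> m" using lower_along_le[OF m(1), of 0 v] by (simp add: le_fun_def)
    then have "lower_along m v = m"
      using m(2) by (intro min sublinear_lower_along[OF m(1)]) auto
    then have "m x \<le> m (x + v) - m v" using lower_along_le[OF m(1), of 1 v x] by simp
    then show ?thesis using sublinear_props(1)[OF m(1), of x v] by simp
  qed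
  have neg: "m (- x) = - m x" for x using add[of x "-x"] sublinear_props(4)[OF m(1)] by simp
  have scale: "m (t *\<^sub>R x) = t * m x" for t x
  proof (cases "t \<ge> 0")
    case False
    then have "m ((- t) *\<^sub>R x) = (- t) * m x" by (intro sublinear_props(2)[OF m(1)]) simp
    then show ?thesis using neg[of "t *\<^sub>R x"] by simp
  qed (rule sublinear_props(2)[OF m(1)])
  have "bounded_linear m"
  proof (rule bounded_linear_intro[where K=1])
    show "norm (m x) \<le> norm x * 1" for x
      using sublinear_props(3)[OF m(1), of x] sublinear_props(5)[OF m(1), of x] by (simp add: abs_le_iff)
  qed (simp_all add: add scale)
  then have M: "blinfun_apply (Blinfun m) = m" by (rule bounded_linear_Blinfun_apply)
  have "m (- e) \<le> - norm e" using m(2) p0e unfolding le_fun_def by (meson order_trans)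
  then have "m e > 0" using assms neg[of e] zero_less_norm_iff[of e] by linarith
  then have "((1 / m e) *\<^sub>R Blinfun m) e = 1" by (simp add: scaleR_blinfun.rep_eq M)
  then show ?thesis by blast
qed

subsection \<open>A smooth step\<close>

definition pos_sq :: "real \<Rightarrow> real" where "pos_sq t = (max 0 t)\<^sup>2"

text \<open>A composition of two C1 functions that equals 1 up to 0 and 0 from 1 on. The second
  derivative jumps, but C1 with a bounded derivative is all that is asked.\<close>

definition step_down :: "real \<Rightarrow> real" where "step_down t = pos_sq (1 - pos_sq t)"

lemma pos_sq_C1: "C1_with UNIV pos_sq (\<lambda>t. blinfun_scaleR_left (2 * max 0 t))"
proof -
  have "(pos_sq has_derivative (\<lambda>h. h *\<^sub>R (2 * max 0 t))) (at t)" for t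
  proof (cases "t = 0")
    case False
    have "((\<lambda>t. if t > 0 then t\<^sup>2 else 0) has_real_derivative (2 * max 0 t)) (at t)"
    proof (cases "t > 0")
      case True
      have "((\<lambda>t::real. t\<^sup>2) has_real_derivative (2 * max 0 t)) (at t)"
        using True by (auto intro!: derivative_eq_intros)
      then show ?thesis
        by (rule has_field_derivative_transform_within_open[of _ _ _ "{0<..}"]) (use True in auto)
    next
      case nt: False
      have "((\<lambda>t::real. 0) has_real_derivative (2 * max 0 t)) (at t)" using nt by simp
      then show ?thesis
        by (rule has_field_derivative_transform_within_open[of _ _ _ "{..<0}"]) (use nt \<open>t \<noteq> 0\<close> in auto)
    qed
    moreover have "(\<lambda>t. if t > 0 then t\<^sup>2 else 0) = pos_sq" by (auto simp: pos_sq_def max_def)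
    ultimately show ?thesis by (simp add: has_field_derivative_def mult.commute[of "2 * _"] mult_commute_abs)
  next
    case True
    have "((\<lambda>h. pos_sq (0 + h) / h) \<longlongrightarrow> 0) (at 0)"
    proof (rule Lim_null_comparison)
      show "\<forall>\<^sub>F h in at 0. norm (pos_sq (0 + h) / h) \<le> norm h"
        by (rule always_eventually) (auto simp: pos_sq_def max_def power2_eq_square)
      show "((\<lambda>h::real. norm h) \<longlongrightarrow> 0) (at 0)" by (intro tendsto_norm_zero tendsto_ident_at)
    qed
    then have "(pos_sq has_real_derivative 0) (at 0)" by (simp add: DERIV_def pos_sq_def)
    moreover have "(*) 0 = (\<lambda>h::real. 0)" by auto
    ultimately show ?thesis using True by (simp add: has_field_derivative_def)
  qed
  then have "(pos_sq has_derivative blinfun_scaleR_left (2 * max 0 t)) (at t)" for t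
    by simp
  moreover have "continuous_on UNIV (\<lambda>t::real. blinfun_scaleR_left (2 * max 0 t))"
    by (intro bounded_linear.continuous_on[OF bounded_linear_blinfun_scaleR_left] continuous_intros)
  ultimately show ?thesis by (simp add: C1_with_def)
qed

lemma step_down_C1: "\<exists>s'. C1_with UNIV step_down s' \<and> (\<forall>t. norm (s' t) \<le> 4)"
proof -
  define s' where "s' t = blinfun_scaleR_left (2 * max 0 (1 - pos_sq t)) o\<^sub>L (0 - blinfun_scaleR_left (2 * max 0 t))" for t :: real
  have "C1_with UNIV step_down s'"
    using C1_with_compose[OF C1_with_diff[OF C1_with_const pos_sq_C1] pos_sq_C1, of 1]
    unfolding step_down_def s'_def by simp
  moreover have "norm (s' t) \<le> 4" for t
  proof (rule norm_blinfun_bound)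
    fix x :: real
    have "\<bar>max 0 t * max 0 (1 - (max 0 t)\<^sup>2)\<bar> \<le> 1 * 1"
    proof (cases "t \<le> 1")
      case True then show ?thesis by (subst abs_mult, intro mult_mono) (auto simp: max_def power_le_one)
    next
      case False
      then have "t\<^sup>2 > 1" by (simp add: one_less_power)
      then have "1 - (max 0 t)\<^sup>2 \<le> 0" using False by simp
      then have "max 0 (1 - (max 0 t)\<^sup>2) = 0" by simp
      then show ?thesis by simp
    qed
    then have "\<bar>max 0 t * max 0 (1 - (max 0 t)\<^sup>2)\<bar> * \<bar>x\<bar> \<le> 1 * \<bar>x\<bar>" by (intro mult_right_mono) auto
    then show "norm (s' t x) \<le> 4 * norm x"
      by (simp add: s'_def pos_sq_def blinfun.bilinear_simps abs_mult mult_ac)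
  qed simp
  ultimately show ?thesis by blast
qed

lemma step_down_bounds: "0 \<le> step_down t" "step_down t \<le> 1"
proof -
  show "0 \<le> step_down t" by (simp add: step_down_def pos_sq_def)
  have "0 \<le> pos_sq t" by (simp add: pos_sq_def)
  then show "step_down t \<le> 1" by (simp add: step_down_def pos_sq_def[of "1 - pos_sq t"] max_def power_le_one)
qed

lemma step_down_eq: "t \<le> 0 \<Longrightarrow> step_down t = 1" "1 \<le> t \<Longrightarrow> step_down t = 0"
proof -
  show "t \<le> 0 \<Longrightarrow> step_down t = 1" by (simp add: step_down_def pos_sq_def max_def)
  assume "1 \<le> t"
  then have "t\<^sup>2 \<ge> 1" by (rule one_le_power)
  then have "1 - (max 0 t)\<^sup>2 \<le> 0" using \<open>1 \<le> t\<close> by simp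
  then have "max 0 (1 - (max 0 t)\<^sup>2) = 0" by simp
  then show "step_down t = 0" by (simp add: step_down_def pos_sq_def)
qed

subsection \<open>Consequences of property \<open>(*)\<close>\<close>

lemma bounded_projection_apply: "bounded_projection P \<Longrightarrow> P (P x) = P x"
  unfolding bounded_projection_def by (metis blinfun_apply_blinfun_compose)

lemma range_projection: "bounded_projection P \<Longrightarrow> x \<in> range (blinfun_apply P) \<longleftrightarrow> P x = x"
  using bounded_projection_apply by (metis rangeE rangeI)

lemma bounded_projection_complement:
  "bounded_projection P \<Longrightarrow> bounded_projection (id_blinfun - P)"
  using bounded_projection_apply[of P] unfolding bounded_projection_def[of "id_blinfun - P"]
  by (intro blinfun_eqI) (simp add: blinfun.bilinear_simps)

text \<open>Property star controls Lipschitz constants, while gluing needs bounds on derivatives;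
  this converts the former into the latter.\<close>

lemma has_derivative_lipschitz_bound:
  fixes f' :: "'a::real_normed_vector \<Rightarrow>\<^sub>L 'b::real_normed_vector"
  assumes f: "(f has_derivative f') (at x)" and B: "0 \<le> B"
    and lip: "\<And>y. norm (f y - f x) \<le> B * norm (y - x)"
  shows "norm f' \<le> B"
proof (rule norm_blinfun_bound[OF B])
  show "norm (f' v) \<le> B * norm v" for v
  proof (rule field_le_epsilon)
    fix e :: real assume e: "e > 0"
    define \<eta> where "\<eta> = e / (norm v + 1)"
    have \<eta>: "\<eta> > 0" using e by (simp add: \<eta>_def add_nonneg_pos)
    obtain d where d: "d > 0" "\<And>y. norm (y - x) < d \<Longrightarrow> norm (f y - f x - f' (y - x)) \<le> \<eta> * norm (y - x)"
      using f \<eta> unfolding has_derivative_at_alt by blast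
    define t where "t = d / 2 / (norm v + 1)"
    have t: "t > 0" using d by (simp add: t_def add_nonneg_pos)
    have "t * norm v < d"
    proof -
      have "t * norm v \<le> t * (norm v + 1)" using t by simp
      also have "\<dots> = d / 2"
      proof -
        have "norm v + 1 \<noteq> 0" using norm_ge_zero[of v] by linarith
        then show ?thesis using t_def nonzero_eq_divide_eq by metis
      qed
      finally show ?thesis using d by simp
    qed
    then have "norm (f (x + t *\<^sub>R v) - f x - f' (t *\<^sub>R v)) \<le> \<eta> * (t * norm v)"
      using d(2)[of "x + t *\<^sub>R v"] t by simp
    moreover have "norm (f (x + t *\<^sub>R v) - f x) \<le> B * (t * norm v)"
      using lip[of "x + t *\<^sub>R v"] t by simp
    ultimately have "norm (f' (t *\<^sub>R v)) \<le> B * (t * norm v) + \<eta> * (t * norm v)"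
      using norm_triangle_sub[of "f' (t *\<^sub>R v)" "f (x + t *\<^sub>R v) - f x"]
      by (simp add: norm_minus_commute)
    then have "t * norm (f' v) \<le> t * (B * norm v + \<eta> * norm v)"
      using t by (simp add: blinfun.bilinear_simps algebra_simps)
    then have "norm (f' v) \<le> B * norm v + \<eta> * norm v" using t by simp
    moreover have "\<eta> * norm v \<le> e"
    proof -
      have "\<eta> * norm v \<le> \<eta> * (norm v + 1)" using \<eta> by simp
      also have "\<dots> = e"
      proof -
        have "norm v + 1 \<noteq> 0" using norm_ge_zero[of v] by linarith
        then show ?thesis using \<eta>_def nonzero_eq_divide_eq by metis
      qed
      finally show ?thesis .
    qed
    ultimately show "norm (f' v) \<le> B * norm v + e" by simp
  qed
qed

text \<open>The conditions concern the distance of \<open>P x\<close>, not of \<open>x\<close>, from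
  \<open>A\<close>: such functions live on cylinders over range P. The gap between
  \<open>r/4\<close> and \<open>3 * r/4\<close> absorbs the error of approximating a distance
  function smoothly.\<close>

definition cutoff :: "('a \<Rightarrow> 'a::metric_space) \<Rightarrow> 'a set \<Rightarrow> real \<Rightarrow> ('a \<Rightarrow> real) \<Rightarrow> bool" where
  "cutoff P A r b \<longleftrightarrow> (\<forall>x. 0 \<le> b x \<and> b x \<le> 1) \<and>
     (\<forall>x. infdist (P x) A \<le> r / 4 \<longrightarrow> b x = 1) \<and> (\<forall>x. 3 * r / 4 \<le> infdist (P x) A \<longrightarrow> b x = 0)"

context
  fixes P :: "'a::banach \<Rightarrow>\<^sub>L 'a"
  assumes P: "bounded_projection P"
    and star: "property_star (range (blinfun_apply P)) (range (blinfun_apply (id_blinfun - P)))"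
begin

text \<open>Precomposing with \<open>P\<close> turns a C1 map on the subspace into one on the whole
  space, at the price of the factor \<open>norm P\<close>. The constant does not depend on the data,
  so it can be compensated by shrinking \<open>L\<close>.\<close>

lemma star_extension:
  "\<exists>C\<ge>1. \<forall>A f e L. A \<subseteq> range (blinfun_apply P) \<and> closed A \<and> f ` A \<subseteq> range (blinfun_apply (id_blinfun - P)) \<and>
     L > 0 \<and> L-lipschitz_on A f \<and> e > 0 \<longrightarrow>
     (\<exists>G G'. C1_with UNIV G G' \<and> (\<forall>x. G (P x) = G x) \<and>
       (\<forall>x. norm (G' x) \<le> C * L) \<and> (\<forall>x\<in>A. norm (f x - G x) < e))"
proof -
  obtain C0 where C0: "C0 \<ge> 1" and ext: "\<forall>A (f :: 'a \<Rightarrow> 'a) \<epsilon>.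
        A \<subseteq> range (blinfun_apply P) \<and> closed A \<and> f ` A \<subseteq> range (blinfun_apply (id_blinfun - P)) \<and>
        (\<exists>L. L-lipschitz_on A f) \<and> \<epsilon> > 0 \<longrightarrow>
        (\<exists>g :: 'a \<Rightarrow> 'a. g ` range (blinfun_apply P) \<subseteq> range (blinfun_apply (id_blinfun - P)) \<and>
            C1_on (range (blinfun_apply P)) g \<and> (\<exists>L. L-lipschitz_on (range (blinfun_apply P)) g) \<and>
            (\<forall>x\<in>A. norm (f x - g x) < \<epsilon>) \<and> Lip (range (blinfun_apply P)) g \<le> C0 * Lip A f)"
    using star unfolding property_star_def by (elim exE conjE) (rule that)
  define C where "C = 2 * C0 * (norm P + 1)"
  have "C \<ge> 1 * 1" unfolding C_def using C0 by (intro mult_mono) auto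
  moreover have "\<exists>G G'. C1_with UNIV G G' \<and> (\<forall>x. G (P x) = G x) \<and>
       (\<forall>x. norm (G' x) \<le> C * L) \<and> (\<forall>x\<in>A. norm (f x - G x) < e)"
    if A: "A \<subseteq> range (blinfun_apply P)" "closed A" "f ` A \<subseteq> range (blinfun_apply (id_blinfun - P))"
      and L: "L > 0" "L-lipschitz_on A f" and e: "e > 0" for A f e L
  proof -
    obtain g where g: "g ` range (blinfun_apply P) \<subseteq> range (blinfun_apply (id_blinfun - P))"
            "C1_on (range (blinfun_apply P)) g" "\<exists>L. L-lipschitz_on (range (blinfun_apply P)) g"
            "\<forall>x\<in>A. norm (f x - g x) < e" "Lip (range (blinfun_apply P)) g \<le> C0 * Lip A f"
    proof -
      have "A \<subseteq> range (blinfun_apply P) \<and> closed A \<and> f ` A \<subseteq> range (blinfun_apply (id_blinfun - P)) \<and>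
          (\<exists>L. L-lipschitz_on A f) \<and> e > 0" using A L e by blast
      from ext[rule_format, OF this] show ?thesis
        by (elim exE conjE) (rule that, assumption, assumption, rule exI, assumption+)
    qed
    have "Lip A f \<le> L" unfolding Lip_def
      by (rule cInf_lower) (use L in \<open>auto intro!: bdd_belowI[of _ 0] dest: lipschitz_on_nonneg\<close>)
    then have "C0 * Lip A f \<le> C0 * L" using C0 by simp
    also have "\<dots> < 2 * C0 * L" using C0 L by simp
    \<comment> \<open>\<open>Lip\<close> is an infimum. The factor 2 in \<open>C\<close>, together
      with \<open>L > 0\<close>, makes the inequality strict, so that an actual Lipschitz constant
      \<open>M\<close> lies below the bound.\<close>
    finally have "Inf {M. M-lipschitz_on (range (blinfun_apply P)) g} < 2 * C0 * L" using g(5) unfolding Lip_def by simp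
    then obtain M where M: "M-lipschitz_on (range (blinfun_apply P)) g" "M < 2 * C0 * L"
      using cInf_lessD[of "{M. M-lipschitz_on (range (blinfun_apply P)) g}"] g(3) by auto
    have M0: "M \<ge> 0" using lipschitz_on_nonneg[OF M(1)] .
    define G where "G = (\<lambda>x. g (P x))"
    obtain g' where g': "continuous_on (range (blinfun_apply P)) g'"
      "\<And>x. x \<in> range (blinfun_apply P) \<Longrightarrow> (g has_derivative blinfun_apply (g' x)) (at x within range (blinfun_apply P))"
      using g(2) unfolding C1_on_def by blast
    define G' where "G' x = g' (P x) o\<^sub>L P" for x
    have dG: "(G has_derivative G' x) (at x)" for x
      using diff_chain_within[of P P x UNIV g, OF _ g'(2)]
      by (simp add: G_def G'_def o_def blinfun_compose.rep_eq bounded_linear_imp_has_derivative blinfun.bounded_linear_right)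
    have "continuous_on UNIV (\<lambda>x. g' (P x))"
      by (rule continuous_on_compose2[OF g'(1)]) (auto intro: continuous_intros)
    then have "continuous_on UNIV G'" unfolding G'_def by (intro continuous_intros)
    then have "C1_with UNIV G G'" using dG by (simp add: C1_with_def)
    moreover have "G (P x) = G x" for x by (simp add: G_def bounded_projection_apply[OF P])
    moreover have "norm (G' x) \<le> C * L" for x
    proof (rule has_derivative_lipschitz_bound[OF dG])
      show "0 \<le> C * L" unfolding C_def using C0 L by simp
      fix y
      have "norm (G y - G x) \<le> M * norm (P y - P x)"
        using lipschitz_onD[OF M(1)] by (simp add: G_def dist_norm)
      also have "norm (P y - P x) \<le> norm P * norm (y - x)"
        using norm_blinfun[of P "y - x"] by (simp add: blinfun.bilinear_simps)
      also have "M * (norm P * norm (y - x)) \<le> (2 * C0 * L) * ((norm P + 1) * norm (y - x))"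
        using M M0 C0 L by (intro mult_mono) auto
      also have "(2 * C0 * L) * ((norm P + 1) * norm (y - x)) = C * L * norm (y - x)"
        by (simp add: C_def algebra_simps)
      finally show "norm (G y - G x) \<le> C * L * norm (y - x)" using M0 by (simp add: mult_left_mono)
    qed
    moreover have "norm (f x - G x) < e" if "x \<in> A" for x
    proof -
      have "P x = x" using range_projection[OF P, of x] A(1) that by blast
      then show ?thesis using bspec[OF g(4) that] by (simp add: G_def)
    qed
    ultimately show ?thesis by blast
  qed
  ultimately show ?thesis by (intro exI[of _ C]) auto
qed

text \<open>As \<open>P\<close> is not the identity, the complement contains some
  \<open>v \<noteq> 0\<close>; the map \<open>h x *\<^sub>R v\<close> is approximated by property
  star, and a functional \<open>l\<close> with \<open>l v = 1\<close> recovers a scalar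
  function.\<close>

lemma star_scalar_extension:
  assumes "P \<noteq> id_blinfun"
  shows "\<exists>C\<ge>1. \<forall>(h :: 'a \<Rightarrow> real) e L. L > 0 \<and> L-lipschitz_on (range (blinfun_apply P)) h \<and> e > 0 \<longrightarrow>
     (\<exists>u u'. C1_with UNIV u u' \<and> (\<forall>x. norm (u' x) \<le> C * L) \<and>
       (\<forall>x. \<bar>u x - h (P x)\<bar> < e))"
proof -
  obtain z where z: "z - P z \<noteq> 0" using assms by (metis blinfun_apply_id_blinfun blinfun_eqI right_minus_eq)
  define v where "v = z - P z"
  have v: "v \<noteq> 0" "v \<in> range (blinfun_apply (id_blinfun - P))"
    using z by (auto simp: v_def blinfun.bilinear_simps)
  obtain l :: "'a \<Rightarrow>\<^sub>L real" where l: "l v = 1" using exists_norming_functional[OF v(1)] by blast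
  obtain C where C: "C \<ge> 1" and ext: "\<forall>A f e L. A \<subseteq> range (blinfun_apply P) \<and> closed A \<and>
     f ` A \<subseteq> range (blinfun_apply (id_blinfun - P)) \<and> L > 0 \<and> L-lipschitz_on A f \<and> e > 0 \<longrightarrow>
     (\<exists>G G'. C1_with UNIV G G' \<and> (\<forall>x. G (P x) = G x) \<and>
       (\<forall>x. norm (G' x) \<le> C * L) \<and> (\<forall>x\<in>A. norm (f x - G x) < e))"
    using star_extension by (elim exE conjE) (rule that)
  define D where "D = (norm l + 1) * C * (norm v + 1)"
  have "D \<ge> 1 * 1 * 1" unfolding D_def using C by (intro mult_mono) auto
  moreover have "\<exists>u u'. C1_with UNIV u u' \<and> (\<forall>x. norm (u' x) \<le> D * L) \<and>
       (\<forall>x. \<bar>u x - h (P x)\<bar> < e)"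
    if L: "L > 0" "L-lipschitz_on (range (blinfun_apply P)) h" and e: "e > 0" for h :: "'a \<Rightarrow> real" and e L
  proof -
    have cl: "closed (range (blinfun_apply P))"
    proof -
      have "range (blinfun_apply P) = {x. P x = x}" using range_projection[OF P] by blast
      moreover have "closed {x. P x = x}" by (intro closed_Collect_eq continuous_intros)
      ultimately show ?thesis by simp
    qed
    have im: "(\<lambda>x. h x *\<^sub>R v) ` range (blinfun_apply P) \<subseteq> range (blinfun_apply (id_blinfun - P))"
    proof clarify
      fix x show "h (P x) *\<^sub>R v \<in> range (blinfun_apply (id_blinfun - P))"
        using v(2) by (metis (no_types, lifting) blinfun.scaleR_right imageE rangeI)
    qed
    have lip: "(L * (norm v + 1))-lipschitz_on (range (blinfun_apply P)) (\<lambda>x. h x *\<^sub>R v)"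
    proof (rule lipschitz_onI)
      fix x y assume "x \<in> range (blinfun_apply P)" "y \<in> range (blinfun_apply P)"
      then have "\<bar>h x - h y\<bar> * norm v \<le> (L * dist x y) * (norm v + 1)"
        using lipschitz_onD[OF L(2)] L by (intro mult_mono) (auto simp: dist_real_def)
      then show "dist (h x *\<^sub>R v) (h y *\<^sub>R v) \<le> L * (norm v + 1) * dist x y"
        by (simp add: dist_norm scaleR_diff_left[symmetric] mult_ac)
    qed (use L in simp)
    have "e / (norm l + 1) > 0" "L * (norm v + 1) > 0" using e L by (auto simp: add_nonneg_pos)
    then have "range (blinfun_apply P) \<subseteq> range (blinfun_apply P) \<and> closed (range (blinfun_apply P)) \<and>
        (\<lambda>x. h x *\<^sub>R v) ` range (blinfun_apply P) \<subseteq> range (blinfun_apply (id_blinfun - P)) \<and>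
        L * (norm v + 1) > 0 \<and> (L * (norm v + 1))-lipschitz_on (range (blinfun_apply P)) (\<lambda>x. h x *\<^sub>R v) \<and>
        e / (norm l + 1) > 0" using cl im lip by simp
    from ext[rule_format, OF this] obtain G G' where G0: "C1_with UNIV G G'" "\<forall>x. G (P x) = G x"
      "\<forall>x. norm (G' x) \<le> C * (L * (norm v + 1))"
      "\<forall>x\<in>range (blinfun_apply P). norm (h x *\<^sub>R v - G x) < e / (norm l + 1)"
      by (elim exE conjE) (rule that)
    note G = G0(1) G0(2-4)[rule_format]
    have "norm (l o\<^sub>L G' x) \<le> D * L" for x
    proof -
      have "norm (l o\<^sub>L G' x) \<le> norm l * norm (G' x)" by (rule norm_blinfun_compose)
      also have "\<dots> \<le> (norm l + 1) * (C * (L * (norm v + 1)))" using G(3) by (intro mult_mono) auto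
      finally show ?thesis by (simp add: D_def mult_ac)
    qed
    moreover have "\<bar>l (G x) - h (P x)\<bar> < e" for x
    proof -
      have "l (G x) - h (P x) = - l (h (P x) *\<^sub>R v - G (P x))" using l G(2) by (simp add: blinfun.bilinear_simps)
      then have "\<bar>l (G x) - h (P x)\<bar> \<le> norm l * norm (h (P x) *\<^sub>R v - G (P x))"
        using norm_blinfun[of l "h (P x) *\<^sub>R v - G (P x)"] by simp
      also have "\<dots> \<le> (norm l) * (e / (norm l + 1))" using G(4)[of "P x"] by (intro mult_left_mono) auto
      also have "\<dots> < e"
      proof -
        have "norm l + 1 > 0" using norm_ge_zero[of l] by linarith
        then show ?thesis using e by (simp add: pos_divide_less_eq algebra_simps)
      qed
      finally show ?thesis .
    qed
    ultimately show ?thesis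
      using C1_with_blinfun_compose[OF G(1), of l] by (intro exI[of _ "\<lambda>x. l (G x)"] exI[of _ "\<lambda>x. l o\<^sub>L G' x"]) auto
  qed
  ultimately show ?thesis by (intro exI[of _ D]) auto
qed

text \<open>Smoothed distance functions composed with \<open>step_down\<close>. What matters is the
  scaling: one \<open>C\<close> bounds the derivative by \<open>C / r\<close> for all sets and all
  radii.\<close>

lemma star_cutoff:
  assumes "P \<noteq> id_blinfun"
  shows "\<exists>C>0. \<forall>A r. r > 0 \<longrightarrow>
     (\<exists>b b'. C1_with UNIV b b' \<and> (\<forall>x. norm (b' x) \<le> C / r) \<and> cutoff P A r b)"
proof -
  obtain C where C: "C \<ge> 1" and ext: "\<forall>(h :: 'a \<Rightarrow> real) e L. L > 0 \<and>
     L-lipschitz_on (range (blinfun_apply P)) h \<and> e > 0 \<longrightarrow>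
     (\<exists>u u'. C1_with UNIV u u' \<and> (\<forall>x. norm (u' x) \<le> C * L) \<and>
       (\<forall>x. \<bar>u x - h (P x)\<bar> < e))"
    using star_scalar_extension[OF assms] by (elim exE conjE) (rule that)
  obtain s' where s': "C1_with UNIV step_down s'" "\<And>t. norm (s' t) \<le> 4" using step_down_C1 by blast
  have "\<exists>b b'. C1_with UNIV b b' \<and> (\<forall>x. norm (b' x) \<le> (16 * C) / r) \<and> cutoff P A r b"
    if r: "r > 0" for A and r :: real
  proof -
    \<comment> \<open>The affine function of the distance is at most -1/2 up to \<open>r/4\<close>
      and at least 3/2 from \<open>3 * r/4\<close> on, so an approximation with error below 1/2
      stays at most 0, respectively at least 1.\<close>
    have "(4 / r)-lipschitz_on (range (blinfun_apply P)) (\<lambda>x. 4 / r * infdist x A - 3/2)"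
    proof (rule lipschitz_onI)
      fix x y
      have "\<bar>infdist x A - infdist y A\<bar> \<le> dist x y" by (rule infdist_triangle_abs)
      then have "4 / r * \<bar>infdist x A - infdist y A\<bar> \<le> 4 / r * dist x y" using r by (intro mult_left_mono) auto
      moreover have "(4 / r * infdist x A - 3/2) - (4 / r * infdist y A - 3/2) = 4 / r * (infdist x A - infdist y A)"
        by (simp add: right_diff_distrib)
      moreover have "\<bar>4 / r * (infdist x A - infdist y A)\<bar> = 4 / r * \<bar>infdist x A - infdist y A\<bar>"
        using r by (subst abs_mult) simp
      ultimately show "dist (4 / r * infdist x A - 3/2) (4 / r * infdist y A - 3/2) \<le> 4 / r * dist x y"
        unfolding dist_real_def by presburger
    qed (use r in simp)
    then have "4 / r > 0 \<and> (4 / r)-lipschitz_on (range (blinfun_apply P)) (\<lambda>x. 4 / r * infdist x A - 3/2) \<and>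
        (1/2 :: real) > 0" using r by simp
    from ext[rule_format, OF this] obtain u u' where u0: "C1_with UNIV u u'" "\<forall>x. norm (u' x) \<le> C * (4 / r)"
       "\<forall>x. \<bar>u x - (4 / r * infdist (P x) A - 3/2)\<bar> < 1/2"
      by (elim exE conjE) (rule that)
    note u = u0(1) u0(2-3)[rule_format]
    have "norm (s' (u x) o\<^sub>L u' x) \<le> (16 * C) / r" for x
    proof -
      have "norm (s' (u x) o\<^sub>L u' x) \<le> norm (s' (u x)) * norm (u' x)" by (rule norm_blinfun_compose)
      also have "\<dots> \<le> 4 * (C * (4 / r))" using s' u(2) by (intro mult_mono) auto
      finally show ?thesis by simp
    qed
    moreover have "step_down (u x) = 1" if "infdist (P x) A \<le> r / 4" for x
    proof (rule step_down_eq(1))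
      have "4 / r * infdist (P x) A \<le> 4 / r * (r / 4)" using that r by (intro mult_left_mono) auto
      moreover have "4 / r * (r / 4) = 1" using r by simp
      ultimately show "u x \<le> 0" using u(3)[of x] by linarith
    qed
    moreover have "step_down (u x) = 0" if "3 * r / 4 \<le> infdist (P x) A" for x
    proof (rule step_down_eq(2))
      have "4 / r * (3 * r / 4) \<le> 4 / r * infdist (P x) A" using that r by (intro mult_left_mono) auto
      moreover have "4 / r * (3 * r / 4) = 3" using r by simp
      ultimately show "1 \<le> u x" using u(3)[of x] by linarith
    qed
    ultimately show ?thesis
      using C1_with_compose[OF u(1) s'(1)] step_down_bounds unfolding cutoff_def
      by (intro exI[of _ "\<lambda>x. step_down (u x)"] exI[of _ "\<lambda>x. s' (u x) o\<^sub>L u' x"]) auto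
  qed
  then show ?thesis using C by (intro exI[of _ "16 * C"]) auto
qed

end

subsection \<open>Sequential partitions of unity\<close>

text \<open>A partition of unity without normalisation: the sum is 1 as soon as some factor
  \<open>a k\<close> equals 1, and every later term is then 0. No lower bound for a denominator is
  involved.\<close>

definition seq_part :: "(nat \<Rightarrow> 'a \<Rightarrow> real) \<Rightarrow> nat \<Rightarrow> 'a \<Rightarrow> real" where
  "seq_part a n x = a n x * (\<Prod>k<n. 1 - a k x)"

lemma seq_part_sum: "(\<Sum>j<n. seq_part a j x) = 1 - (\<Prod>k<n. 1 - a k x)"
  by (induction n) (simp_all add: seq_part_def algebra_simps)

lemma seq_part_sum_eq_1: "k < n \<Longrightarrow> a k x = 1 \<Longrightarrow> (\<Sum>j<n. seq_part a j x) = 1"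
  unfolding seq_part_sum by (simp add: prod_zero_iff) (metis lessThan_iff)

lemma seq_part_eq_0: "k < n \<Longrightarrow> a k x = 1 \<Longrightarrow> seq_part a n x = 0"
  unfolding seq_part_def by (simp add: prod_zero_iff) (metis lessThan_iff)

lemma seq_part_nonneg:
  assumes "\<And>k. k \<le> n \<Longrightarrow> 0 \<le> a k x \<and> a k x \<le> 1"
  shows "0 \<le> seq_part a n x"
  unfolding seq_part_def using assms by (intro mult_nonneg_nonneg prod_nonneg) auto

lemma seq_part_C1:
  assumes "\<And>k. k \<le> n \<Longrightarrow> \<exists>d. C1_with U (a k) d"
  shows "\<exists>d. C1_with U (seq_part a n) d"
proof -
  have "\<exists>d. C1_with U (\<lambda>x. \<Prod>k<m. 1 - a k x) d" if "m \<le> Suc n" for m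
    using that
  proof (induction m)
    case 0
    then show ?case using C1_with_const by auto
  next
    case (Suc m)
    then obtain d where "C1_with U (\<lambda>x. \<Prod>k<m. 1 - a k x) d" by auto
    moreover obtain d' where "C1_with U (\<lambda>x. 1 - a m x) d'"
      using C1_with_diff[OF C1_with_const] assms[of m] Suc.prems by fastforce
    ultimately show ?case using C1_with_mult by (simp, blast)
  qed
  then obtain d where "C1_with U (\<lambda>x. \<Prod>k<n. 1 - a k x) d" by (meson le_SucI order_refl)
  moreover obtain d' where "C1_with U (a n) d'" using assms by blast
  ultimately show ?thesis unfolding seq_part_def using C1_with_mult by blast
qed

lemma norm_convex_combination_le:
  fixes v :: "nat \<Rightarrow> 'a::real_normed_vector"
  assumes c: "\<And>j. j < n \<Longrightarrow> 0 \<le> c j" "(\<Sum>j<n. c j) = 1"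
    and v: "\<And>j. j < n \<Longrightarrow> c j \<noteq> 0 \<Longrightarrow> norm (v j - w) \<le> e"
  shows "norm ((\<Sum>j<n. c j *\<^sub>R v j) - w) \<le> e"
proof -
  have "(\<Sum>j<n. c j *\<^sub>R v j) - w = (\<Sum>j<n. c j *\<^sub>R (v j - w))"
    unfolding scaleR_diff_right sum_subtractf scaleR_left.sum[symmetric] c(2) by simp
  also have "norm \<dots> \<le> (\<Sum>j<n. c j * e)"
  proof (rule sum_norm_le)
    fix j assume "j \<in> {..<n}"
    then show "norm (c j *\<^sub>R (v j - w)) \<le> c j * e"
      using c(1)[of j] v[of j] by (cases "c j = 0") (auto intro: mult_left_mono)
  qed
  also have "\<dots> = e" unfolding sum_distrib_right[symmetric] c(2) by simp
  finally show ?thesis .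
qed

text \<open>Lets the derivative of a bump be dropped wherever the bump itself is 0, including
  boundary points of its support.\<close>

lemma C1_with_zero_at_min:
  fixes f :: "'a::real_normed_vector \<Rightarrow> real"
  assumes "C1_with U f f'" "open U" "x \<in> U" "f x = 0" "\<And>y. y \<in> U \<Longrightarrow> 0 \<le> f y"
  shows "f' x = 0"
proof -
  have "blinfun_apply (f' x) = (\<lambda>v. 0)"
    using differential_zero_maxmin[OF assms(3,2) C1_withD(1)[OF assms(1,3)]] assms(4,5) by auto
  then show ?thesis by (intro blinfun_eqI) simp
qed

lemma C1_with_zero_const:
  assumes "C1_with U f f'" "open U" "x \<in> U" "\<And>y. y \<in> U \<Longrightarrow> f y = c"
  shows "f' x = 0"
proof -
  have "(f has_derivative (\<lambda>v. 0)) (at x)"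
    by (rule has_derivative_transform_within_open[OF has_derivative_const[of c] assms(2,3)]) (simp add: assms(4))
  then have "blinfun_apply (f' x) = (\<lambda>v. 0)" using C1_withD(1)[OF assms(1,3)] has_derivative_unique by blast
  then show ?thesis by (intro blinfun_eqI) simp
qed

subsection \<open>A Whitney extension theorem\<close>

lemma C1_with_series:
  fixes h :: "nat \<Rightarrow> 'a::real_normed_vector \<Rightarrow> 'b::banach"
  assumes h: "\<And>n. C1_with UNIV (h n) (h' n)" and M: "\<And>n x. norm (h' n x) \<le> M n" "summable M"
    and x0: "summable (\<lambda>n. h n x0)"
  shows "\<exists>g g'. C1_with UNIV g g' \<and> (\<forall>x. (\<lambda>n. h n x) sums g x) \<and> (\<forall>x. (\<lambda>n. h' n x) sums g' x)"
proof -
  define g' where "g' x = (\<Sum>n. h' n x)" for x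
  have sm: "(\<lambda>n. h' n x) sums g' x" for x
    unfolding g'_def by (rule summable_sums, rule summable_comparison_test[OF _ M(2)]) (use M in auto)
  have ul: "uniform_limit UNIV (\<lambda>n x. \<Sum>i<n. h' i x) g' sequentially"
    unfolding g'_def by (rule Weierstrass_m_test[OF M(1) M(2)])
  have cont: "continuous_on UNIV g'"
  proof (rule uniform_limit_theorem[OF _ ul])
    show "\<forall>\<^sub>F n in sequentially. continuous_on UNIV (\<lambda>x. \<Sum>i<n. h' i x)"
      using C1_withD(2)[OF h] by (auto intro!: always_eventually continuous_on_sum)
  qed simp
  have "\<exists>g. \<forall>x\<in>UNIV. (\<lambda>n. h n x) sums (g x) \<and> (g has_derivative g' x) (at x within UNIV)"
  proof (rule has_derivative_series[where f' = "\<lambda>n x. blinfun_apply (h' n x)"])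
    fix e :: real assume "e > 0"
    then have "\<forall>\<^sub>F n in sequentially. \<forall>x\<in>UNIV. dist (\<Sum>i<n. h' i x) (g' x) < e"
      using ul unfolding uniform_limit_iff by blast
    then show "\<forall>\<^sub>F n in sequentially. \<forall>x\<in>UNIV. \<forall>v. norm (sum (\<lambda>i. h' i x v) {..<n} - g' x v) \<le> e * norm v"
    proof eventually_elim
      case (elim n)
      show ?case
      proof (intro ballI allI)
        fix x v
        have "sum (\<lambda>i. h' i x v) {..<n} - g' x v = ((\<Sum>i<n. h' i x) - g' x) v"
          by (simp add: blinfun.bilinear_simps blinfun.sum_left)
        also have "norm \<dots> \<le> norm ((\<Sum>i<n. h' i x) - g' x) * norm v" by (rule norm_blinfun)
        also have "\<dots> \<le> e * norm v" using elim by (intro mult_right_mono) (auto simp: dist_norm less_imp_le)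
        finally show "norm (sum (\<lambda>i. h' i x v) {..<n} - g' x v) \<le> e * norm v" .
      qed
    qed
  qed (use C1_withD(1)[OF h] x0 in \<open>auto simp: summable_sums\<close>)
  then obtain g where "\<And>x. (\<lambda>n. h n x) sums (g x)" "\<And>x. (g has_derivative g' x) (at x)" by auto
  then show ?thesis using sm cont unfolding C1_with_def by blast
qed

lemma norm_scaleR_left_compose:
  "norm (blinfun_scaleR_left v o\<^sub>L A) \<le> norm v * norm (A :: 'a::real_normed_vector \<Rightarrow>\<^sub>L real)"
proof (rule norm_blinfun_bound)
  show "norm ((blinfun_scaleR_left v o\<^sub>L A) x) \<le> norm v * norm A * norm x" for x
    using mult_right_mono[OF norm_blinfun[of A x] norm_ge_zero[of v]] by (simp add: mult_ac)
qed simp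

lemma compact_finite_subcover_balls:
  fixes A :: "'a::metric_space set"
  assumes "compact A" "\<And>y. y \<in> A \<Longrightarrow> s y > 0"
  shows "\<exists>n p. p ` {..<n} \<subseteq> A \<and> (\<forall>z\<in>A. \<exists>j<(n::nat). dist (p j) z < s (p j))"
proof -
  obtain J where J: "J \<subseteq> A" "finite J" "A \<subseteq> (\<Union>y\<in>J. ball y (s y))"
    by (rule compactE_image[OF assms(1), of A "\<lambda>y. ball y (s y)"]) (use assms(2) in auto)
  obtain n p where "J = p ` {i. i < (n::nat)}" using finite_imp_nat_seg_image_inj_on[OF J(2)] by blast
  then have "J = p ` {..<n}" by (simp add: lessThan_def)
  moreover have "\<exists>j<n. dist (p j) z < s (p j)" if "z \<in> A" for z
  proof -
    have "z \<in> (\<Union>y\<in>p ` {..<n}. ball y (s y))" using J(3) that \<open>J = p ` {..<n}\<close> by blast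
    then show ?thesis by auto
  qed
  ultimately show ?thesis using J(1) by blast
qed

context
  fixes P :: "'a::banach \<Rightarrow>\<^sub>L 'a" and A :: "'a set" and f :: "'a \<Rightarrow> 'a" and D :: "'a \<Rightarrow> 'a \<Rightarrow>\<^sub>L 'a"
  assumes P: "bounded_projection P"
    and star: "property_star (range (blinfun_apply P)) (range (blinfun_apply (id_blinfun - P)))"
    and nontriv: "P \<noteq> id_blinfun"
    and A: "compact A" "\<And>y. y \<in> A \<Longrightarrow> P y = y"
    and f: "\<And>y. y \<in> A \<Longrightarrow> P (f y) = 0"
    and D: "continuous_on A D" "\<And>y v. y \<in> A \<Longrightarrow> P (D y v) = 0"
    and jet: "\<And>y e. y \<in> A \<Longrightarrow> e > 0 \<Longrightarrow> \<exists>r>0. \<forall>z\<in>A \<inter> ball y r. \<forall>w\<in>A \<inter> ball y r.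
        norm (f z - f w - D y (z - w)) \<le> e * norm (z - w)"
begin

text \<open>The radius \<open>r\<close> comes from the jet condition alone, while the accuracy
  \<open>t\<close> is free, because property star approximates arbitrarily well at a fixed cost in
  the Lipschitz constant. This order of quantifiers is the point of the lemma.\<close>

lemma jet_approx_at:
  assumes y: "y \<in> A" and e: "e > 0"
  shows "\<exists>r>0. \<forall>t>0. \<exists>\<psi> \<psi>'. C1_with UNIV \<psi> \<psi>' \<and> (\<forall>x. norm (\<psi>' x - D y) \<le> e) \<and>
     (\<forall>z\<in>A \<inter> cball y r. norm (\<psi> z - f z) < t)"
proof -
  obtain C where C: "C \<ge> 1" and ext: "\<forall>A f e L. A \<subseteq> range (blinfun_apply P) \<and> closed A \<and>
     f ` A \<subseteq> range (blinfun_apply (id_blinfun - P)) \<and> L > 0 \<and> L-lipschitz_on A f \<and> e > 0 \<longrightarrow>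
     (\<exists>G G'. C1_with UNIV G G' \<and> (\<forall>x. G (P x) = G x) \<and>
       (\<forall>x. norm (G' x) \<le> C * L) \<and> (\<forall>x\<in>A. norm (f x - G x) < e))"
    using star_extension[OF P star] by (elim exE conjE) (rule that)
  have eC: "e / C > 0" using e C by simp
  then obtain r where r: "r > 0" "\<forall>z\<in>A \<inter> ball y r. \<forall>w\<in>A \<inter> ball y r.
        norm (f z - f w - D y (z - w)) \<le> (e / C) * norm (z - w)"
    using jet[OF y] by blast
  define A0 where "A0 = A \<inter> cball y (r / 2)"
  \<comment> \<open>The remainder of the affine jet takes values in the complement and has Lipschitz
    constant \<open>e / C\<close> near \<open>y\<close>; extension multiplies this by
    \<open>C\<close>, so its derivative is at most \<open>e\<close> everywhere.\<close>
  define k where "k z = f z - f y - D y (z - y)" for z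
  have "(e / C)-lipschitz_on A0 k"
  proof (rule lipschitz_onI)
    fix z w assume "z \<in> A0" "w \<in> A0"
    then have "norm (f z - f w - D y (z - w)) \<le> (e / C) * norm (z - w)"
      using r by (auto simp: A0_def)
    then show "dist (k z) (k w) \<le> (e / C) * dist z w"
      by (simp add: k_def dist_norm blinfun.bilinear_simps algebra_simps)
  qed (use eC in simp)
  moreover have "A0 \<subseteq> range (blinfun_apply P)" using A(2) by (auto simp: A0_def) (metis rangeI)
  moreover have "closed A0" unfolding A0_def using A(1) by (intro closed_Int compact_imp_closed) auto
  moreover have "k ` A0 \<subseteq> range (blinfun_apply (id_blinfun - P))"
  proof clarify
    fix z assume "z \<in> A0"
    then have "P (k z) = 0" using f D(2) y by (simp add: k_def A0_def blinfun.bilinear_simps)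
    then have "k z = (id_blinfun - P) (k z)" by (simp add: blinfun.bilinear_simps)
    then show "k z \<in> range (blinfun_apply (id_blinfun - P))" by (rule range_eqI)
  qed
  ultimately have pre: "A0 \<subseteq> range (blinfun_apply P) \<and> closed A0 \<and> k ` A0 \<subseteq> range (blinfun_apply (id_blinfun - P)) \<and>
      e / C > 0 \<and> (e / C)-lipschitz_on A0 k \<and> t > 0" if "t > 0" for t :: real using eC that by blast
  have "\<exists>\<psi> \<psi>'. C1_with UNIV \<psi> \<psi>' \<and> (\<forall>x. norm (\<psi>' x - D y) \<le> e) \<and>
     (\<forall>z\<in>A \<inter> cball y (r / 2). norm (\<psi> z - f z) < t)" if t: "t > 0" for t
  proof -
    obtain G G' where G: "C1_with UNIV G G'" "\<forall>x. norm (G' x) \<le> C * (e / C)" "\<forall>x\<in>A0. norm (k x - G x) < t"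
      using ext[rule_format, OF pre[OF t]] by (elim exE conjE) (rule that)
    have "C1_with UNIV (\<lambda>x. (f y - D y y) + D y x + G x) (\<lambda>x. 0 + D y + G' x)"
      by (intro C1_with_add C1_with_const C1_with_linear G)
    moreover have "norm (0 + D y + G' x - D y) \<le> e" for x using G(2) C by simp
    moreover have "norm ((f y - D y y) + D y z + G z - f z) < t" if "z \<in> A \<inter> cball y (r / 2)" for z
    proof -
      have "(f y - D y y) + D y z + G z - f z = - (k z - G z)"
        by (simp add: k_def blinfun.bilinear_simps algebra_simps)
      then have "norm ((f y - D y y) + D y z + G z - f z) = norm (k z - G z)" by (metis norm_minus_cancel)
      then show ?thesis using G(3) that by (simp add: A0_def)
    qed
    ultimately show ?thesis by blast
  qed
  then show ?thesis using r by (intro exI[of _ "r / 2"]) auto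
qed

text \<open>Patching the local maps adds the term with \<open>\<psi> j x - f z\<close> times
  derivatives of the weights. It is at most \<open>(B * \<rho> + s) * M\<close>, where
  \<open>B\<close> and \<open>M\<close> depend only on \<open>e\<close> and the cover; hence
  \<open>\<rho>\<close> can be fixed first and \<open>t\<close> (with \<open>s\<close>)
  afterwards.\<close>

lemma jet_approx:
  assumes e: "e > 0"
  shows "\<exists>\<rho>>0. \<forall>t>0. \<exists>g g'. C1_with UNIV g g' \<and> (\<forall>z\<in>A. \<forall>x. dist z x < \<rho> \<longrightarrow> norm (g' x - D z) \<le> e) \<and>
     (\<forall>z\<in>A. norm (g z - f z) \<le> t)"
proof -
  have "\<exists>r>0. (\<forall>z\<in>A \<inter> cball y r. norm (D z - D y) \<le> e / 3) \<and>
      (\<forall>t>0. \<exists>\<psi> \<psi>'. C1_with UNIV \<psi> \<psi>' \<and> (\<forall>x. norm (\<psi>' x - D y) \<le> e / 3) \<and>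
     (\<forall>z\<in>A \<inter> cball y r. norm (\<psi> z - f z) < t))" if y: "y \<in> A" for y
  proof -
    obtain r1 where r1: "r1 > 0" "\<And>z. z \<in> A \<Longrightarrow> dist z y < r1 \<Longrightarrow> dist (D z) (D y) < e / 3"
      using D(1) y e unfolding continuous_on_iff by (metis divide_pos_pos zero_less_numeral)
    obtain r2 where r2: "r2 > 0" "\<forall>t>0. \<exists>\<psi> \<psi>'. C1_with UNIV \<psi> \<psi>' \<and> (\<forall>x. norm (\<psi>' x - D y) \<le> e / 3) \<and>
     (\<forall>z\<in>A \<inter> cball y r2. norm (\<psi> z - f z) < t)"
      using jet_approx_at[OF y, of "e / 3"] e by (metis divide_pos_pos zero_less_numeral)
    have "norm (D z - D y) \<le> e / 3" if "z \<in> A \<inter> cball y (min (r1 / 2) r2)" for z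
      using r1(1) r1(2)[of z] that by (simp add: dist_norm[symmetric] dist_commute)
    moreover have "A \<inter> cball y (min (r1 / 2) r2) \<subseteq> A \<inter> cball y r2" by auto
    ultimately show ?thesis using r1(1) r2
      by (intro exI[of _ "min (r1 / 2) r2"] conjI allI impI) (simp, blast, meson subsetD)
  qed
  then obtain r where r: "\<And>y. y \<in> A \<Longrightarrow> r y > 0"
    and rD: "\<And>y z. y \<in> A \<Longrightarrow> z \<in> A \<inter> cball y (r y) \<Longrightarrow> norm (D z - D y) \<le> e / 3"
    and r\<psi>: "\<And>y t. y \<in> A \<Longrightarrow> t > 0 \<Longrightarrow> \<exists>\<psi> \<psi>'. C1_with UNIV \<psi> \<psi>' \<and> (\<forall>x. norm (\<psi>' x - D y) \<le> e / 3) \<and>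
     (\<forall>z\<in>A \<inter> cball y (r y). norm (\<psi> z - f z) < t)" by metis
  \<comment> \<open>The covering radius \<open>r/16\<close> plus the displacement
    \<open>r/16\<close> permitted by \<open>\<rho>2\<close> below gives \<open>r/8\<close>, the
    plateau of the cutoff of radius \<open>r/2\<close>.\<close>
  obtain n p where p: "p ` {..<n} \<subseteq> A" and cover: "\<And>z. z \<in> A \<Longrightarrow> \<exists>j<(n::nat). dist (p j) z < r (p j) / 16"
    using compact_finite_subcover_balls[OF A(1), of "\<lambda>y. r y / 16"] r by auto
  have pA: "p j \<in> A" if "j < n" for j using p that by auto
  obtain Cc where cut: "\<forall>A r. r > 0 \<longrightarrow>
     (\<exists>b b'. C1_with UNIV b b' \<and> (\<forall>x. norm (b' x) \<le> Cc / r) \<and> cutoff P A r b)"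
    using star_cutoff[OF P star nontriv] by (elim exE conjE) (rule that)
  have "\<exists>b. (\<exists>b'. C1_with UNIV b b') \<and> (\<forall>x. 0 \<le> b x \<and> b x \<le> (1::real)) \<and>
     (\<forall>x. dist (P x) (p j) \<le> r (p j) / 8 \<longrightarrow> b x = 1) \<and> (\<forall>x. b x \<noteq> 0 \<longrightarrow> dist (P x) (p j) \<le> 3 * r (p j) / 8)" if "j < n" for j
  proof -
    have "r (p j) / 2 > 0" using r[OF pA[OF that]] by simp
    from cut[rule_format, OF this, of "{p j}"] show ?thesis
    proof (elim exE conjE)
      fix b b' assume b0: "C1_with UNIV b b'" "cutoff P {p j} (r (p j) / 2) b"
      note b = b0(1) b0(2)[unfolded cutoff_def, THEN conjunct1]
        b0(2)[unfolded cutoff_def, THEN conjunct2, THEN conjunct1] b0(2)[unfolded cutoff_def, THEN conjunct2, THEN conjunct2]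
      have "dist (P x) (p j) \<le> 3 * r (p j) / 8" if "b x \<noteq> 0" for x
      proof (rule ccontr)
        assume "\<not> ?thesis"
        then have "3 * (r (p j) / 2) / 4 \<le> infdist (P x) {p j}" by simp
        then show False using b(4) that by blast
      qed
      then show ?thesis using b by (intro exI[of _ b]) auto
    qed
  qed
  then obtain b where b: "\<And>j. j < n \<Longrightarrow> \<exists>b'. C1_with UNIV (b j) b'" "\<And>j x. j < n \<Longrightarrow> 0 \<le> b j x \<and> b j x \<le> (1::real)"
    "\<And>j x. j < n \<Longrightarrow> dist (P x) (p j) \<le> r (p j) / 8 \<Longrightarrow> b j x = 1"
    "\<And>j x. j < n \<Longrightarrow> b j x \<noteq> 0 \<Longrightarrow> dist (P x) (p j) \<le> 3 * r (p j) / 8" by metis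
  define \<phi> where "\<phi> = seq_part b"
  have "\<exists>d. C1_with UNIV (\<phi> j) d" if "j < n" for j
    unfolding \<phi>_def by (rule seq_part_C1) (use b(1) that in auto)
  then obtain \<phi>' where \<phi>': "\<And>j. j < n \<Longrightarrow> C1_with UNIV (\<phi> j) (\<phi>' j)" by metis
  have \<phi>0: "0 \<le> \<phi> j x" if "j < n" for j x
    unfolding \<phi>_def by (rule seq_part_nonneg) (use b(2) that in auto)
  have \<phi>ne: "b j x \<noteq> 0" if "\<phi> j x \<noteq> 0" for j x using that by (auto simp: \<phi>_def seq_part_def)
  have \<phi>'0: "\<phi>' j x = 0" if "j < n" "\<phi> j x = 0" for j x
    by (rule C1_with_zero_at_min[OF \<phi>'[OF that(1)] open_UNIV]) (use that \<phi>0 in auto)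
  have "continuous_on UNIV (\<lambda>x. \<Sum>j<n. norm (\<phi>' j x))"
    using \<phi>'[THEN C1_withD(2)] by (intro continuous_intros) auto
  then obtain \<rho>1 M where \<rho>1: "\<rho>1 > 0" "M > 0" "\<And>x. x \<in> tube A \<rho>1 \<Longrightarrow> (\<Sum>j<n. norm (\<phi>' j x)) \<le> M"
    using compact_tube_bound[OF A(1) open_UNIV] by (force simp: sum_nonneg)
  define B where "B = (\<Sum>j<n. norm (D (p j))) + e"
  have B: "B > 0" unfolding B_def using e by (simp add: add_nonneg_pos sum_nonneg)
  \<comment> \<open>The weights see only \<open>P x\<close>: if \<open>x\<close> lies within
    \<open>\<rho>2\<close> of some \<open>z\<close> in \<open>A\<close>, then \<open>P x\<close>
    lies within \<open>r/16\<close> of \<open>P z = z\<close>.\<close>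
  define \<rho>2 where "\<rho>2 = Min (insert 1 ((\<lambda>j. r (p j)) ` {..<n})) / 16 / (norm P + 1)"
  have minpos: "Min (insert 1 ((\<lambda>j. r (p j)) ` {..<n})) > 0" using r pA by (subst Min_gr_iff) auto
  have Ppos: "norm P + 1 > 0" by (simp add: add_nonneg_pos)
  have \<rho>2: "\<rho>2 > 0" unfolding \<rho>2_def using minpos Ppos by simp
  have \<rho>2r: "norm P * \<rho>2 \<le> r (p j) / 16" if "j < n" for j
  proof -
    have "norm P * \<rho>2 \<le> (norm P + 1) * \<rho>2" using \<rho>2 by simp
    also have "\<dots> = Min (insert 1 ((\<lambda>j. r (p j)) ` {..<n})) / 16"
    proof -
      have "c * (m / 16 / c) = m / 16" if "c > 0" for c m :: real using that by simp
      then show ?thesis unfolding \<rho>2_def using Ppos by blast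
    qed
    also have "\<dots> \<le> r (p j) / 16" using that by (intro divide_right_mono Min_le) auto
    finally show ?thesis .
  qed
  \<comment> \<open>The error budget is \<open>2 * e/3\<close> for averaging the derivatives,
    \<open>e/6\<close> for \<open>B * \<rho> * M\<close> and \<open>e/6\<close> for
    \<open>s * M\<close>.\<close>
  define \<rho> where "\<rho> = min (min \<rho>1 \<rho>2) (e / (6 * M * B))"
  have \<rho>: "\<rho> > 0" "\<rho> \<le> \<rho>1" "\<rho> \<le> \<rho>2" "\<rho> * B * M \<le> e / 6"
  proof -
    show "\<rho> > 0" using \<rho>1 \<rho>2 B e by (simp add: \<rho>_def)
    show "\<rho> \<le> \<rho>1" "\<rho> \<le> \<rho>2" by (auto simp: \<rho>_def)
    have "\<rho> * (B * M) \<le> (e / (6 * M * B)) * (B * M)" using B \<rho>1 by (intro mult_right_mono) (auto simp: \<rho>_def)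
    also have "\<dots> = e / 6" using B \<rho>1 by simp
    finally show "\<rho> * B * M \<le> e / 6" by (simp add: mult_ac)
  qed
  have PA: "dist (P x) z \<le> norm P * dist x z" if "z \<in> A" for x z
    using norm_blinfun[of P "x - z"] A(2)[OF that] by (simp add: dist_norm blinfun.bilinear_simps)
  have near: "z \<in> A \<inter> cball (p j) (r (p j))" if "z \<in> A" "dist z x < \<rho>" "j < n" "\<phi> j x \<noteq> 0" for z x j
  proof -
    have "norm P * dist x z \<le> norm P * \<rho>2"
      using that \<rho> by (intro mult_left_mono) (auto simp: dist_commute)
    then have "dist (P x) z \<le> r (p j) / 16" using PA[OF that(1)] \<rho>2r[OF that(3)] by (meson order_trans)
    moreover have "dist (P x) (p j) \<le> 3 * r (p j) / 8" by (rule b(4)[OF that(3) \<phi>ne[OF that(4)]])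
    ultimately show ?thesis using that dist_triangle2[of "p j" z "P x"] r[OF pA[OF that(3)]]
      by (auto simp: dist_commute)
  qed
  have sum1: "(\<Sum>j<n. \<phi> j x) = 1" if xt: "x \<in> tube A \<rho>" for x
  proof -
    obtain z where z: "z \<in> A" "dist z x < \<rho>" using xt by (auto simp: tube_def)
    obtain j where j: "j < n" "dist (p j) z < r (p j) / 16" using cover[OF z(1)] by blast
    have "norm P * dist x z \<le> norm P * \<rho>2"
      using z \<rho> by (intro mult_left_mono) (auto simp: dist_commute)
    then have "dist (P x) z \<le> r (p j) / 16" using PA[OF z(1)] \<rho>2r[OF j(1)] by (meson order_trans)
    then have "dist (P x) (p j) \<le> r (p j) / 8"
      using j(2) dist_triangle2[of "P x" "p j" z] by (simp add: dist_commute)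
    then show ?thesis unfolding \<phi>_def using b(3)[OF j(1)] j(1) by (intro seq_part_sum_eq_1) auto
  qed
  have sum0: "(\<Sum>j<n. \<phi>' j x) = 0" if "x \<in> tube A \<rho>" for x
  proof -
    have "C1_with (tube A \<rho>) (\<lambda>x. \<Sum>j<n. \<phi> j x) (\<lambda>x. \<Sum>j<n. \<phi>' j x)"
      using \<phi>' C1_with_subset by (intro C1_with_sum) blast
    then show ?thesis using open_tube that sum1 by (rule C1_with_zero_const)
  qed
  have "\<exists>g g'. C1_with UNIV g g' \<and> (\<forall>z\<in>A. \<forall>x. dist z x < \<rho> \<longrightarrow> norm (g' x - D z) \<le> e) \<and>
     (\<forall>z\<in>A. norm (g z - f z) \<le> t)" if t: "t > 0" for t
  proof -
    define s where "s = min t (e / (6 * M))"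
    have s: "s > 0" "s \<le> t" "s * M \<le> e / 6"
    proof -
      show "s > 0" "s \<le> t" using t e \<rho>1 by (auto simp: s_def)
      have "s * M \<le> (e / (6 * M)) * M" using \<rho>1 by (intro mult_right_mono) (auto simp: s_def)
      then show "s * M \<le> e / 6" using \<rho>1 by simp
    qed
    have "\<forall>j. \<exists>\<psi> \<psi>'. j < n \<longrightarrow> C1_with UNIV \<psi> \<psi>' \<and> (\<forall>x. norm (\<psi>' x - D (p j)) \<le> e / 3) \<and>
       (\<forall>z\<in>A \<inter> cball (p j) (r (p j)). norm (\<psi> z - f z) < s)" using r\<psi> pA s(1) by blast
    then obtain \<psi> \<psi>' where \<psi>: "\<And>j. j < n \<Longrightarrow> C1_with UNIV (\<psi> j) (\<psi>' j)"
      "\<And>j x. j < n \<Longrightarrow> norm (\<psi>' j x - D (p j)) \<le> e / 3"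
      "\<And>j z. j < n \<Longrightarrow> z \<in> A \<inter> cball (p j) (r (p j)) \<Longrightarrow> norm (\<psi> j z - f z) < s" by metis
    have \<psi>B: "norm (\<psi>' j x) \<le> B" if "j < n" for j x
    proof -
      have "norm (\<psi>' j x) \<le> norm (D (p j)) + norm (\<psi>' j x - D (p j))" by (rule norm_triangle_sub)
      also have "norm (D (p j)) \<le> (\<Sum>j<n. norm (D (p j)))"
        using that by (intro member_le_sum) auto
      finally show ?thesis using \<psi>(2)[OF that, of x] e by (simp add: B_def)
    qed
    define g where "g x = (\<Sum>j<n. \<phi> j x *\<^sub>R \<psi> j x)" for x
    define g' where "g' x = (\<Sum>j<n. \<phi> j x *\<^sub>R \<psi>' j x + (blinfun_scaleR_left (\<psi> j x) o\<^sub>L \<phi>' j x))" for x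
    have g: "C1_with UNIV g g'" unfolding g_def g'_def
      using \<phi>' \<psi> by (intro C1_with_sum C1_with_scaleR) auto
    have "norm (g' x - D z) \<le> e" if z: "z \<in> A" "dist z x < \<rho>" for x z
    proof -
      have xt: "x \<in> tube A \<rho>" using z by (rule tubeI)
      have e2: "(\<Sum>j<n. blinfun_scaleR_left (f z) o\<^sub>L \<phi>' j x) = 0"
        using sum0[OF xt] by (simp add: blinfun_compose.sum_right[symmetric] blinfun_compose.zero_right)
      \<comment> \<open>The weights sum to the constant 1 on the tube, so their derivatives sum to 0
        and \<open>f z\<close> may be subtracted from every \<open>\<psi> j x\<close>.\<close>
      have "g' x - D z = ((\<Sum>j<n. \<phi> j x *\<^sub>R \<psi>' j x) - D z) + (\<Sum>j<n. blinfun_scaleR_left (\<psi> j x - f z) o\<^sub>L \<phi>' j x)"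
      proof -
        have "blinfun_scaleR_left (\<psi> j x - f z) o\<^sub>L \<phi>' j x =
           (blinfun_scaleR_left (\<psi> j x) o\<^sub>L \<phi>' j x) - (blinfun_scaleR_left (f z) o\<^sub>L \<phi>' j x)" for j
          by (rule blinfun_eqI) (simp add: blinfun.bilinear_simps scaleR_diff_right)
        then show ?thesis
          by (simp add: g'_def sum.distrib sum_subtractf e2)
      qed
      also have "norm \<dots> \<le> norm ((\<Sum>j<n. \<phi> j x *\<^sub>R \<psi>' j x) - D z) + norm (\<Sum>j<n. blinfun_scaleR_left (\<psi> j x - f z) o\<^sub>L \<phi>' j x)"
        by (rule norm_triangle_ineq)
      also have "norm ((\<Sum>j<n. \<phi> j x *\<^sub>R \<psi>' j x) - D z) \<le> 2 * e / 3"
      proof (rule norm_convex_combination_le[OF \<phi>0 sum1[OF xt]])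
        fix j assume j: "j < n" "\<phi> j x \<noteq> 0"
        show "norm (\<psi>' j x - D z) \<le> 2 * e / 3"
          using \<psi>(2)[OF j(1), of x] rD[OF pA[OF j(1)] near[OF z j]]
            norm_triangle_ineq4[of "\<psi>' j x - D (p j)" "D z - D (p j)"] by simp
      qed
      also have "norm (\<Sum>j<n. blinfun_scaleR_left (\<psi> j x - f z) o\<^sub>L \<phi>' j x) \<le> (\<Sum>j<n. (B * \<rho> + s) * norm (\<phi>' j x))"
      proof (rule sum_norm_le)
        fix j assume "j \<in> {..<n}"
        then have j: "j < n" by simp
        show "norm (blinfun_scaleR_left (\<psi> j x - f z) o\<^sub>L \<phi>' j x) \<le> (B * \<rho> + s) * norm (\<phi>' j x)"
        proof (cases "\<phi> j x = 0")
          case True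
          then show ?thesis using \<phi>'0[OF j] by (simp add: blinfun_compose.zero_right)
        next
          case False
          have "norm (\<psi> j z - f z) < s" by (rule \<psi>(3)[OF j near[OF z j False]])
          moreover have "norm (\<psi> j x - \<psi> j z) \<le> B * norm (x - z)"
            by (rule C1_with_bound[OF \<psi>(1)[OF j] convex_UNIV]) (use \<psi>B[OF j] in auto)
          moreover have "B * norm (x - z) \<le> B * \<rho>"
            using z B by (intro mult_left_mono) (auto simp: dist_norm norm_minus_commute)
          ultimately have "norm (\<psi> j x - f z) \<le> B * \<rho> + s"
            using norm_triangle_ineq[of "\<psi> j x - \<psi> j z" "\<psi> j z - f z"] by simp
          then show ?thesis
            using norm_scaleR_left_compose[of "\<psi> j x - f z" "\<phi>' j x"]
            by (meson mult_right_mono norm_ge_zero order_trans)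
        qed
      qed
      also have "\<dots> \<le> (B * \<rho> + s) * M"
      proof -
        have "x \<in> tube A \<rho>1" using xt tube_mono[OF \<rho>(2)] by blast
        then show ?thesis using \<rho>1(3) B \<rho>(1) s(1)
          by (simp add: sum_distrib_left[symmetric] mult_left_mono)
      qed
      also have "\<dots> \<le> e / 3" using \<rho>(4) s(3) by (simp add: algebra_simps)
      finally show ?thesis by simp
    qed
    moreover have "norm (g z - f z) \<le> t" if z: "z \<in> A" for z
    proof -
      have xt: "z \<in> tube A \<rho>" using z \<rho>(1) by (intro tubeI[of z]) auto
      have "norm (g z - f z) \<le> s" unfolding g_def
      proof (rule norm_convex_combination_le[OF \<phi>0 sum1[OF xt]])
        fix j assume j: "j < n" "\<phi> j z \<noteq> 0"
        show "norm (\<psi> j z - f z) \<le> s" using \<psi>(3)[OF j(1) near[OF z _ j]] \<rho>(1) by simp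
      qed
      then show ?thesis using s by simp
    qed
    ultimately show ?thesis using g by blast
  qed
  then show ?thesis using \<rho>(1) by blast
qed

text \<open>The extension is \<open>G 0\<close> plus the series of cut-off differences of
  consecutive approximations. On \<open>A\<close> the cutoffs are 1 and the series telescopes to
  \<open>f\<close>; on the support of the n-th cutoff the difference is at most
  \<open>4 * \<epsilon> n * R n\<close>, which outweighs the derivative \<open>C / R n\<close> of
  the cutoff and makes the derivatives summable.\<close>

theorem whitney_extension:
  "\<exists>g g'. C1_with UNIV g g' \<and> (\<forall>y\<in>A. g y = f y \<and> g' y = D y o\<^sub>L P)"
proof (cases "A = {}")
  case True
  then show ?thesis using C1_with_const[of UNIV "0::'a"] by blast
next
  case ne: False
  then obtain a where a: "a \<in> A" by blast
  define \<epsilon> where "\<epsilon> n = (1/2 :: real)^n" for n :: nat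
  have \<epsilon>: "\<epsilon> n > 0" "\<epsilon> (Suc n) \<le> \<epsilon> n" for n by (auto simp: \<epsilon>_def)
  have \<epsilon>s: "summable \<epsilon>" unfolding \<epsilon>_def by (rule summable_geometric) simp
  obtain \<rho> where \<rho>: "\<And>n. \<rho> n > 0" and ap: "\<And>n t. t > 0 \<Longrightarrow> \<exists>g g'. C1_with UNIV g g' \<and>
     (\<forall>z\<in>A. \<forall>x. dist z x < \<rho> n \<longrightarrow> norm (g' x - D z) \<le> \<epsilon> n) \<and> (\<forall>z\<in>A. norm (g z - f z) \<le> t)"
    using jet_approx[OF \<epsilon>(1)] by metis
  \<comment> \<open>The n-th difference involves both \<open>g n\<close> and
    \<open>g (Suc n)\<close>, hence both radii; the bound 1 makes
    \<open>\<tau> n \<le> \<epsilon> n\<close>, so that \<open>g n\<close> converges to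
    \<open>f\<close> on \<open>A\<close>.\<close>
  define R where "R n = min 1 (min (\<rho> n) (\<rho> (Suc n)))" for n
  have R: "R n > 0" "R n \<le> 1" "R n \<le> \<rho> n" "R n \<le> \<rho> (Suc n)" for n using \<rho> by (auto simp: R_def)
  \<comment> \<open>\<open>g n\<close> occurs in the differences with indices n - 1 and n, and must
    be accurate relative to both radii. For n = 0 truncated subtraction gives \<open>R 0\<close>
    twice.\<close>
  define \<tau> where "\<tau> n = \<epsilon> n * min (R n) (R (n - 1))" for n
  have \<tau>: "\<tau> n > 0" "\<tau> n \<le> \<epsilon> n * R n" "\<tau> (Suc n) \<le> \<epsilon> n * R n" "\<tau> n \<le> \<epsilon> n" for n
  proof -
    show "\<tau> n > 0" using \<epsilon> R by (simp add: \<tau>_def)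
    show *: "\<tau> n \<le> \<epsilon> n * R n" unfolding \<tau>_def using \<epsilon>(1)[of n] by (intro mult_left_mono) auto
    have "\<tau> (Suc n) \<le> \<epsilon> (Suc n) * R n" unfolding \<tau>_def using \<epsilon>(1)[of "Suc n"] by (intro mult_left_mono) auto
    also have "\<dots> \<le> \<epsilon> n * R n" using \<epsilon>(2) R(1)[of n] by (intro mult_right_mono) auto
    finally show "\<tau> (Suc n) \<le> \<epsilon> n * R n" .
    have "\<epsilon> n * R n \<le> \<epsilon> n * 1" using \<epsilon>(1)[of n] R(2) by (intro mult_left_mono) auto
    then show "\<tau> n \<le> \<epsilon> n" using * by simp
  qed
  have "\<exists>g g'. C1_with UNIV g g' \<and> (\<forall>z\<in>A. \<forall>x. dist z x < \<rho> n \<longrightarrow> norm (g' x - D z) \<le> \<epsilon> n) \<and>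
      (\<forall>z\<in>A. norm (g z - f z) \<le> \<tau> n)" for n
    by (rule ap[OF \<tau>(1)])
  then obtain g g' where g: "\<And>n. C1_with UNIV (g n) (g' n)"
    "\<And>n z x. z \<in> A \<Longrightarrow> dist z x < \<rho> n \<Longrightarrow> norm (g' n x - D z) \<le> \<epsilon> n"
    "\<And>n z. z \<in> A \<Longrightarrow> norm (g n z - f z) \<le> \<tau> n" by metis
  obtain C where C: "C > 0" and cut: "\<forall>A r. r > 0 \<longrightarrow>
     (\<exists>b b'. C1_with UNIV b b' \<and> (\<forall>x. norm (b' x) \<le> C / r) \<and> cutoff P A r b)"
    using star_cutoff[OF P star nontriv] by (elim exE conjE) (rule that)
  have "\<exists>b b'. C1_with UNIV b b' \<and> (\<forall>x. norm (b' x) \<le> C / R n) \<and> cutoff P A (R n) b" for n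
    using cut[rule_format, OF R(1)] .
  then obtain b b' where b: "\<And>n. C1_with UNIV (b n) (b' n)" "\<And>n x. norm (b' n x) \<le> C / R n"
    "\<And>n x. 0 \<le> b n x" "\<And>n x. b n x \<le> (1::real)"
    "\<And>n x. infdist (P x) A \<le> R n / 4 \<Longrightarrow> b n x = 1" "\<And>n x. 3 * R n / 4 \<le> infdist (P x) A \<Longrightarrow> b n x = 0"
    unfolding cutoff_def by metis
  have b'0: "b' n x = 0" if "b n x = 0" for n x
    by (rule C1_with_zero_at_min[OF b(1) open_UNIV]) (use that b(3) in auto)
  have b'1: "b' n x = 0" if "b n x = 1" for n x
  proof -
    have "0 - b' n x = 0"
      by (rule C1_with_zero_at_min[OF C1_with_diff[OF C1_with_const[of _ 1] b(1)[of n]] open_UNIV])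
        (use that b(4) in auto)
    then show ?thesis by simp
  qed
  \<comment> \<open>The cutoff controls only the distance of \<open>P x\<close> from
    \<open>A\<close>, so the approximations must be evaluated at \<open>P x\<close>; this is the
    origin of the factor \<open>P\<close> in the final derivative.\<close>
  define G where "G n x = g n (P x)" for n x
  define G' where "G' n x = g' n (P x) o\<^sub>L P" for n x
  have G: "C1_with UNIV (G n) (G' n)" for n
    unfolding G_def G'_def using C1_with_compose[OF C1_with_linear g(1)] by auto
  define h where "h n x = b n x *\<^sub>R (G (Suc n) x - G n x)" for n x
  define h' where "h' n x = b n x *\<^sub>R (G' (Suc n) x - G' n x) + (blinfun_scaleR_left (G (Suc n) x - G n x) o\<^sub>L b' n x)" for n x
  have h: "C1_with UNIV (h n) (h' n)" for n
    unfolding h_def h'_def using C1_with_scaleR[OF b(1) C1_with_diff[OF G G]] by auto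
  \<comment> \<open>\<open>2 * norm P\<close> pays for the difference of derivatives, and
    \<open>4 * C\<close> is \<open>4 * \<epsilon> n * R n\<close> times \<open>C / R n\<close> with
    \<open>\<epsilon> n\<close> removed.\<close>
  define K where "K = 2 * norm P + 4 * C"
  have h'b: "norm (h' n x) \<le> K * \<epsilon> n" for n x
  proof (cases "b n x = 0")
    case True
    then show ?thesis using b'0 \<epsilon>(1)[of n] C by (simp add: h'_def K_def blinfun_compose.zero_right)
  next
    case False
    then have "\<not> 3 * R n / 4 \<le> infdist (P x) A" using b(6)[of n x] by blast
    then have "infdist (P x) A < R n" using R(1)[of n] by linarith
    then obtain z where z: "z \<in> A" "dist (P x) z < R n"
      using ne by (auto simp: infdist_def cInf_less_iff split: if_splits)
    have g'd: "norm (g' (Suc n) w - g' n w) \<le> 2 * \<epsilon> n" if "dist z w < R n" for w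
    proof -
      have "norm (g' (Suc n) w - D z) \<le> \<epsilon> (Suc n)" "norm (g' n w - D z) \<le> \<epsilon> n"
        using g(2)[OF z(1)] that R(3,4)[of n] by (smt (verit))+
      then show ?thesis
        using norm_triangle_ineq4[of "g' (Suc n) w - D z" "g' n w - D z"] \<epsilon>(2)[of n] by simp
    qed
    have "norm ((g (Suc n) (P x) - g n (P x)) - (g (Suc n) z - g n z)) \<le> 2 * \<epsilon> n * norm (P x - z)"
      by (rule C1_with_bound[OF C1_with_diff[OF g(1) g(1)] convex_ball[of z "R n"]])
        (use g'd z R(1)[of n] in \<open>auto simp: dist_commute\<close>)
    also have "\<dots> \<le> 2 * \<epsilon> n * R n" using z \<epsilon>(1)[of n] by (intro mult_left_mono) (auto simp: dist_norm)
    finally have 1: "norm ((g (Suc n) (P x) - g n (P x)) - (g (Suc n) z - g n z)) \<le> 2 * \<epsilon> n * R n" .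
    have 2: "norm (g (Suc n) z - g n z) \<le> 2 * \<epsilon> n * R n"
      using g(3)[OF z(1), of n] g(3)[OF z(1), of "Suc n"] \<tau>(2,3)[of n]
        norm_triangle_ineq4[of "g (Suc n) z - f z" "g n z - f z"] by simp
    have Gd: "norm (G (Suc n) x - G n x) \<le> 4 * \<epsilon> n * R n"
      using norm_triangle_sub[of "g (Suc n) (P x) - g n (P x)" "g (Suc n) z - g n z"] 1 2 by (simp add: G_def)
    have "norm (G' (Suc n) x - G' n x) = norm ((g' (Suc n) (P x) - g' n (P x)) o\<^sub>L P)"
      by (simp add: G'_def blinfun_compose.diff_left)
    also have "\<dots> \<le> norm (g' (Suc n) (P x) - g' n (P x)) * norm P" by (rule norm_blinfun_compose)
    also have "\<dots> \<le> 2 * \<epsilon> n * norm P" using g'd z by (intro mult_right_mono) (auto simp: dist_commute)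
    finally have G'd: "norm (G' (Suc n) x - G' n x) \<le> 2 * \<epsilon> n * norm P" .
    have "norm (h' n x) \<le> b n x * norm (G' (Suc n) x - G' n x) + norm (G (Suc n) x - G n x) * norm (b' n x)"
      unfolding h'_def
      by (rule order_trans[OF norm_triangle_ineq])
        (use b(3) norm_scaleR_left_compose in \<open>auto intro!: add_mono\<close>)
    also have "\<dots> \<le> 1 * (2 * \<epsilon> n * norm P) + (4 * \<epsilon> n * R n) * (C / R n)"
      using b(2-4) G'd Gd \<epsilon>(1)[of n] R(1)[of n] by (intro add_mono mult_mono) auto
    also have "\<dots> = K * \<epsilon> n" using R(1)[of n] by (simp add: K_def algebra_simps)
    finally show ?thesis .
  qed
  \<comment> \<open>On \<open>A\<close> the cutoffs attain their maximum 1, so their derivatives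
    vanish and the derivatives telescope too.\<close>
  have atA: "h n z = g (Suc n) z - g n z" "h' n z = (g' (Suc n) z o\<^sub>L P) - (g' n z o\<^sub>L P)" if "z \<in> A" for n z
  proof -
    have "b n z = 1" using b(5)[of z n] A(2)[OF that] R(1)[of n] that by simp
    then show "h n z = g (Suc n) z - g n z" "h' n z = (g' (Suc n) z o\<^sub>L P) - (g' n z o\<^sub>L P)"
      using b'1 A(2)[OF that] by (auto simp: h_def h'_def G_def G'_def blinfun_compose.zero_right)
  qed
  have \<epsilon>0: "\<epsilon> \<longlonglongrightarrow> 0" using \<epsilon>s by (rule summable_LIMSEQ_zero)
  have lim: "(\<lambda>n. g n z) \<longlonglongrightarrow> f z" "(\<lambda>n. g' n z) \<longlonglongrightarrow> D z" if z: "z \<in> A" for z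
  proof -
    have "(\<lambda>n. g n z - f z) \<longlonglongrightarrow> 0"
    proof (rule Lim_null_comparison[OF always_eventually \<epsilon>0], rule allI)
      show "norm (g n z - f z) \<le> \<epsilon> n" for n using g(3)[OF z, of n] \<tau>(4)[of n] by linarith
    qed
    then show "(\<lambda>n. g n z) \<longlonglongrightarrow> f z" by (simp add: LIM_zero_iff)
    have "(\<lambda>n. g' n z - D z) \<longlonglongrightarrow> 0"
    proof (rule Lim_null_comparison[OF always_eventually \<epsilon>0], rule allI)
      show "norm (g' n z - D z) \<le> \<epsilon> n" for n using g(2)[OF z, of z n] \<rho>[of n] by simp
    qed
    then show "(\<lambda>n. g' n z) \<longlonglongrightarrow> D z" by (simp add: LIM_zero_iff)
  qed
  have hs: "(\<lambda>n. h n z) sums (f z - g 0 z)" if "z \<in> A" for z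
    using telescope_sums[OF lim(1)[OF that]] atA(1)[OF that] by simp
  have h's: "(\<lambda>n. h' n z) sums ((D z o\<^sub>L P) - (g' 0 z o\<^sub>L P))" if "z \<in> A" for z
  proof -
    have "(\<lambda>n. g' n z o\<^sub>L P) \<longlonglongrightarrow> (D z o\<^sub>L P)" by (intro tendsto_intros lim(2)[OF that])
    from telescope_sums[OF this] show ?thesis using atA(2)[OF that] by simp
  qed
  have "summable (\<lambda>n. K * \<epsilon> n)" using \<epsilon>s by (rule summable_mult)
  then obtain s s' where s: "C1_with UNIV s s'" "\<And>x. (\<lambda>n. h n x) sums s x" "\<And>x. (\<lambda>n. h' n x) sums s' x"
    using C1_with_series[OF h h'b _ sums_summable[OF hs[OF a]]] by blast
  have "C1_with UNIV (\<lambda>x. G 0 x + s x) (\<lambda>x. G' 0 x + s' x)" by (rule C1_with_add[OF G s(1)])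
  moreover have "G 0 y + s y = f y \<and> G' 0 y + s' y = D y o\<^sub>L P" if y: "y \<in> A" for y
    using sums_unique2[OF s(2) hs[OF y]] sums_unique2[OF s(3) h's[OF y]] A(2)[OF y] by (simp add: G_def G'_def)
  ultimately show ?thesis by blast
qed

end

subsection \<open>Partitions of unity near the compact set\<close>

text \<open>The supremum is monotone in the radius, so a limit 0 needs just one good radius for each
  \<open>e\<close>; pairs of equal points satisfy the product form trivially.\<close>

lemma whitney_tangent_subset_iff:
  "whitney_tangent_subset U m P \<longleftrightarrow>
    (\<forall>e>0. \<exists>r>0. \<forall>x\<in>U \<inter> ball m r. \<forall>y\<in>U \<inter> ball m r. norm (x - y - P (x - y)) \<le> e * norm (x - y))"
proof -
  define F where "F \<epsilon> = (SUP (m1, m2) \<in> {(m1, m2). m1 \<in> U \<inter> ball m \<epsilon> \<and> m2 \<in> U \<inter> ball m \<epsilon> \<and> m1 \<noteq> m2}.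
             ennreal (norm (m1 - m2 - P (m1 - m2)) / norm (m1 - m2)))" for \<epsilon>
  have Fle: "F \<epsilon> \<le> ennreal e \<longleftrightarrow>
      (\<forall>x\<in>U \<inter> ball m \<epsilon>. \<forall>y\<in>U \<inter> ball m \<epsilon>. norm (x - y - P (x - y)) \<le> e * norm (x - y))" if "e > 0" for e \<epsilon> :: real
  proof -
    have "norm (x - y - P (x - y)) / norm (x - y) \<le> e \<longleftrightarrow> norm (x - y - P (x - y)) \<le> e * norm (x - y)"
      if "x \<noteq> y" for x y using that by (simp add: divide_le_eq)
    then show ?thesis unfolding F_def SUP_le_iff using that by (force simp: blinfun.bilinear_simps)
  qed
  have "whitney_tangent_subset U m P \<longleftrightarrow> (F \<longlongrightarrow> 0) (at_right 0)"
    unfolding whitney_tangent_subset_def F_def ..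
  also have "\<dots> \<longleftrightarrow> (\<forall>e>0. \<exists>r>0. F r \<le> ennreal e)"
  proof (intro iffI allI impI)
    fix e :: real assume F: "(F \<longlongrightarrow> 0) (at_right 0)" and e: "e > 0"
    have "\<forall>\<^sub>F \<epsilon> in at_right 0. F \<epsilon> < ennreal e" using e by (intro order_tendstoD(2)[OF F]) simp
    then obtain b where "b > 0" "\<forall>y>0. y < b \<longrightarrow> F y < ennreal e" by (auto simp: eventually_at_right_field)
    then show "\<exists>r>0. F r \<le> ennreal e" by (intro exI[of _ "b / 2"]) (auto intro!: less_imp_le)
  next
    assume R: "\<forall>e>0. \<exists>r>0. F r \<le> ennreal e"
    show "(F \<longlongrightarrow> 0) (at_right 0)"
    proof (rule order_tendstoI)
      fix a :: ennreal assume "0 < a"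
      then obtain c where c: "0 < c" "c < a" using dense by blast
      then obtain e where e: "c = ennreal e" "e > 0" by (cases c) (auto simp: ennreal_less_zero_iff)
      obtain r where r: "r > 0" "F r \<le> ennreal e" using R e by blast
      have "F \<epsilon> \<le> F r" if "\<epsilon> \<le> r" for \<epsilon>
        unfolding F_def by (rule SUP_subset_mono) (use that in auto)
      then have "F \<epsilon> < a" if "\<epsilon> \<le> r" for \<epsilon> using r e c that by (meson order.strict_trans1 order_trans)
      then show "\<forall>\<^sub>F \<epsilon> in at_right 0. F \<epsilon> < a"
        using r(1) by (auto simp: eventually_at_right_field intro!: exI[of _ r])
    qed simp
  qed
  also have "\<dots> \<longleftrightarrow> (\<forall>e>0. \<exists>r>0. \<forall>x\<in>U \<inter> ball m r. \<forall>y\<in>U \<inter> ball m r. norm (x - y - P (x - y)) \<le> e * norm (x - y))"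
    using Fle by simp
  finally show ?thesis .
qed

text \<open>One tolerance \<open>\<eta>\<close> serves all projections of norm at most
  \<open>M\<close>. This uniformity is needed because the projections over the manifold are only
  known to be bounded, not to form a compact family.\<close>

lemma projection_retraction_near:
  fixes M e :: real
  assumes M: "M \<ge> 0" and e: "e > 0"
  shows "\<exists>\<eta>>0. \<exists>\<Omega> R R'. open \<Omega> \<and> C1_with \<Omega> R R' \<and>
    (\<forall>P S :: 'a::banach \<Rightarrow>\<^sub>L 'a. bounded_projection P \<and> norm P \<le> M \<and> norm (S - P) \<le> \<eta> \<longrightarrow>
       S \<in> \<Omega> \<and> bounded_projection (R S) \<and> norm (R S - P) \<le> e)"
proof -
  \<comment> \<open>The norm of \<open>S\<close> is at most \<open>M + 1\<close>, so the factor
    \<open>1 + 2 * norm S\<close> of the retraction is at most \<open>2 * M + 3\<close>; the other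
    half of \<open>e\<close> is for \<open>S - P\<close>.\<close>
  define e1 where "e1 = e / 2 / (2 * M + 3)"
  have cancel: "a / c * c = a" if "c > 0" for a c :: real using that by simp
  have e1: "e1 > 0" "e1 * (2 * M + 3) = e / 2"
    unfolding e1_def using cancel[of "2 * M + 3"] e M by (simp, simp only:)
  obtain \<delta> R R' where \<delta>: "\<delta> > 0"
    and R: "C1_with {S :: 'a \<Rightarrow>\<^sub>L 'a. norm ((S o\<^sub>L S) - S) < \<delta>} R R'"
    "\<forall>S :: 'a \<Rightarrow>\<^sub>L 'a. norm ((S o\<^sub>L S) - S) < \<delta> \<longrightarrow> bounded_projection (R S) \<and> norm (R S - S) \<le> e1 * (1 + 2 * norm S)"
    using projection_retraction[OF e1(1), where 'a = 'a] by (elim exE conjE) (rule that)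
  \<comment> \<open>With \<open>E = S - P\<close> the defect is \<open>P E + E P + E^2 - E\<close>,
    of norm at most \<open>e2 * (2 * M + 2)\<close> since \<open>e2 \<le> 1\<close>.\<close>
  define e2 where "e2 = min (min (e / 2) 1) (\<delta> / 2 / (2 * M + 2))"
  have e2: "e2 > 0" "e2 \<le> e / 2" "e2 \<le> 1" "e2 * (2 * M + 2) \<le> \<delta> / 2"
  proof -
    show "e2 > 0" using e \<delta> M by (auto simp: e2_def)
    show "e2 \<le> e / 2" "e2 \<le> 1" unfolding e2_def by linarith+
    have "e2 * (2 * M + 2) \<le> (\<delta> / 2 / (2 * M + 2)) * (2 * M + 2)"
      using M by (intro mult_right_mono) (auto simp: e2_def)
    then show "e2 * (2 * M + 2) \<le> \<delta> / 2" using cancel[of "2 * M + 2" "\<delta> / 2"] M by linarith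
  qed
  define \<Omega> where "\<Omega> = {S :: 'a \<Rightarrow>\<^sub>L 'a. norm ((S o\<^sub>L S) - S) < \<delta>}"
  have "open \<Omega>" unfolding \<Omega>_def by (intro open_Collect_less continuous_intros)
  moreover have "S \<in> \<Omega> \<and> bounded_projection (R S) \<and> norm (R S - P) \<le> e"
    if P: "bounded_projection P" "norm P \<le> M" and S: "norm (S - P) \<le> e2" for P S :: "'a \<Rightarrow>\<^sub>L 'a"
  proof -
    define E where "E = S - P"
    have E: "norm E \<le> e2" using S by (simp add: E_def)
    have Sx: "S = P + E" by (simp add: E_def)
    have "(S o\<^sub>L S) - S = (P o\<^sub>L E) + (E o\<^sub>L P) + ((E o\<^sub>L E) - E)"
      unfolding Sx by (rule blinfun_eqI) (simp add: blinfun.bilinear_simps bounded_projection_apply[OF P(1)])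
    also have "norm \<dots> \<le> norm P * norm E + norm E * norm P + (norm E * norm E + norm E)"
      by (intro order_trans[OF norm_triangle_ineq] order_trans[OF norm_triangle_ineq4] add_mono norm_blinfun_compose order_refl)
    also have "\<dots> \<le> M * e2 + e2 * M + (1 * e2 + e2)"
      using E M P(2) e2 by (intro add_mono mult_mono) auto
    also have "\<dots> = e2 * (2 * M + 2)" by (simp add: algebra_simps)
    also have "\<dots> < \<delta>" using e2(4) \<delta> by simp
    finally have *: "norm ((S o\<^sub>L S) - S) < \<delta>" .
    have "norm S \<le> M + 1" using norm_triangle_ineq[of P E] E e2(3) P(2) by (simp add: Sx)
    then have "e1 * (1 + 2 * norm S) \<le> e1 * (2 * M + 3)" using e1(1) by (intro mult_left_mono) auto
    then have "norm (R S - S) \<le> e / 2" using R(2)[rule_format, OF *] e1(2) by simp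
    then have "norm (R S - P) \<le> e"
      using E e2(2) norm_triangle_ineq[of "R S - S" "S - P"] by (simp add: E_def)
    then show ?thesis using R(2) * by (simp add: \<Omega>_def)
  qed
  ultimately show ?thesis using e2(1) R(1) unfolding \<Omega>_def[symmetric] by blast
qed

section \<open>The field of projections along K: bumps, partitions and extensions\<close>

locale tangent_field =
  fixes K :: "'a::banach set" and Pic :: "'a \<Rightarrow> 'a \<Rightarrow>\<^sub>L 'a"
  assumes compact_K: "compact K"
    and proj: "\<And>m. m \<in> K \<Longrightarrow> bounded_projection (Pic m)"
    and cont_Pic: "continuous_on K Pic"
    and tangent: "\<And>m. m \<in> K \<Longrightarrow> whitney_tangent_subset K m (Pic m)"
    and star: "\<And>m. m \<in> K \<Longrightarrow> property_star (range (blinfun_apply (Pic m)))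
                         (range (blinfun_apply (id_blinfun - Pic m)))"
begin

definition Pih :: "'a \<Rightarrow> 'a \<Rightarrow>\<^sub>L 'a" where "Pih m = id_blinfun - Pic m"

lemma Pih_apply: "Pih m v = v - Pic m v"
  by (simp add: Pih_def blinfun.bilinear_simps)

lemma cont_Pih: "continuous_on K Pih"
  unfolding Pih_def by (intro continuous_intros cont_Pic)

lemma Pih_Pic:
  assumes "m \<in> K"
  shows "Pic m (Pic m v) = Pic m v" "Pih m (Pih m v) = Pih m v" "Pic m (Pih m v) = 0" "Pih m (Pic m v) = 0"
  using bounded_projection_apply[OF proj[OF assms]] by (auto simp: Pih_apply blinfun.bilinear_simps)

lemma Pih_eq_0: "Pih m = 0 \<longleftrightarrow> Pic m = id_blinfun"
  by (auto simp: Pih_def)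

lemma K_cone:
  assumes "m \<in> K" "e > 0"
  shows "\<exists>r>0. \<forall>x\<in>K \<inter> ball m r. \<forall>y\<in>K \<inter> ball m r. norm (Pih m (x - y)) \<le> e * norm (x - y)"
  using tangent[OF assms(1)] assms(2) unfolding whitney_tangent_subset_iff Pih_apply by blast

text \<open>A function of \<open>P x\<close> is a bump on a cylinder unbounded along the kernel of
  \<open>P\<close>. Multiplying by the indicator of a ball keeps it C1 on a thin tube: near the
  sphere, points of K are displaced from \<open>m\<close> mainly along range P, so the cylinder
  function is already 0 there.\<close>

lemma cylinder_bump:
  assumes m: "m \<in> K" "Pic m \<noteq> id_blinfun" and r: "r > 0"
  shows "\<exists>\<eta>>0. \<exists>s>0. \<exists>\<xi> \<xi>'. C1_with (tube K \<eta>) \<xi> \<xi>' \<and> (\<forall>x. 0 \<le> \<xi> x \<and> \<xi> x \<le> (1::real)) \<and>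
     (\<forall>x\<in>ball m s. \<xi> x = 1) \<and> (\<forall>x. \<xi> x \<noteq> 0 \<longrightarrow> dist m x < r)"
proof -
  define P where "P = Pic m"
  obtain r1 where r1: "r1 > 0" "\<And>x. x \<in> K \<Longrightarrow> dist m x < r1 \<Longrightarrow> norm (Pih m (x - m)) \<le> 1/2 * norm (x - m)"
    using K_cone[OF m(1), of "1/2"] m(1) by auto
  define r0 where "r0 = min r (r1 / 2)"
  have r0: "r0 > 0" "r0 \<le> r" "2 * r0 \<le> r1" using r r1 by (auto simp: r0_def)
  have slope: "norm (z - m) \<le> 2 * norm (P (z - m))" if "z \<in> K" "dist m z < 2 * r0" for z
    using r1(2)[OF that(1)] r0(3) that(2) norm_triangle_sub[of "z - m" "P (z - m)"] by (simp add: Pih_apply P_def)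
  obtain Cc where cut: "\<forall>A r. r > 0 \<longrightarrow>
     (\<exists>b b'. C1_with UNIV b b' \<and> (\<forall>x. norm (b' x) \<le> Cc / r) \<and> cutoff P A r b)"
    using star_cutoff[OF proj[OF m(1)] star[OF m(1)] m(2), folded P_def] by (elim exE conjE) (rule that)
  have "r0 / 4 > 0" using r0 by simp
  from cut[rule_format, OF this, of "{P m}"] obtain b b' where b: "C1_with UNIV b b'"
    "\<forall>x. 0 \<le> b x \<and> b x \<le> (1::real)" "\<forall>x. infdist (P x) {P m} \<le> r0 / 4 / 4 \<longrightarrow> b x = 1"
    "\<forall>x. 3 * (r0 / 4) / 4 \<le> infdist (P x) {P m} \<longrightarrow> b x = 0"
    unfolding cutoff_def by (elim exE conjE) (rule that)
  have infd: "infdist (P x) {P m} = norm (P (x - m))" for x by (simp add: dist_norm blinfun.bilinear_simps)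
  define N where "N = norm P + 1"
  have N: "N \<ge> 1" "N > 0" by (auto simp: N_def add_nonneg_pos)
  have PN: "norm (P v) \<le> N * norm v" for v
    using norm_blinfun[of P v] norm_ge_zero[of v] unfolding N_def distrib_right by linarith
  \<comment> \<open>For \<open>y\<close> in the tube and within \<open>\<eta>\<close> of the sphere,
    the nearby \<open>z\<close> in K has \<open>norm (z - m) > r0 - 2 * \<eta>\<close>, so
    \<open>P (y - m)\<close> exceeds \<open>r0/2 - \<eta> - \<eta> * N\<close>, which is above
    \<open>3 * r0/16\<close>, where \<open>b\<close> vanishes.\<close>
  define \<eta> where "\<eta> = r0 / 16 / N"
  have \<eta>: "\<eta> > 0" "\<eta> * N = r0 / 16" "\<eta> \<le> r0 / 16"
    using r0 N by (auto simp: \<eta>_def divide_le_eq)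
  define s where "s = r0 / 16 / N"
  have s: "s > 0" "s * N = r0 / 16" "s \<le> r0 / 16"
    using r0 N by (auto simp: s_def divide_le_eq)
  define \<xi> where "\<xi> x = (if dist m x < r0 then b x else 0)" for x
  have zero: "\<xi> y = 0" if y: "y \<in> tube K \<eta>" "dist m y > r0 - \<eta>" for y
  proof (cases "dist m y < r0")
    case True
    obtain z where z: "z \<in> K" "dist z y < \<eta>" using y(1) by (auto simp: tube_def)
    have "dist m z < 2 * r0" using z(2) True \<eta> r0 dist_triangle2[of m z y] by simp
    then have "norm (z - m) \<le> 2 * norm (P (z - m))" by (rule slope[OF z(1)])
    moreover have "norm (z - m) > r0 - 2 * \<eta>"
      using z(2) y(2) dist_triangle[of m y z] by (simp add: dist_norm norm_minus_commute)
    moreover have "norm (P (z - m)) \<le> norm (P (y - m)) + norm (P (z - y))"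
      using norm_triangle_ineq[of "P (y - m)" "P (z - y)"] by (simp add: blinfun.bilinear_simps)
    moreover have "norm (P (z - y)) \<le> \<eta> * N"
    proof -
      have "N * norm (z - y) \<le> N * \<eta>" using z(2) N by (intro mult_left_mono) (auto simp: dist_norm)
      then show ?thesis using PN[of "z - y"] by (simp add: mult.commute)
    qed
    ultimately have "3 * (r0 / 4) / 4 \<le> norm (P (y - m))" using \<eta> by linarith
    then show ?thesis using b(4) infd by (simp add: \<xi>_def)
  qed (simp add: \<xi>_def)
  have "\<exists>V f'. open V \<and> x \<in> V \<and> C1_with V \<xi> f'" if x: "x \<in> tube K \<eta>" for x
  proof (cases "dist m x < r0")
    case True
    have "C1_with (ball m r0) \<xi> b'"
      by (rule C1_with_cong[OF C1_with_subset[OF b(1)]]) (auto simp: \<xi>_def)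
    then show ?thesis using True by (intro exI[of _ "ball m r0"] exI[of _ b']) auto
  next
    case False
    define V where "V = tube K \<eta> \<inter> {y. r0 - \<eta> < dist m y}"
    have "open V" unfolding V_def by (intro open_Int open_tube open_Collect_less continuous_intros)
    moreover have "x \<in> V" using x False \<eta> by (simp add: V_def)
    moreover have "C1_with V \<xi> (\<lambda>x. 0)"
      by (rule C1_with_cong[OF C1_with_const[of _ 0] \<open>open V\<close>]) (use zero in \<open>auto simp: V_def\<close>)
    ultimately show ?thesis by blast
  qed
  then obtain \<xi>' where "C1_with (tube K \<eta>) \<xi> \<xi>'" using C1_with_local by metis
  moreover have "0 \<le> \<xi> x \<and> \<xi> x \<le> 1" for x using b(2) by (simp add: \<xi>_def)
  moreover have "\<xi> x = 1" if "x \<in> ball m s" for x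
  proof -
    have "norm (P (x - m)) \<le> N * s"
    proof -
      have "N * norm (x - m) \<le> N * s"
        using that N by (intro mult_left_mono) (auto simp: dist_norm norm_minus_commute)
      then show ?thesis using PN[of "x - m"] by simp
    qed
    then have "b x = 1" using b(3) infd s by (simp add: mult.commute)
    moreover have "dist m x < r0" using that s r0 by simp
    ultimately show ?thesis by (simp add: \<xi>_def)
  qed
  moreover have "dist m x < r" if "\<xi> x \<noteq> 0" for x
    using that r0 by (auto simp: \<xi>_def split: if_splits)
  ultimately show ?thesis using \<eta>(1) s(1) by blast
qed

lemma norm_Pih_ge_1:
  assumes "m \<in> K" "Pic m \<noteq> id_blinfun"
  shows "norm (Pih m) \<ge> 1"
proof -
  have "Pih m o\<^sub>L Pih m = Pih m" by (rule blinfun_eqI) (simp add: Pih_Pic[OF assms(1)])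
  then have "norm (Pih m) \<le> norm (Pih m) * norm (Pih m)" using norm_blinfun_compose[of "Pih m" "Pih m"] by simp
  moreover have "norm (Pih m) > 0" using assms(2) Pih_eq_0 by simp
  ultimately show ?thesis by simp
qed

text \<open>On K the norm of \<open>Pih\<close> is continuous with values in {0} or at least 1, so
  both kinds of points form closed, hence compact, subsets.\<close>

lemma separation:
  "compact {m\<in>K. Pic m \<noteq> id_blinfun}"
  "\<exists>d>0. \<forall>x\<in>K. \<forall>y\<in>K. Pic x = id_blinfun \<longrightarrow> Pic y \<noteq> id_blinfun \<longrightarrow> d \<le> dist x y"
proof -
  have cn: "continuous_on K (\<lambda>m. norm (Pih m))" by (intro continuous_intros cont_Pih)
  have "closed (K \<inter> (\<lambda>m. norm (Pih m)) -` {1..})"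
    using compact_imp_closed[OF compact_K] by (intro continuous_closed_preimage[OF cn]) auto
  moreover have eq1: "{m\<in>K. Pic m \<noteq> id_blinfun} = K \<inter> (\<lambda>m. norm (Pih m)) -` {1..}"
    using norm_Pih_ge_1 Pih_eq_0 by force
  ultimately show c1: "compact {m\<in>K. Pic m \<noteq> id_blinfun}"
    using compact_K by (metis Int_absorb2 closed_Int_compact inf_le1 inf_commute)
  have "closed (K \<inter> (\<lambda>m. norm (Pih m)) -` {..0})"
    using compact_imp_closed[OF compact_K] by (intro continuous_closed_preimage[OF cn]) auto
  moreover have "K \<inter> (\<lambda>m. norm (Pih m)) -` {..0} = {m\<in>K. Pic m = id_blinfun}"
    by (rule set_eqI) (simp add: Pih_eq_0)
  ultimately have c0: "compact {m\<in>K. Pic m = id_blinfun}"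
    using compact_K by (metis Int_absorb2 closed_Int_compact inf_le1 inf_commute)
  obtain d where d: "d > 0" "tube {m\<in>K. Pic m = id_blinfun} d \<subseteq> - {m\<in>K. Pic m \<noteq> id_blinfun}"
    using compact_tube_subset[OF c0, of "- {m\<in>K. Pic m \<noteq> id_blinfun}"] compact_imp_closed[OF c1] by blast
  have "d \<le> dist x y" if "x \<in> K" "y \<in> K" "Pic x = id_blinfun" "Pic y \<noteq> id_blinfun" for x y
  proof (rule ccontr)
    assume "\<not> d \<le> dist x y"
    then have "y \<in> tube {m\<in>K. Pic m = id_blinfun} d" using that by (intro tubeI[of x]) auto
    then show False using d that by blast
  qed
  then show "\<exists>d>0. \<forall>x\<in>K. \<forall>y\<in>K. Pic x = id_blinfun \<longrightarrow> Pic y \<noteq> id_blinfun \<longrightarrow> d \<le> dist x y"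
    using d(1) by blast
qed

text \<open>No bumps exist around points where \<open>Pic\<close> is the identity. There all weights
  are 0, and each later construction must supply its own value on that part.\<close>

definition partition_at ::
    "real \<Rightarrow> ('a \<Rightarrow> real) \<Rightarrow> nat \<Rightarrow> (nat \<Rightarrow> 'a) \<Rightarrow> (nat \<Rightarrow> 'a \<Rightarrow> real) \<Rightarrow> (nat \<Rightarrow> 'a \<Rightarrow> 'a \<Rightarrow>\<^sub>L real) \<Rightarrow> bool" where
  "partition_at \<rho> r n p \<phi> \<phi>' \<longleftrightarrow>
     (\<forall>j<n. p j \<in> K \<and> Pic (p j) \<noteq> id_blinfun \<and> C1_with (tube K \<rho>) (\<phi> j) (\<phi>' j) \<and>
        (\<forall>x. 0 \<le> \<phi> j x \<and> (\<phi> j x \<noteq> 0 \<longrightarrow> dist (p j) x < r (p j)))) \<and>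
     (\<forall>y\<in>K. \<forall>x. dist y x < \<rho> \<longrightarrow>
        (if Pic y = id_blinfun then \<forall>j<n. \<phi> j x = 0 else (\<Sum>j<n. \<phi> j x) = 1))"

lemma partition_near_K:
  assumes r: "\<forall>m\<in>K. r m > 0"
  shows "\<exists>\<rho>>0. \<exists>n p \<phi> \<phi>'. partition_at \<rho> r n p \<phi> \<phi>'"
proof -
  define K1 where "K1 = {m\<in>K. Pic m \<noteq> id_blinfun}"
  obtain d where d: "d > 0" "\<And>x y. x \<in> K \<Longrightarrow> y \<in> K \<Longrightarrow> Pic x = id_blinfun \<Longrightarrow> Pic y \<noteq> id_blinfun \<Longrightarrow> d \<le> dist x y"
    using separation(2) by blast
  \<comment> \<open>Bumps of radius at most \<open>d/2\<close>, on a tube of radius at most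
    \<open>d/2\<close>, cannot reach the part of the tube around points where \<open>Pic\<close> is
    the identity.\<close>
  have "\<exists>\<eta>>0. \<exists>s>0. \<exists>\<xi>. (\<exists>\<xi>'. C1_with (tube K \<eta>) \<xi> \<xi>') \<and> (\<forall>x. 0 \<le> \<xi> x \<and> \<xi> x \<le> (1::real)) \<and>
     (\<forall>x\<in>ball m s. \<xi> x = 1) \<and> (\<forall>x. \<xi> x \<noteq> 0 \<longrightarrow> dist m x < min (r m) (d / 2))" if "m \<in> K1" for m
  proof -
    have "m \<in> K" "Pic m \<noteq> id_blinfun" "min (r m) (d / 2) > 0" using that r d(1) by (auto simp: K1_def)
    from cylinder_bump[OF this] show ?thesis
      by (elim exE conjE) (intro exI conjI; assumption)
  qed
  then have "\<forall>m. \<exists>\<eta> s \<xi>. m \<in> K1 \<longrightarrow> \<eta> > 0 \<and> s > 0 \<and> (\<exists>\<xi>'. C1_with (tube K \<eta>) \<xi> \<xi>') \<and>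
     (\<forall>x. 0 \<le> \<xi> x \<and> \<xi> x \<le> (1::real)) \<and>
     (\<forall>x\<in>ball m s. \<xi> x = 1) \<and> (\<forall>x. \<xi> x \<noteq> 0 \<longrightarrow> dist m x < min (r m) (d / 2))" by blast
  then obtain \<eta> s \<xi> where \<eta>s: "\<forall>m. m \<in> K1 \<longrightarrow> \<eta> m > 0 \<and> s m > 0 \<and> (\<exists>\<xi>'. C1_with (tube K (\<eta> m)) (\<xi> m) \<xi>') \<and>
     (\<forall>x. 0 \<le> \<xi> m x \<and> \<xi> m x \<le> (1::real)) \<and>
     (\<forall>x\<in>ball m (s m). \<xi> m x = 1) \<and> (\<forall>x. \<xi> m x \<noteq> 0 \<longrightarrow> dist m x < min (r m) (d / 2))"
    unfolding choice_iff by (elim exE) (rule that)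
  then have \<eta>: "\<And>m. m \<in> K1 \<Longrightarrow> \<eta> m > 0" and s: "\<And>m. m \<in> K1 \<Longrightarrow> s m > 0"
    and \<xi>: "\<And>m. m \<in> K1 \<Longrightarrow> \<exists>\<xi>'. C1_with (tube K (\<eta> m)) (\<xi> m) \<xi>'"
    "\<And>m x. m \<in> K1 \<Longrightarrow> 0 \<le> \<xi> m x \<and> \<xi> m x \<le> (1::real)"
    "\<And>m x. m \<in> K1 \<Longrightarrow> x \<in> ball m (s m) \<Longrightarrow> \<xi> m x = 1"
    "\<And>m x. m \<in> K1 \<Longrightarrow> \<xi> m x \<noteq> 0 \<Longrightarrow> dist m x < min (r m) (d / 2)" by blast+
  have "compact K1" unfolding K1_def by (rule separation(1))
  then obtain n p where p: "p ` {..<n} \<subseteq> K1" and cover: "\<And>z. z \<in> K1 \<Longrightarrow> \<exists>j<(n::nat). dist (p j) z < s (p j) / 2"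
    using compact_finite_subcover_balls[of K1 "\<lambda>m. s m / 2"] s by auto
  have pK: "p j \<in> K1" if "j < n" for j using p that by auto
  define \<rho> where "\<rho> = Min (insert (d / 2) ((\<lambda>j. min (\<eta> (p j)) (s (p j) / 2)) ` {..<n}))"
  have \<rho>0: "\<rho> > 0" unfolding \<rho>_def using d s \<eta> pK by (subst Min_gr_iff) auto
  have \<rho>d: "\<rho> \<le> d / 2" unfolding \<rho>_def by (intro Min_le) auto
  have \<rho>j: "\<rho> \<le> \<eta> (p j)" "\<rho> \<le> s (p j) / 2" if "j < n" for j
  proof -
    have "\<rho> \<le> min (\<eta> (p j)) (s (p j) / 2)" unfolding \<rho>_def using that by (intro Min_le) auto
    then show "\<rho> \<le> \<eta> (p j)" "\<rho> \<le> s (p j) / 2" by auto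
  qed
  define b where "b j = \<xi> (p j)" for j
  define \<phi> where "\<phi> = seq_part b"
  have "\<exists>d. C1_with (tube K \<rho>) (\<phi> j) d" if "j < n" for j
    unfolding \<phi>_def b_def
  proof (rule seq_part_C1)
    fix k assume "k \<le> j"
    then have k: "k < n" using that by simp
    show "\<exists>d. C1_with (tube K \<rho>) (\<xi> (p k)) d"
      using \<xi>(1)[OF pK[OF k]] C1_with_subset[OF _ tube_mono[OF \<rho>j(1)[OF k]]] by blast
  qed
  then obtain \<phi>' where \<phi>': "\<And>j. j < n \<Longrightarrow> C1_with (tube K \<rho>) (\<phi> j) (\<phi>' j)" by metis
  have \<phi>0: "0 \<le> \<phi> j x" if "j < n" for j x
    unfolding \<phi>_def b_def by (rule seq_part_nonneg) (use \<xi>(2) pK that in auto)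
  have \<phi>d: "dist (p j) x < min (r (p j)) (d / 2)" if "j < n" "\<phi> j x \<noteq> 0" for j x
    using that(2) by (intro \<xi>(4)[OF pK[OF that(1)]]) (auto simp: \<phi>_def b_def seq_part_def)
  have z: "\<phi> j x = 0" if y: "y \<in> K" "dist y x < \<rho>" "Pic y = id_blinfun" and j: "j < n" for y x j
  proof (rule ccontr)
    assume "\<phi> j x \<noteq> 0"
    then have "dist (p j) x < d / 2" using \<phi>d[OF j] by simp
    then have "dist y (p j) < d" using y(2) \<rho>d dist_triangle2[of y "p j" x] by simp
    then show False using d(2)[OF y(1) _ y(3)] pK[OF j] by (force simp: K1_def)
  qed
  have o: "(\<Sum>j<n. \<phi> j x) = 1" if y: "y \<in> K" "dist y x < \<rho>" "Pic y \<noteq> id_blinfun" for y x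
  proof -
    obtain j where j: "j < n" "dist (p j) y < s (p j) / 2" using cover y by (auto simp: K1_def)
    then have "dist (p j) x < s (p j)" using y(2) \<rho>j(2)[OF j(1)] dist_triangle[of "p j" x y] by simp
    then have "b j x = 1" using \<xi>(3)[OF pK[OF j(1)]] by (simp add: b_def)
    then show ?thesis unfolding \<phi>_def by (rule seq_part_sum_eq_1[OF j(1)])
  qed
  show ?thesis
    unfolding partition_at_def
    by (intro exI[of _ \<rho>] conjI exI[of _ n] exI[of _ p] exI[of _ \<phi>] exI[of _ \<phi>'] \<rho>0 allI impI ballI)
      (use pK \<phi>' \<phi>0 \<phi>d z o in \<open>auto simp: K1_def\<close>)
qed

text \<open>Averages of finitely many values of \<open>Pih\<close>. Where all weights vanish the
  average is 0, which is exactly \<open>Pih y\<close> when \<open>Pic y\<close> is the identity. The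
  radius is doubled because \<open>y\<close> and \<open>p j\<close> are compared through
  \<open>x\<close>.\<close>

lemma Pih_smooth_approx:
  assumes e: "e > 0"
  shows "\<exists>\<rho>>0. \<exists>S S'. C1_with (tube K \<rho>) S S' \<and> (\<forall>y\<in>K. \<forall>x. dist y x < \<rho> \<longrightarrow> norm (S x - Pih y) \<le> e)"
proof -
  have "\<exists>r>0. \<forall>z\<in>K. dist z m < 2 * r \<longrightarrow> dist (Pih z) (Pih m) < e" if m: "m \<in> K" for m
  proof -
    obtain r where "r > 0" "\<forall>z\<in>K. dist z m < r \<longrightarrow> dist (Pih z) (Pih m) < e"
      using cont_Pih[unfolded continuous_on_iff, rule_format, OF m e] by blast
    then show ?thesis by (intro exI[of _ "r / 2"]) auto
  qed
  then obtain r where r: "\<And>m. m \<in> K \<Longrightarrow> r m > 0"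
    "\<And>m z. m \<in> K \<Longrightarrow> z \<in> K \<Longrightarrow> dist z m < 2 * r m \<Longrightarrow> dist (Pih z) (Pih m) < e" by metis
  have rp: "\<forall>m\<in>K. r m > 0" using r(1) by blast
  obtain \<rho>0 n p \<phi> \<phi>' where \<rho>0: "\<rho>0 > 0" and pt: "partition_at \<rho>0 (r) n p \<phi> \<phi>'"
    using partition_near_K[OF rp] by (elim exE conjE) (rule that)
  note \<phi> = pt[unfolded partition_at_def, THEN conjunct1]
    and one = pt[unfolded partition_at_def, THEN conjunct2]
  define \<rho> where "\<rho> = Min (insert \<rho>0 ((\<lambda>j. r (p j)) ` {..<n}))"
  have \<rho>: "\<rho> > 0" "\<rho> \<le> \<rho>0" "\<And>j. j < n \<Longrightarrow> \<rho> \<le> r (p j)"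
    unfolding \<rho>_def using \<rho>0 r(1) \<phi> by (auto intro!: Min_le)
  define S where "S x = (\<Sum>j<n. \<phi> j x *\<^sub>R Pih (p j))" for x
  have "\<exists>d. C1_with (tube K \<rho>) (\<lambda>x. \<phi> j x *\<^sub>R Pih (p j)) d" if "j < n" for j
    using C1_with_scaleR[OF C1_with_subset[OF _ tube_mono[OF \<rho>(2)]] C1_with_const] \<phi> that by blast
  then obtain D where "\<And>j. j < n \<Longrightarrow> C1_with (tube K \<rho>) (\<lambda>x. \<phi> j x *\<^sub>R Pih (p j)) (D j)" by metis
  then have "C1_with (tube K \<rho>) S (\<lambda>x. \<Sum>j<n. D j x)" unfolding S_def by (intro C1_with_sum) auto
  moreover have "norm (S x - Pih y) \<le> e" if y: "y \<in> K" "dist y x < \<rho>" for x y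
  proof (cases "Pic y = id_blinfun")
    case True
    then have "S x = 0" using one y \<rho>(2) by (auto simp: S_def intro!: sum.neutral)
    then show ?thesis using True e by (simp add: Pih_def)
  next
    case False
    then have s1: "(\<Sum>j<n. \<phi> j x) = 1" using one y \<rho>(2) by (meson order_less_le_trans)
    show ?thesis unfolding S_def
    proof (rule norm_convex_combination_le[OF _ s1])
      fix j assume j: "j < n"
      then show "0 \<le> \<phi> j x" using \<phi> by blast
      assume "\<phi> j x \<noteq> 0"
      then have "dist (p j) x < r (p j)" using \<phi> j by blast
      then have "dist y (p j) < 2 * r (p j)"
        using y \<rho>(3)[OF j] dist_triangle2[of y "p j" x] by simp
      then show "norm (Pih (p j) - Pih y) \<le> e"
        using r(2)[of "p j" y] \<phi> j y by (force simp: dist_norm norm_minus_commute)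
    qed
  qed
  ultimately show ?thesis using \<rho>(1) by blast
qed

lemma Pih_bound: "\<exists>M\<ge>1. \<forall>m\<in>K. norm (Pih m) \<le> M"
proof -
  have "bounded (Pih ` K)" using cont_Pih compact_K by (intro compact_imp_bounded compact_continuous_image)
  then obtain M where "\<forall>m\<in>K. norm (Pih m) \<le> M" by (auto simp: bounded_iff)
  then show ?thesis by (intro exI[of _ "max 1 M"]) force
qed

text \<open>An average of projections is only nearly a projection; the smooth retraction repairs it,
  with one tolerance because \<open>Pih\<close> is bounded on K.\<close>

lemma Pih_smooth_projection_approx:
  assumes e: "e > 0"
  shows "\<exists>\<rho>>0. \<exists>H H'. C1_with (tube K \<rho>) H H' \<and> (\<forall>x\<in>tube K \<rho>. bounded_projection (H x)) \<and>
    (\<forall>y\<in>K. \<forall>x. dist y x < \<rho> \<longrightarrow> norm (H x - Pih y) \<le> e)"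
proof -
  obtain M where M: "M \<ge> 1" "\<And>m. m \<in> K \<Longrightarrow> norm (Pih m) \<le> M" using Pih_bound by blast
  obtain \<eta> \<Omega> R R' where \<eta>: "\<eta> > 0" and R: "open \<Omega>" "C1_with \<Omega> R R'"
    "\<forall>P S :: 'a \<Rightarrow>\<^sub>L 'a. bounded_projection P \<and> norm P \<le> M \<and> norm (S - P) \<le> \<eta> \<longrightarrow>
       S \<in> \<Omega> \<and> bounded_projection (R S) \<and> norm (R S - P) \<le> e"
  proof -
    have "M \<ge> 0" using M(1) by simp
    from projection_retraction_near[OF this e, where 'a = 'a] show ?thesis by (elim exE conjE) (rule that)
  qed
  obtain \<rho> S S' where \<rho>: "\<rho> > 0" and S: "C1_with (tube K \<rho>) S S'"
    "\<And>y x. y \<in> K \<Longrightarrow> dist y x < \<rho> \<Longrightarrow> norm (S x - Pih y) \<le> \<eta>"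
    using Pih_smooth_approx[OF \<eta>] by blast
  have near: "S x \<in> \<Omega> \<and> bounded_projection (R (S x)) \<and> norm (R (S x) - Pih y) \<le> e"
    if y: "y \<in> K" "dist y x < \<rho>" for x y
    using R(3) S(2)[OF y] M(2)[OF y(1)] bounded_projection_complement[OF proj[OF y(1)]]
    unfolding Pih_def[symmetric] by blast
  have "C1_with (tube K \<rho>) (\<lambda>x. R (S x)) (\<lambda>x. R' (S x) o\<^sub>L S' x)"
    by (rule C1_with_compose[OF S(1) R(2)]) (use near in \<open>auto simp: tube_def\<close>)
  then show ?thesis using \<rho> near
    by (intro exI[of _ \<rho>] conjI exI[of _ "\<lambda>x. R (S x)"] exI[of _ "\<lambda>x. R' (S x) o\<^sub>L S' x"]) (auto simp: tube_def)
qed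

text \<open>Unlike the smooth field of projections, this extension agrees with \<open>Pih\<close> on
  K. It is the telescoping series of smooth approximations, weighted by tent functions of the
  distance to K.\<close>

lemma Pih_continuous_extension:
  "\<exists>\<rho>>0. \<exists>E. continuous_on (tube K \<rho>) E \<and> (\<forall>y\<in>K. E y = Pih y)"
proof (cases "K = {}")
  case True
  then show ?thesis by (intro exI[of _ 1]) (auto simp: tube_def)
next
  case ne: False
  define \<epsilon> where "\<epsilon> n = (1/2 :: real)^n" for n :: nat
  have \<epsilon>: "\<epsilon> n > 0" "\<epsilon> (Suc n) \<le> \<epsilon> n" for n by (auto simp: \<epsilon>_def)
  have \<epsilon>s: "summable (\<lambda>n. 2 * \<epsilon> n)" unfolding \<epsilon>_def by (intro summable_mult summable_geometric) simp
  obtain \<rho> S where \<rho>: "\<And>n. \<rho> n > 0" and S: "\<And>n. \<exists>S'. C1_with (tube K (\<rho> n)) (S n) S'"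
    "\<And>n y x. y \<in> K \<Longrightarrow> dist y x < \<rho> n \<Longrightarrow> norm (S n x - Pih y) \<le> \<epsilon> n"
    using Pih_smooth_approx[OF \<epsilon>(1)] by metis
  define R where "R n = min (\<rho> n) (\<rho> (Suc n))" for n
  have R: "R n > 0" "R n \<le> \<rho> n" "R n \<le> \<rho> (Suc n)" for n using \<rho> by (auto simp: R_def)
  \<comment> \<open>Only continuity is wanted, so the distance function itself will do: the weight
    is 1 on K and 0 outside the tube on which both approximations are controlled.\<close>
  define \<theta> where "\<theta> n x = max 0 (1 - infdist x K / R n)" for n x
  define h where "h n x = \<theta> n x *\<^sub>R (S (Suc n) x - S n x)" for n x
  have \<theta>c: "isCont (\<theta> n) x" for n x unfolding \<theta>_def using R(1)[of n] by (intro continuous_intros) auto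
  have tb: "\<exists>y\<in>K. dist y x < R n" if "\<theta> n x \<noteq> 0" for n x
  proof -
    have "infdist x K < R n" using that R(1)[of n] by (auto simp: \<theta>_def max_def divide_less_eq split: if_splits)
    then obtain y where "y \<in> K" "dist x y < R n"
      using ne by (auto simp: infdist_def cInf_less_iff split: if_splits)
    then show ?thesis by (auto simp: dist_commute)
  qed
  have hb: "norm (h n x) \<le> 2 * \<epsilon> n * \<theta> n x" for n x
  proof (cases "\<theta> n x = 0")
    case False
    then obtain y where y: "y \<in> K" "dist y x < R n" using tb by blast
    have "norm (S (Suc n) x - S n x) \<le> 2 * \<epsilon> n"
      using S(2)[OF y(1), of x n] S(2)[OF y(1), of x "Suc n"] y(2) R(2,3)[of n] \<epsilon>(2)[of n]
        norm_triangle_ineq4[of "S (Suc n) x - Pih y" "S n x - Pih y"] by simp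
    moreover have "\<theta> n x \<ge> 0" by (simp add: \<theta>_def)
    ultimately show ?thesis by (simp add: h_def mult.commute mult_left_mono)
  qed (simp add: h_def)
  have \<theta>1: "\<theta> n x \<le> 1" for n x using R(1)[of n] infdist_nonneg[of x K] by (simp add: \<theta>_def)
  have hb2: "norm (h n x) \<le> 2 * \<epsilon> n" for n x
  proof -
    have "2 * \<epsilon> n * \<theta> n x \<le> 2 * \<epsilon> n * 1" using \<theta>1 \<epsilon>(1)[of n] by (intro mult_left_mono) auto
    then show ?thesis using hb[of n x] by simp
  qed
  \<comment> \<open>Where the weight vanishes nothing is known about continuity of
    \<open>S n\<close>; the bound \<open>hb\<close> squeezes \<open>h n\<close> to 0
    instead.\<close>
  have hc: "isCont (h n) x" for n x
  proof (cases "\<theta> n x = 0")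
    case True
    have "((\<lambda>y. 2 * \<epsilon> n * \<theta> n y) \<longlongrightarrow> 2 * \<epsilon> n * \<theta> n x) (at x)"
      using \<theta>c unfolding isCont_def by (intro tendsto_intros) auto
    then have "(h n \<longlongrightarrow> 0) (at x)"
      using True hb by (intro Lim_null_comparison[of "h n" "\<lambda>y. 2 * \<epsilon> n * \<theta> n y"]) auto
    then show ?thesis using True by (simp add: isCont_def h_def)
  next
    case False
    then obtain y where y: "y \<in> K" "dist y x < R n" using tb by blast
    have "isCont (S k) x" if "k = n \<or> k = Suc n" for k
    proof -
      have "x \<in> tube K (\<rho> k)" using that y R[of n] by (intro tubeI[of y]) auto
      moreover have "continuous_on (tube K (\<rho> k)) (S k)" using S(1) C1_with_continuous_on by blast
      ultimately show ?thesis using continuous_on_eq_continuous_at[OF open_tube] by blast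
    qed
    then show ?thesis unfolding h_def by (intro continuous_intros \<theta>c) auto
  qed
  define E where "E x = S 0 x + (\<Sum>n. h n x)" for x
  have "uniform_limit UNIV (\<lambda>n x. \<Sum>i<n. h i x) (\<lambda>x. \<Sum>i. h i x) sequentially"
    by (rule Weierstrass_m_test[OF hb2 \<epsilon>s])
  then have "continuous_on UNIV (\<lambda>x. \<Sum>i. h i x)"
    by (rule uniform_limit_theorem[rotated])
      (use hc in \<open>auto intro!: always_eventually continuous_on_sum continuous_at_imp_continuous_on\<close>)
  then have "continuous_on (tube K (\<rho> 0)) E"
    unfolding E_def using S(1)[of 0] C1_with_continuous_on
    by (intro continuous_on_add) (blast intro: continuous_on_subset)+
  moreover have "E y = Pih y" if y: "y \<in> K" for y
  proof -
    have "(\<lambda>n. S n y - Pih y) \<longlonglongrightarrow> 0"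
    proof (rule Lim_null_comparison[OF always_eventually], rule allI)
      show "norm (S n y - Pih y) \<le> \<epsilon> n" for n using S(2)[OF y, of y n] \<rho>[of n] by simp
      show "\<epsilon> \<longlonglongrightarrow> 0" unfolding \<epsilon>_def by (rule LIMSEQ_realpow_zero) auto
    qed
    then have "(\<lambda>n. S n y) \<longlonglongrightarrow> Pih y" by (simp add: LIM_zero_iff)
    then have "(\<lambda>n. S (Suc n) y - S n y) sums (Pih y - S 0 y)" by (rule telescope_sums)
    moreover have "h n y = S (Suc n) y - S n y" for n using y by (simp add: h_def \<theta>_def)
    ultimately show ?thesis by (simp add: E_def sums_iff)
  qed
  ultimately show ?thesis using \<rho> by blast
qed

end

subsection \<open>The manifold as a zero set\<close>

lemma continuous_on_at_point:
  fixes h :: "'a::metric_space \<Rightarrow> 'b::real_normed_vector"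
  assumes "continuous_on S h" "p \<in> S" "e > 0"
  shows "\<exists>r>0. \<forall>x\<in>S. dist x p < r \<longrightarrow> norm (h x - h p) \<le> e"
  using assms unfolding continuous_on_iff dist_norm[of "h _"] by (meson less_imp_le)

context tangent_field
begin

text \<open>Near \<open>p\<close>, K is the graph of \<open>f\<close> over \<open>A = P K'\<close>.
  The tangent condition dictates the jet \<open>D\<close>, and with the Whitney extension
  \<open>g\<close> of this jet the map \<open>Q x - g (P x)\<close> vanishes on K and its derivative
  kills range \<open>Pic y\<close> at each \<open>y\<close>.\<close>

lemma local_defining_map:
  assumes p: "p \<in> K" "Pic p \<noteq> id_blinfun" and e: "e > 0"
  shows "\<exists>R>0. \<exists>\<psi> \<psi>'. C1_with UNIV \<psi> \<psi>' \<and>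
    (\<forall>y\<in>K \<inter> ball p R. \<psi> y = 0 \<and> (\<forall>v. \<psi>' y (Pic y v) = 0) \<and> norm (\<psi>' y - Pih y) \<le> e)"
proof -
  define P where "P = Pic p"
  define Q where "Q = Pih p"
  have PQ: "P (P v) = P v" "Q (Q v) = Q v" "P (Q v) = 0" "Q (P v) = 0" for v
    using Pih_Pic[OF p(1)] by (simp_all add: P_def Q_def)
  have split: "v = P v + Q v" for v by (simp add: P_def Q_def Pih_apply)
  \<comment> \<open>On range Q this is the compression \<open>Q Pih x Q\<close>; the summand
    \<open>P\<close> completes it to an operator equal to the identity at \<open>p\<close>, hence
    invertible nearby.\<close>
  define L where "L x = (Q o\<^sub>L Pih x o\<^sub>L Q) + P" for x
  \<comment> \<open>On K the derivative of \<open>\<psi>\<close> turns out to be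
    \<open>B Q Pih\<close>, and \<open>B Q Pih - Pih = B J\<close>. Since \<open>J p = 0\<close>, it
    is close to \<open>Pih\<close> near \<open>p\<close>.\<close>
  define J where "J x = (Q o\<^sub>L Pih x) - (L x o\<^sub>L Pih x)" for x
  have Lc: "continuous_on K L" unfolding L_def by (intro continuous_intros cont_Pih)
  have Jc: "continuous_on K J" unfolding J_def by (intro continuous_intros cont_Pih Lc)
  have Lp: "L p = id_blinfun"
    by (rule blinfun_eqI) (simp add: L_def blinfun.bilinear_simps PQ flip: Q_def, simp add: P_def Q_def Pih_apply)
  have Jp: "J p = 0" by (rule blinfun_eqI) (simp add: J_def Lp blinfun.bilinear_simps PQ flip: Q_def)
  obtain r1 where r1: "r1 > 0" "\<forall>x\<in>K. dist x p < r1 \<longrightarrow> norm (L x - L p) \<le> 1/2"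
    using continuous_on_at_point[OF Lc p(1), of "1/2"] by auto
  obtain r2 where r2: "r2 > 0" "\<forall>x\<in>K. dist x p < r2 \<longrightarrow> norm (J x - J p) \<le> e / 2"
    using continuous_on_at_point[OF Jc p(1), of "e/2"] e by auto
  obtain r3 where r3: "r3 > 0" "\<forall>x\<in>K \<inter> ball p r3. \<forall>y\<in>K \<inter> ball p r3. norm (Pih p (x - y)) \<le> 1/2 * norm (x - y)"
    using K_cone[OF p(1), of "1/2"] by auto
  define R where "R = min (min r1 r2) r3 / 2"
  have R: "R > 0" "R < r1" "R < r2" "R < r3" using r1 r2 r3 by (auto simp: R_def)
  define K' where "K' = K \<inter> cball p R"
  have K'K: "K' \<subseteq> K" by (auto simp: K'_def)
  have Ln: "norm (L x - id_blinfun) \<le> 1/2" if "x \<in> K'" for x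
    using r1(2) that R Lp by (auto simp: K'_def dist_commute)
  have Jn: "norm (J x) \<le> e / 2" if "x \<in> K'" for x
    using r2(2) that R Jp by (auto simp: K'_def dist_commute)
  have slope: "norm (x - y) \<le> 2 * norm (P x - P y)" if "x \<in> K'" "y \<in> K'" for x y
  proof -
    have "norm (Q (x - y)) \<le> 1/2 * norm (x - y)" using r3(2) that R by (auto simp: K'_def Q_def)
    then show ?thesis
      using norm_triangle_ineq[of "P (x - y)" "Q (x - y)"] split[of "x - y"] by (simp add: blinfun.bilinear_simps)
  qed
  have K'c: "compact K'" unfolding K'_def using compact_K by (intro compact_Int_closed) auto
  define A where "A = P ` K'"
  have inj: "inj_on P K'" using slope by (force simp: inj_on_def)
  define s where "s = inv_into K' P"
  have sP: "s (P x) = x" if "x \<in> K'" for x using inj that by (simp add: s_def)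
  have s: "s a \<in> K'" "P (s a) = a" if "a \<in> A" for a
    using that by (auto simp: s_def A_def inv_into_into f_inv_into_f)
  have sl: "norm (s a - s b) \<le> 2 * norm (a - b)" if "a \<in> A" "b \<in> A" for a b
    using slope[OF s(1)[OF that(1)] s(1)[OF that(2)]] s that by simp
  have "2-lipschitz_on A s" using sl by (intro lipschitz_onI) (auto simp: dist_norm)
  then have sc: "continuous_on A s" by (rule lipschitz_on_continuous_on)
  define f where "f a = Q (s a)" for a
  define B where "B x = binv (L x)" for x
  \<comment> \<open>The slope of range \<open>Pic x\<close> as a graph over range P, with
    \<open>x = s a\<close>: by the identity \<open>key\<close>, \<open>Pih x v = 0\<close> gives
    \<open>Q v = D a (P v)\<close>.\<close>
  define D where "D a = - (B (s a) o\<^sub>L Q o\<^sub>L Pih (s a) o\<^sub>L P)" for a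
  have LB: "L x (B x v) = v" "B x (L x v) = v" if "x \<in> K'" for x v
    using near_id_inverse_apply[OF Ln[OF that]] by (auto simp: B_def)
  have Bn: "norm (B x) \<le> 2" if "x \<in> K'" for x
    using near_id_inverse(3)[OF Ln[OF that]] by (simp add: B_def)
  have key: "Q v + B x (Q (Pih x (P v))) = B x (Q (Pih x v))" if x: "x \<in> K'" for x v
  proof -
    have "Q v = B x (L x (Q v))" using LB(2)[OF x] by simp
    also have "L x (Q v) = Q (Pih x (Q v))" by (simp add: L_def blinfun.bilinear_simps PQ)
    finally have "Q v + B x (Q (Pih x (P v))) = B x (Q (Pih x (P v + Q v)))"
      by (simp add: blinfun.bilinear_simps add.commute)
    then show ?thesis using split[of v] by simp
  qed
  have "\<exists>g g'. C1_with UNIV g g' \<and> (\<forall>y\<in>A. g y = f y \<and> g' y = D y o\<^sub>L P)"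
  proof (rule whitney_extension)
    show "bounded_projection P" unfolding P_def by (rule proj[OF p(1)])
    show "property_star (range (blinfun_apply P)) (range (blinfun_apply (id_blinfun - P)))"
      unfolding P_def by (rule star[OF p(1)])
    show "P \<noteq> id_blinfun" using p(2) by (simp add: P_def)
    show "compact A" unfolding A_def by (intro compact_continuous_image K'c continuous_intros)
    show "P y = y" if "y \<in> A" for y using that PQ by (auto simp: A_def)
    show "P (f y) = 0" for y by (simp add: f_def PQ)
    have "continuous_on A (\<lambda>a. L (s a))"
      by (rule continuous_on_compose2[OF Lc sc]) (use s K'K in auto)
    then have "continuous_on A (\<lambda>a. B (s a))" unfolding B_def
      by (rule continuous_on_binv) (use s Ln in auto)
    moreover have "continuous_on A (\<lambda>a. Pih (s a))"
      by (rule continuous_on_compose2[OF cont_Pih sc]) (use s K'K in auto)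
    ultimately show "continuous_on A D" unfolding D_def by (intro continuous_intros)
    show "P (D y v) = 0" if y: "y \<in> A" for y v
    proof -
      define z where "z = B (s y) (Q (Pih (s y) (P v)))"
      have "P (L (s y) z) = P z" by (simp add: L_def blinfun.bilinear_simps PQ)
      moreover have "L (s y) z = Q (Pih (s y) (P v))" using LB(1)[OF s(1)[OF y]] by (simp add: z_def)
      ultimately have "P z = 0" by (simp add: PQ)
      then show ?thesis by (simp add: D_def z_def blinfun.bilinear_simps)
    qed
    show "\<exists>r>0. \<forall>z\<in>A \<inter> ball y r. \<forall>w\<in>A \<inter> ball y r. norm (f z - f w - D y (z - w)) \<le> e' * norm (z - w)"
      if y: "y \<in> A" and e': "e' > 0" for y e'
    proof -
      define x where "x = s y"
      have x: "x \<in> K'" "x \<in> K" using s(1)[OF y] K'K by (auto simp: x_def)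
      \<comment> \<open>The losses are 2 for the norm of \<open>B\<close>, 2 for the Lipschitz
        constant of \<open>s\<close>, and \<open>norm Q\<close>.\<close>
      define e1 where "e1 = e' / 4 / (norm Q + 1)"
      have Qp: "norm Q + 1 > 0" by (simp add: add_nonneg_pos)
      have e1: "e1 > 0" "4 * e1 * norm Q \<le> e'"
      proof -
        show "e1 > 0" using e' Qp by (simp add: e1_def)
        have "4 * e1 * norm Q \<le> 4 * e1 * (norm Q + 1)" using \<open>e1 > 0\<close> by simp
        also have "\<dots> = e'"
        proof -
          have "4 * (a / 4 / c) * c = a" if "c > 0" for a c :: real using that by simp
          then show ?thesis unfolding e1_def using Qp by blast
        qed
        finally show "4 * e1 * norm Q \<le> e'" .
      qed
      obtain r where r: "r > 0" "\<forall>z\<in>K \<inter> ball x r. \<forall>w\<in>K \<inter> ball x r. norm (Pih x (z - w)) \<le> e1 * norm (z - w)"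
        using K_cone[OF x(2) e1(1)] by blast
      have "norm (f z - f w - D y (z - w)) \<le> e' * norm (z - w)"
        if z: "z \<in> A \<inter> ball y (r / 2)" and w: "w \<in> A \<inter> ball y (r / 2)" for z w
      proof -
        define v where "v = s z - s w"
        have sK: "s a \<in> K \<inter> ball x r" if "a \<in> A \<inter> ball y (r / 2)" for a
          using sl[OF y, of a] that s(1)[of a] K'K by (auto simp: x_def dist_norm)
        have v: "norm (Pih x v) \<le> e1 * norm v" unfolding v_def using r(2) sK[OF z] sK[OF w] by blast
        have Pv: "P v = z - w" using s(2) z w by (simp add: v_def blinfun.bilinear_simps)
        \<comment> \<open>By \<open>key\<close> the jet error is \<open>B x Q\<close> applied to
          \<open>Pih x v\<close> with \<open>v\<close> a chord of K, so the cone condition at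
          \<open>x\<close> makes it small relative to \<open>norm v\<close>.\<close>
        have "f z - f w - D y (z - w) = Q v + B x (Q (Pih x (P v)))"
          using PQ by (simp add: Pv[symmetric]) (simp add: f_def D_def v_def x_def blinfun.bilinear_simps PQ)
        also have "\<dots> = B x (Q (Pih x v))" by (rule key[OF x(1)])
        also have "norm \<dots> \<le> norm (B x) * (norm Q * norm (Pih x v))"
          by (meson norm_blinfun mult_left_mono norm_ge_zero order_trans)
        also have "\<dots> \<le> 2 * (norm Q * (e1 * norm v))"
          using Bn[OF x(1)] v by (intro mult_mono) auto
        also have "norm v \<le> 2 * norm (z - w)" unfolding v_def using sl z w by auto
        also have "2 * (norm Q * (e1 * (2 * norm (z - w)))) = (4 * e1 * norm Q) * norm (z - w)" by simp
        also have "\<dots> \<le> e' * norm (z - w)" using e1(2) by (intro mult_right_mono) auto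
        finally show ?thesis using e1(1) by (simp add: mult_left_mono)
      qed
      then show ?thesis using r(1) by (intro exI[of _ "r / 2"]) auto
    qed
  qed
  then obtain g g' where g: "C1_with UNIV g g'" "\<forall>y\<in>A. g y = f y \<and> g' y = D y o\<^sub>L P" by blast
  define \<psi> where "\<psi> x = Q x - g (P x)" for x
  define \<psi>' where "\<psi>' x = Q - (g' (P x) o\<^sub>L P)" for x
  have "C1_with UNIV \<psi> \<psi>'" unfolding \<psi>_def \<psi>'_def
    by (intro C1_with_diff C1_with_linear C1_with_compose[OF C1_with_linear g(1)]) simp
  moreover have "\<psi> y = 0 \<and> (\<forall>v. \<psi>' y (Pic y v) = 0) \<and> norm (\<psi>' y - Pih y) \<le> e" if y: "y \<in> K \<inter> ball p R" for y
  proof -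
    have yK: "y \<in> K'" "y \<in> K" using y by (auto simp: K'_def)
    then have a: "P y \<in> A" by (simp add: A_def)
    have sy: "s (P y) = y" by (rule sP[OF yK(1)])
    have "\<psi> y = 0" using g(2) a by (simp add: \<psi>_def f_def sy)
    have \<psi>'y: "\<psi>' y v = B y (Q (Pih y v))" for v
      using g(2) a key[OF yK(1), of v] by (simp add: \<psi>'_def D_def sy blinfun.bilinear_simps PQ)
    have "\<psi>' y - Pih y = B y o\<^sub>L J y"
      by (rule blinfun_eqI) (simp add: \<psi>'y J_def blinfun.bilinear_simps LB[OF yK(1)])
    then have "norm (\<psi>' y - Pih y) \<le> norm (B y) * norm (J y)" using norm_blinfun_compose by metis
    also have "\<dots> \<le> 2 * (e / 2)" using Bn Jn yK by (intro mult_mono) auto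
    finally show ?thesis using \<open>\<psi> y = 0\<close> \<psi>'y Pih_Pic[OF yK(2)] by (simp add: blinfun.bilinear_simps)
  qed
  ultimately show ?thesis using R(1) by blast
qed

text \<open>Each local map is pushed into range \<open>H x\<close> before averaging, so
  \<open>H x (\<Phi> x) = \<Phi> x\<close> holds identically. Differentiating this at zeros later
  confines the derivative to range \<open>H x\<close> off K as well, where the local maps alone give
  no control of the rank.\<close>

lemma defining_map:
  assumes e: "e > 0" "e \<le> 1"
  shows "\<exists>\<rho>>0. \<exists>\<Phi> \<Phi>' H H'. C1_with (tube K \<rho>) \<Phi> \<Phi>' \<and> C1_with (tube K \<rho>) H H' \<and>
    (\<forall>x\<in>tube K \<rho>. bounded_projection (H x) \<and> H x (\<Phi> x) = \<Phi> x) \<and>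
    (\<forall>y\<in>K. \<forall>x. dist y x < \<rho> \<longrightarrow> norm (H x - Pih y) \<le> e) \<and>
    (\<forall>y\<in>K. \<Phi> y = 0 \<and> (\<forall>v. \<Phi>' y (Pic y v) = 0) \<and> norm (\<Phi>' y - Pih y) \<le> e)"
proof -
  obtain M where M: "M \<ge> 1" "\<And>m. m \<in> K \<Longrightarrow> norm (Pih m) \<le> M" using Pih_bound by blast
  \<comment> \<open>The final estimate is \<open>(M + 1) * e1\<close> for the local derivative seen
    through \<open>H\<close>, plus \<open>e1 * M\<close> for replacing \<open>H\<close> by
    \<open>Pih\<close>.\<close>
  define e1 where "e1 = e / (2 * M + 1)"
  have e1: "e1 > 0" "e1 * (2 * M + 1) = e" using e M by (auto simp: e1_def)
  have "e1 * 1 \<le> e1 * (2 * M + 1)" using e1(1) M by (intro mult_left_mono) auto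
  then have e1e: "e1 \<le> e" using e1(2) by simp
  obtain \<rho>1 H H' where H: "\<rho>1 > 0" "C1_with (tube K \<rho>1) H H'" "\<forall>x\<in>tube K \<rho>1. bounded_projection (H x)"
    "\<forall>y\<in>K. \<forall>x. dist y x < \<rho>1 \<longrightarrow> norm (H x - Pih y) \<le> e1"
    using Pih_smooth_projection_approx[OF e1(1)] by (elim exE conjE) (rule that)
  have "\<forall>p. \<exists>R \<psi> \<psi>'. p \<in> K \<longrightarrow> R > 0 \<and> (Pic p \<noteq> id_blinfun \<longrightarrow> C1_with UNIV \<psi> \<psi>' \<and>
    (\<forall>y\<in>K \<inter> ball p R. \<psi> y = 0 \<and> (\<forall>v. \<psi>' y (Pic y v) = 0) \<and> norm (\<psi>' y - Pih y) \<le> e1))"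
    using local_defining_map[OF _ _ e1(1)] zero_less_one[where 'a = real] by blast
  then obtain R \<psi> \<psi>' where loc: "\<forall>p. p \<in> K \<longrightarrow> R p > 0 \<and> (Pic p \<noteq> id_blinfun \<longrightarrow> C1_with UNIV (\<psi> p) (\<psi>' p) \<and>
    (\<forall>y\<in>K \<inter> ball p (R p). \<psi> p y = 0 \<and> (\<forall>v. \<psi>' p y (Pic y v) = 0) \<and> norm (\<psi>' p y - Pih y) \<le> e1))"
    unfolding choice_iff by (elim exE) (rule that)
  then have Rpos: "\<forall>m\<in>K. R m > 0" by blast
  obtain \<rho>2 n p \<phi> \<phi>' where \<rho>2: "\<rho>2 > 0" and pt: "partition_at \<rho>2 (R) n p \<phi> \<phi>'"
    using partition_near_K[OF Rpos] by (elim exE conjE) (rule that)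
  note \<phi> = pt[unfolded partition_at_def, THEN conjunct1]
    and one = pt[unfolded partition_at_def, THEN conjunct2]
  define \<rho> where "\<rho> = min \<rho>1 \<rho>2"
  have \<rho>: "\<rho> > 0" "\<rho> \<le> \<rho>1" "\<rho> \<le> \<rho>2" using H(1) \<rho>2 by (auto simp: \<rho>_def)
  have KU: "K \<subseteq> tube K \<rho>" by (rule subset_tube[OF \<rho>(1)])
  have C\<phi>: "C1_with (tube K \<rho>) (\<phi> j) (\<phi>' j)" if "j < n" for j
    using \<phi> that C1_with_subset[OF _ tube_mono[OF \<rho>(3)]] by blast
  have C\<psi>: "C1_with (tube K \<rho>) (\<psi> (p j)) (\<psi>' (p j))" if "j < n" for j
    using \<phi> that loc C1_with_subset[OF _ subset_UNIV] by blast
  have CH: "C1_with (tube K \<rho>) H H'" by (rule C1_with_subset[OF H(2) tube_mono[OF \<rho>(2)]])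
  define W where "W j x = H x (\<psi> (p j) x)" for j x
  define W' where "W' j x = (bounded_bilinear.prod_right blinfun_apply (H x) o\<^sub>L \<psi>' (p j) x) +
      (bounded_bilinear.prod_left blinfun_apply (\<psi> (p j) x) o\<^sub>L H' x)" for j x
  have CW: "C1_with (tube K \<rho>) (W j) (W' j)" if "j < n" for j
    unfolding W_def W'_def
    by (rule C1_with_bilinear[OF bounded_bilinear_blinfun_apply CH C\<psi>[OF that]])
  have W'_apply: "W' j x v = H x (\<psi>' (p j) x v)" if "\<psi> (p j) x = 0" for j x v
    by (simp add: W'_def plus_blinfun.rep_eq bounded_bilinear.prod_right.rep_eq[OF bounded_bilinear_blinfun_apply]
        bounded_bilinear.prod_left.rep_eq[OF bounded_bilinear_blinfun_apply] that blinfun.zero_right)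
  define \<Phi> where "\<Phi> x = (\<Sum>j<n. \<phi> j x *\<^sub>R W j x)" for x
  define \<Phi>' where "\<Phi>' x = (\<Sum>j<n. \<phi> j x *\<^sub>R W' j x + (blinfun_scaleR_left (W j x) o\<^sub>L \<phi>' j x))" for x
  have C\<Phi>: "C1_with (tube K \<rho>) \<Phi> \<Phi>'" unfolding \<Phi>_def \<Phi>'_def
    using C\<phi> CW by (intro C1_with_sum C1_with_scaleR) auto
  have H\<Phi>: "bounded_projection (H x) \<and> H x (\<Phi> x) = \<Phi> x" if x: "x \<in> tube K \<rho>" for x
  proof -
    have "bounded_projection (H x)" using H(3) x tube_mono[OF \<rho>(2)] by blast
    then show ?thesis using bounded_projection_apply[of "H x"]
      by (simp add: \<Phi>_def W_def blinfun.sum_right blinfun.bilinear_simps)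
  qed
  have atK: "\<Phi> y = 0 \<and> (\<forall>v. \<Phi>' y (Pic y v) = 0) \<and> norm (\<Phi>' y - Pih y) \<le> e" if y: "y \<in> K" for y
  proof -
    have \<psi>y: "\<psi> (p j) y = 0" "\<And>v. \<psi>' (p j) y (Pic y v) = 0" "norm (\<psi>' (p j) y - Pih y) \<le> e1"
      if "j < n" "\<phi> j y \<noteq> 0" for j
    proof -
      have "p j \<in> K" "Pic (p j) \<noteq> id_blinfun" "y \<in> K \<inter> ball (p j) (R (p j))" using \<phi> that y by auto
      then show "\<psi> (p j) y = 0" "\<And>v. \<psi>' (p j) y (Pic y v) = 0" "norm (\<psi>' (p j) y - Pih y) \<le> e1"
        using loc by blast+
    qed
    \<comment> \<open>If the weight is 0 at \<open>y\<close>, the local map may say nothing about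
      \<open>y\<close>; the derivative of the weight vanishes as well, so the term drops
      out.\<close>
    have \<phi>'0: "\<phi>' j y = 0" if "j < n" "\<phi> j y = 0" for j
      by (rule C1_with_zero_at_min[OF C\<phi>[OF that(1)] open_tube]) (use that \<phi> y KU in auto)
    have "\<phi> j y *\<^sub>R W j y = 0" if "j < n" for j
      using \<psi>y(1)[OF that] by (cases "\<phi> j y = 0") (auto simp: W_def blinfun.zero_right)
    then have \<Phi>0: "\<Phi> y = 0" unfolding \<Phi>_def by (intro sum.neutral) auto
    \<comment> \<open>On K the local maps vanish, which removes both the terms with derivatives of
      the weights and those with the derivative of \<open>H\<close>.\<close>
    have \<Phi>'y: "\<Phi>' y v = (\<Sum>j<n. \<phi> j y *\<^sub>R H y (\<psi>' (p j) y v))" for v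
    proof -
      have "(\<phi> j y *\<^sub>R W' j y + (blinfun_scaleR_left (W j y) o\<^sub>L \<phi>' j y)) v = \<phi> j y *\<^sub>R H y (\<psi>' (p j) y v)"
        if "j < n" for j
        using \<psi>y(1)[OF that] \<phi>'0[OF that] W'_apply[of j y]
        by (cases "\<phi> j y = 0") (auto simp: W_def blinfun.bilinear_simps)
      then show ?thesis by (simp add: \<Phi>'_def blinfun.sum_left)
    qed
    have ker: "\<Phi>' y (Pic y v) = 0" for v
    proof -
      have "\<phi> j y *\<^sub>R H y (\<psi>' (p j) y (Pic y v)) = 0" if "j < n" for j
        using \<psi>y(2)[OF that] by (cases "\<phi> j y = 0") (auto simp: blinfun.zero_right)
      then show ?thesis unfolding \<Phi>'y by (intro sum.neutral) auto
    qed
    have Hy: "norm (H y - Pih y) \<le> e1" using H(1,4) y by simp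
    have Hn: "norm (H y) \<le> M + 1"
      using norm_triangle_sub[of "H y" "Pih y"] Hy M(2)[OF y] e1e e(2) by simp
    have "norm (\<Phi>' y - Pih y) \<le> e"
    proof (cases "Pic y = id_blinfun")
      case True
      then have "\<phi> j y = 0" if "j < n" for j using one y \<rho>2 that by (metis dist_self)
      then have "\<Phi>' y = 0" by (intro blinfun_eqI) (simp add: \<Phi>'y)
      then show ?thesis using True e by (simp add: Pih_def)
    next
      case False
      then have s1: "(\<Sum>j<n. \<phi> j y) = 1" using one y \<rho>2 by (metis dist_self)
      have "\<Phi>' y = (\<Sum>j<n. \<phi> j y *\<^sub>R (H y o\<^sub>L \<psi>' (p j) y))"
        by (rule blinfun_eqI) (simp add: \<Phi>'y blinfun.bilinear_simps blinfun.sum_left)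
      moreover have "norm ((\<Sum>j<n. \<phi> j y *\<^sub>R (H y o\<^sub>L \<psi>' (p j) y)) - Pih y) \<le> e"
      proof (rule norm_convex_combination_le[OF _ s1])
        fix j assume j: "j < n"
        then show "0 \<le> \<phi> j y" using \<phi> by blast
        assume ne: "\<phi> j y \<noteq> 0"
        have "(H y o\<^sub>L \<psi>' (p j) y) - Pih y = (H y o\<^sub>L (\<psi>' (p j) y - Pih y)) + ((H y - Pih y) o\<^sub>L Pih y)"
          by (rule blinfun_eqI) (simp add: blinfun.bilinear_simps Pih_Pic[OF y])
        also have "norm \<dots> \<le> norm (H y) * norm (\<psi>' (p j) y - Pih y) + norm (H y - Pih y) * norm (Pih y)"
          by (intro order_trans[OF norm_triangle_ineq] add_mono norm_blinfun_compose)
        also have "\<dots> \<le> (M + 1) * e1 + e1 * M"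
          using Hn \<psi>y(3)[OF j ne] Hy M(1) M(2)[OF y] e1 by (intro add_mono mult_mono) auto
        also have "\<dots> = e" using e1(2) by (simp add: algebra_simps)
        finally show "norm ((H y o\<^sub>L \<psi>' (p j) y) - Pih y) \<le> e" .
      qed
      ultimately show ?thesis by simp
    qed
    then show ?thesis using \<Phi>0 ker by blast
  qed
  have Hn: "norm (H x - Pih y) \<le> e" if "y \<in> K" "dist y x < \<rho>" for x y
    using H(4) that \<rho>(2) e1e by (meson order_less_le_trans order_trans)
  show ?thesis
    by (intro exI[of _ \<rho>] conjI exI[of _ \<Phi>] exI[of _ \<Phi>'] exI[of _ H] exI[of _ H'] \<rho>(1) C\<Phi> CH ballI allI impI)
      (use H\<Phi> Hn atK in auto)
qed

end

section \<open>Zero sets of a map whose derivative has a continuous generalised inverse\<close>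

context
  fixes U :: "'a::banach set" and \<Phi> :: "'a \<Rightarrow> 'a" and \<Theta> T :: "'a \<Rightarrow> 'a \<Rightarrow>\<^sub>L 'a"
  assumes U: "open U" and \<Phi>: "C1_with U \<Phi> \<Theta>" and T: "continuous_on U T"
    and \<Theta>T\<Theta>: "\<And>m v. m \<in> U \<Longrightarrow> \<Phi> m = 0 \<Longrightarrow> \<Theta> m (T m (\<Theta> m v)) = \<Theta> m v"
    and T\<Theta>T: "\<And>m v. m \<in> U \<Longrightarrow> \<Phi> m = 0 \<Longrightarrow> T m (\<Theta> m (T m v)) = T m v"
    and inj: "\<And>m. m \<in> U \<Longrightarrow> \<Phi> m = 0 \<Longrightarrow> \<exists>r>0. \<forall>x\<in>U \<inter> ball m r. T m (\<Phi> x) = 0 \<longrightarrow> \<Phi> x = 0"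
begin

text \<open>\<open>T m \<Theta> m\<close> is a projection with the kernel of
  \<open>\<Theta> m\<close>, and \<open>N\<close> is its complement. The chart
  \<open>N (x - m) + T m (\<Phi> x)\<close> has derivative \<open>N + T m \<Theta> m = id\<close> at
  \<open>m\<close>, and its value lies in range N exactly when \<open>T m (\<Phi> x) = 0\<close>,
  that is, by the hypothesis \<open>inj\<close>, when \<open>\<Phi> x = 0\<close>. Thus
  \<open>\<Theta> m\<close> need not be onto anything fixed.\<close>

lemma zero_set_chart:
  assumes m: "m \<in> U" "\<Phi> m = 0"
  defines "N \<equiv> id_blinfun - (T m o\<^sub>L \<Theta> m)"
  shows "bounded_projection N" "whitney_tangent_eq {x\<in>U. \<Phi> x = 0} m N"
    "\<exists>V \<phi>. m \<in> V \<and> slice_chart {x\<in>U. \<Phi> x = 0} N V \<phi>"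
proof -
  have N: "N v = v - T m (\<Theta> m v)" for v by (simp add: N_def blinfun.bilinear_simps)
  show bp: "bounded_projection N" unfolding bounded_projection_def
    by (rule blinfun_eqI) (simp add: N blinfun.bilinear_simps \<Theta>T\<Theta>[OF m])
  obtain r where r: "r > 0" "\<And>x. x \<in> U \<Longrightarrow> dist m x < r \<Longrightarrow> T m (\<Phi> x) = 0 \<Longrightarrow> \<Phi> x = 0"
    using inj[OF m] by (auto simp: Ball_def)
  define \<theta> where "\<theta> x = (N x - N m) + T m (\<Phi> x)" for x
  define \<theta>' where "\<theta>' x = N - 0 + (T m o\<^sub>L \<Theta> x)" for x
  have C\<theta>: "C1_with (U \<inter> ball m r) \<theta> \<theta>'" unfolding \<theta>_def \<theta>'_def
    by (intro C1_with_add C1_with_diff C1_with_linear C1_with_const C1_with_blinfun_compose C1_with_subset[OF \<Phi>]) auto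
  have "\<theta>' m = id_blinfun" by (rule blinfun_eqI) (simp add: \<theta>'_def N blinfun.bilinear_simps)
  moreover have "open (U \<inter> ball m r)" "m \<in> U \<inter> ball m r" using U m r by auto
  ultimately obtain V g' where V: "open V" "m \<in> V" "V \<subseteq> U \<inter> ball m r" "inj_on \<theta> V" "open (\<theta> ` V)"
    "C1_with (\<theta> ` V) (inv_into V \<theta>) g'"
    using inverse_function_near_id[OF C\<theta>] by blast
  have in_range: "\<theta> x \<in> range (blinfun_apply N) \<longleftrightarrow> \<Phi> x = 0" if x: "x \<in> V" for x
  proof -
    have "\<theta> x \<in> range (blinfun_apply N) \<longleftrightarrow> N (\<theta> x) = \<theta> x" by (rule range_projection[OF bp])
    also have "\<dots> \<longleftrightarrow> T m (\<Theta> m (\<theta> x)) = 0" by (simp add: N)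
    also have "T m (\<Theta> m (\<theta> x)) = T m (\<Phi> x)"
      by (simp add: \<theta>_def N blinfun.bilinear_simps T\<Theta>T[OF m] \<Theta>T\<Theta>[OF m])
    also have "\<dots> = 0 \<longleftrightarrow> \<Phi> x = 0"
    proof -
      have "x \<in> U" "dist m x < r" using V(3) x by auto
      from r(2)[OF this] show ?thesis by (auto simp: blinfun.zero_right)
    qed
    finally show ?thesis .
  qed
  have "\<theta> ` (V \<inter> {x\<in>U. \<Phi> x = 0}) = \<theta> ` V \<inter> range (blinfun_apply N)"
    using in_range V(3) by blast
  then have "slice_chart {x\<in>U. \<Phi> x = 0} N V \<theta>"
    unfolding slice_chart_def using bp V C1_with_imp_C1_on[OF C\<theta> V(3)] C1_with_imp_C1_on[OF V(6) order_refl] by blast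
  then show "\<exists>V \<phi>. m \<in> V \<and> slice_chart {x\<in>U. \<Phi> x = 0} N V \<phi>" using V(2) by blast
  \<comment> \<open>The deviation of a chord from range N is
    \<open>T m (\<Theta> m (x - y))\<close>, and \<open>\<Theta> m (x - y)\<close> is small because
    \<open>\<Phi>\<close> vanishes at both ends.\<close>
  have "whitney_tangent_subset {x\<in>U. \<Phi> x = 0} m N" unfolding whitney_tangent_subset_iff
  proof (intro allI impI)
    fix e :: real assume e: "e > 0"
    define e1 where "e1 = e / (norm (T m) + 1)"
    have tp: "norm (T m) + 1 > 0" by (simp add: add_nonneg_pos)
    have e1: "e1 > 0" "norm (T m) * e1 \<le> e"
    proof -
      show "e1 > 0" using e tp by (simp add: e1_def)
      then have "norm (T m) * e1 \<le> (norm (T m) + 1) * e1" by simp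
      also have "\<dots> = e" using tp by (simp add: e1_def)
      finally show "norm (T m) * e1 \<le> e" .
    qed
    obtain r1 where r1: "r1 > 0" "\<forall>x\<in>U. dist x m < r1 \<longrightarrow> norm (\<Theta> x - \<Theta> m) \<le> e1"
      using continuous_on_at_point[OF C1_withD(2)[OF \<Phi>] m(1) e1(1)] by blast
    obtain r2 where r2: "r2 > 0" "ball m r2 \<subseteq> U" using U m(1) open_contains_ball by blast
    have "norm (x - y - N (x - y)) \<le> e * norm (x - y)"
      if x: "x \<in> U" "\<Phi> x = 0" "x \<in> ball m (min r1 r2)" and y: "y \<in> U" "\<Phi> y = 0" "y \<in> ball m (min r1 r2)" for x y
    proof -
      have sub: "ball m (min r1 r2) \<subseteq> U" using r2(2) by auto
      have "norm (\<Theta> z - \<Theta> m) \<le> e1" if "z \<in> ball m (min r1 r2)" for z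
        using r1(2) that sub by (auto simp: dist_commute)
      then have "norm (\<Phi> x - \<Phi> y - \<Theta> m (x - y)) \<le> e1 * norm (x - y)"
        by (rule C1_with_bound_linear[OF \<Phi> convex_ball sub]) (use x y in auto)
      then have "norm (\<Theta> m (x - y)) \<le> e1 * norm (x - y)" using x y by simp
      then have "norm (T m) * norm (\<Theta> m (x - y)) \<le> norm (T m) * (e1 * norm (x - y))" by (intro mult_left_mono) auto
      also have "\<dots> \<le> e * norm (x - y)" using mult_right_mono[OF e1(2) norm_ge_zero[of "x - y"]] by (simp add: mult.assoc)
      finally have "norm (T m (\<Theta> m (x - y))) \<le> e * norm (x - y)" using norm_blinfun order_trans by blast
      then show ?thesis by (simp add: N)
    qed
    then show "\<exists>r>0. \<forall>x\<in>{x \<in> U. \<Phi> x = 0} \<inter> ball m r. \<forall>y\<in>{x \<in> U. \<Phi> x = 0} \<inter> ball m r.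
       norm (x - y - N (x - y)) \<le> e * norm (x - y)"
      using r1(1) r2(1) by (intro exI[of _ "min r1 r2"]) auto
  qed
  \<comment> \<open>The chart image is a neighbourhood of 0; a small \<open>x\<close> in range N is
    \<open>\<theta> z\<close> with \<open>\<Phi> z = 0\<close>, and then
    \<open>x = N (z - m)\<close>.\<close>
  moreover have "\<exists>\<delta>>0. \<exists>\<epsilon>>0. {x \<in> range (blinfun_apply N). norm x < \<delta>}
                    \<subseteq> (\<lambda>x. N (x - m)) ` ({x\<in>U. \<Phi> x = 0} \<inter> ball m \<epsilon>)"
  proof -
    have "0 \<in> \<theta> ` V" using V(2) m by (auto simp: \<theta>_def blinfun.zero_right image_iff intro!: bexI[of _ m])
    then obtain \<delta> where \<delta>: "\<delta> > 0" "ball 0 \<delta> \<subseteq> \<theta> ` V" using V(5) open_contains_ball by blast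
    have "x \<in> (\<lambda>x. N (x - m)) ` ({x\<in>U. \<Phi> x = 0} \<inter> ball m r)"
      if x: "x \<in> range (blinfun_apply N)" "norm x < \<delta>" for x
    proof -
      obtain z where z: "z \<in> V" "x = \<theta> z" using \<delta>(2) x(2) by force
      then have "\<Phi> z = 0" using in_range x(1) by blast
      then have "x = N (z - m)" using z(2) by (simp add: \<theta>_def blinfun.bilinear_simps)
      then show ?thesis using z(1) V(3) \<open>\<Phi> z = 0\<close> by blast
    qed
    then show ?thesis using \<delta>(1) r(1) by blast
  qed
  ultimately show "whitney_tangent_eq {x\<in>U. \<Phi> x = 0} m N" unfolding whitney_tangent_eq_def by blast
qed

lemma zero_set_submanifold: "C1_submanifold {x\<in>U. \<Phi> x = 0}"
  unfolding C1_submanifold_def using zero_set_chart(3) by blast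

lemma zero_set_tangent_continuous: "continuous_on {x\<in>U. \<Phi> x = 0} (\<lambda>m. id_blinfun - (T m o\<^sub>L \<Theta> m))"
  by (rule continuous_on_subset[of U]) (use T C1_withD(2)[OF \<Phi>] in \<open>auto intro!: continuous_intros\<close>)

end

subsection \<open>Uniform smooth approximation\<close>

definition smoothly_approximable ::
    "'a::real_normed_vector set \<Rightarrow> ('a \<Rightarrow> 'b::real_normed_vector) \<Rightarrow> real \<Rightarrow> bool" where
  "smoothly_approximable S f \<epsilon> \<longleftrightarrow>
     (\<exists>W g g'. open W \<and> S \<subseteq> W \<and> C1_with W g g' \<and> (\<forall>x\<in>S. norm (g x - f x) \<le> \<epsilon>))"

text \<open>
  Every point \<open>x\<close> picks the least value \<open>\<alpha> x\<close>, in a well-ordering of the target type, that is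
  \<open>\<epsilon>\<close>-close to \<open>f x\<close>. On \<open>V n\<close>, where the pick is robust at scale \<open>h n\<close>, two points closer than
  \<open>3 * h n\<close> exclude each other's smaller picks, so \<open>\<alpha>\<close> is locally constant there.
\<close>

lemma uniform_C1_approx:
  fixes P :: "'a::banach \<Rightarrow>\<^sub>L 'a" and f :: "'a \<Rightarrow> 'b::real_normed_vector"
  assumes P: "bounded_projection P"
    and star: "property_star (range (blinfun_apply P)) (range (blinfun_apply (id_blinfun - P)))"
    and nontriv: "P \<noteq> id_blinfun"
    and slope: "\<And>x y. x \<in> S \<Longrightarrow> y \<in> S \<Longrightarrow> norm (x - y) \<le> 2 * norm (P x - P y)"
    and f: "continuous_on S f" and \<epsilon>: "\<epsilon> > 0"
  shows "smoothly_approximable S f \<epsilon>"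
proof -
  \<comment> \<open>\<open>S\<close> may be nonseparable, so a countable cover by sets on which
    \<open>f\<close> varies little may not exist. The well-ordering, as in Rudin's proof that metric
    spaces are paracompact, gives countably many families instead.\<close>
  obtain r :: "'b rel" where r: "well_order_on UNIV r"
    using well_order_on[of "UNIV :: 'b set"] by (elim exE) (rule that)
  define lt where "lt a b \<longleftrightarrow> (a, b) \<in> r - Id" for a b
  have wf: "wf (r - Id)" and tot: "a \<noteq> b \<Longrightarrow> lt a b \<or> lt b a" for a b
    using r unfolding lt_def well_order_on_def linear_order_on_def total_on_def by auto
  have "\<exists>v. norm (f x - v) < \<epsilon> \<and> (\<forall>w. lt w v \<longrightarrow> \<not> norm (f x - w) < \<epsilon>)" for x
    using wfE_min[OF wf, of "f x" "{v. norm (f x - v) < \<epsilon>}"] \<epsilon> unfolding lt_def by auto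
  then obtain \<alpha> where \<alpha>: "\<And>x. norm (f x - \<alpha> x) < \<epsilon>" "\<And>x w. lt w (\<alpha> x) \<Longrightarrow> \<not> norm (f x - w) < \<epsilon>" by metis
  define h where "h n = (1/2 :: real) ^ n" for n :: nat
  have h: "h n > 0" for n by (simp add: h_def)
  define V where "V n = {x\<in>S. \<forall>y\<in>S. norm (P x - P y) < 3 * h n \<longrightarrow> norm (f y - \<alpha> x) < \<epsilon>}" for n
  have V\<alpha>: "\<alpha> x = \<alpha> y" if "x \<in> V n" "y \<in> V n" "norm (P x - P y) < 3 * h n" for x y n
  proof -
    have "norm (f y - \<alpha> x) < \<epsilon>" "norm (f x - \<alpha> y) < \<epsilon>"
      using that by (auto simp: V_def norm_minus_commute)
    then show ?thesis using tot[of "\<alpha> x" "\<alpha> y"] \<alpha>(2) by blast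
  qed
  have Vcover: "\<exists>n. x \<in> V n" if x: "x \<in> S" for x
  proof -
    have "\<epsilon> - norm (f x - \<alpha> x) > 0" using \<alpha>(1) by simp
    then obtain d where d: "d > 0" "\<forall>y\<in>S. dist y x < d \<longrightarrow> dist (f y) (f x) < \<epsilon> - norm (f x - \<alpha> x)"
      using f x unfolding continuous_on_iff by meson
    \<comment> \<open>Points with \<open>P\<close>-distance below \<open>3 * h n\<close> have
      distance below \<open>6 * h n\<close> by the slope bound.\<close>
    have "d / 6 > 0" using d(1) by simp
    from real_arch_pow_inv[OF this, of "1/2"] obtain n where "h n < d / 6" by (auto simp: h_def)
    then have n: "6 * h n < d" by simp
    have "norm (f y - \<alpha> x) < \<epsilon>" if y: "y \<in> S" "norm (P x - P y) < 3 * h n" for y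
    proof -
      have "dist y x < d" using slope[OF x y(1)] y(2) n by (simp add: dist_norm norm_minus_commute)
      then have "norm (f y - f x) < \<epsilon> - norm (f x - \<alpha> x)" using d(2) y(1) by (simp add: dist_norm)
      then show ?thesis using norm_triangle_ineq[of "f y - f x" "f x - \<alpha> x"] by simp
    qed
    then show ?thesis using x by (auto simp: V_def)
  qed
  obtain C where cut: "\<forall>A r. r > 0 \<longrightarrow>
     (\<exists>b b'. C1_with UNIV b b' \<and> (\<forall>x. norm (b' x) \<le> C / r) \<and> cutoff P A r b)"
    using star_cutoff[OF P star nontriv] by (elim exE conjE) (rule that)
  have "\<forall>n. \<exists>b. (\<exists>b'. C1_with UNIV b b') \<and> (\<forall>x. 0 \<le> b x \<and> b x \<le> (1::real)) \<and>
     (\<forall>z. \<forall>x\<in>V n. norm (P z - P x) \<le> h n / 4 \<longrightarrow> b z = 1) \<and>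
     (\<forall>z. b z \<noteq> 0 \<longrightarrow> (\<exists>x\<in>V n. norm (P z - P x) < 3 * h n / 4))"
  proof
    fix n
    show "\<exists>b. (\<exists>b'. C1_with UNIV b b') \<and> (\<forall>x. 0 \<le> b x \<and> b x \<le> (1::real)) \<and>
     (\<forall>z. \<forall>x\<in>V n. norm (P z - P x) \<le> h n / 4 \<longrightarrow> b z = 1) \<and>
     (\<forall>z. b z \<noteq> 0 \<longrightarrow> (\<exists>x\<in>V n. norm (P z - P x) < 3 * h n / 4))"
    \<comment> \<open>\<open>infdist\<close> to the empty set is 0, so a cutoff for it would be
      constantly 1; here the function 0 is required.\<close>
    proof (cases "V n = {}")
      case True
      then show ?thesis using C1_with_const[of UNIV "0::real"] by (intro exI[of _ "\<lambda>x. 0"]) auto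
    next
      case False
      from cut[rule_format, OF h[of n], of "P ` V n"] obtain b b' where b: "C1_with UNIV b b'"
       "\<forall>x. 0 \<le> b x \<and> b x \<le> (1::real)" "\<forall>x. infdist (P x) (P ` V n) \<le> h n / 4 \<longrightarrow> b x = 1"
       "\<forall>x. 3 * h n / 4 \<le> infdist (P x) (P ` V n) \<longrightarrow> b x = 0"
        unfolding cutoff_def by (elim exE conjE) (rule that)
      have "b z = 1" if "x \<in> V n" "norm (P z - P x) \<le> h n / 4" for z x
      proof -
        have "infdist (P z) (P ` V n) \<le> dist (P z) (P x)" using that by (intro infdist_le) auto
        then show ?thesis using b(3) that(2) by (auto simp: dist_norm)
      qed
      moreover have "\<exists>x\<in>V n. norm (P z - P x) < 3 * h n / 4" if "b z \<noteq> 0" for z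
      proof -
        have "infdist (P z) (P ` V n) < 3 * h n / 4" using b(4) that not_le by blast
        then have "Inf (dist (P z) ` P ` V n) < 3 * h n / 4" using False by (simp add: infdist_notempty)
        then obtain d where "d \<in> dist (P z) ` P ` V n" "d < 3 * h n / 4"
          using cInf_lessD[of "dist (P z) ` P ` V n"] False by blast
        then show ?thesis by (auto simp: dist_norm)
      qed
      ultimately show ?thesis using b(1,2) by blast
    qed
  qed
  then obtain a where a0: "\<forall>n. (\<exists>b'. C1_with UNIV (a n) b') \<and> (\<forall>x. 0 \<le> a n x \<and> a n x \<le> (1::real)) \<and>
     (\<forall>z. \<forall>x\<in>V n. norm (P z - P x) \<le> h n / 4 \<longrightarrow> a n z = 1) \<and>
     (\<forall>z. a n z \<noteq> 0 \<longrightarrow> (\<exists>x\<in>V n. norm (P z - P x) < 3 * h n / 4))"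
    unfolding choice_iff by (elim exE) (rule that)
  then have a: "\<exists>b'. C1_with UNIV (a n) b'" "0 \<le> a n x" "a n x \<le> 1"
    "y \<in> V n \<Longrightarrow> norm (P z - P y) \<le> h n / 4 \<Longrightarrow> a n z = 1"
    "a n z \<noteq> 0 \<Longrightarrow> \<exists>x\<in>V n. norm (P z - P x) < 3 * h n / 4" for n x y z by blast+
  define W where "W n = {z. \<exists>x\<in>V n. norm (P z - P x) < h n}" for n
  \<comment> \<open>The choice is immaterial: two candidates for one \<open>z\<close> are less than
    \<open>2 * h n\<close> apart after \<open>P\<close>, within the \<open>3 * h n\<close> of
    \<open>V\<alpha>\<close>. Hence \<open>F n\<close> is locally constant on
    \<open>W n\<close>.\<close>
  define F where "F n z = \<alpha> (SOME x. x \<in> V n \<and> norm (P z - P x) < h n)" for n z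
  have F: "F n z = \<alpha> x" if "x \<in> V n" "norm (P z - P x) < h n" for n z x
  proof -
    define y where "y = (SOME x. x \<in> V n \<and> norm (P z - P x) < h n)"
    have y: "y \<in> V n \<and> norm (P z - P y) < h n" unfolding y_def by (rule someI[of _ x]) (use that in auto)
    then have "norm (P y - P x) < 3 * h n"
      using that(2) norm_triangle_ineq4[of "P z - P x" "P z - P y"] h[of n] by (simp add: norm_minus_commute)
    then show ?thesis using V\<alpha> y that(1) unfolding F_def y_def[symmetric] by blast
  qed
  define \<xi> where "\<xi> = seq_part a"
  have \<xi>C: "\<exists>d. C1_with UNIV (\<xi> n) d" for n unfolding \<xi>_def by (rule seq_part_C1) (rule a(1))
  have \<xi>0: "\<xi> n x \<ge> 0" for n x unfolding \<xi>_def by (rule seq_part_nonneg) (use a in auto)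
  have near_open: "open {z'. norm (P z' - v) < e}" for v e
    by (intro open_Collect_less continuous_intros)
  have term_C: "\<exists>d. C1_with UNIV (\<lambda>z. \<xi> n z *\<^sub>R F n z) d" for n
  proof (rule C1_with_local)
    fix z
    show "\<exists>B d. open B \<and> z \<in> B \<and> C1_with B (\<lambda>z. \<xi> n z *\<^sub>R F n z) d"
    proof (cases "z \<in> W n")
      case True
      then obtain x where x: "x \<in> V n" "norm (P z - P x) < h n" by (auto simp: W_def)
      define B where "B = {z'. norm (P z' - P x) < h n}"
      have B: "open B" "z \<in> B" using near_open x by (auto simp: B_def)
      obtain d where "C1_with B (\<xi> n) d" using \<xi>C C1_with_subset[OF _ subset_UNIV] by blast
      from C1_with_cong[OF C1_with_scaleR[OF this C1_with_const[of B "\<alpha> x"]] B(1), of "\<lambda>z. \<xi> n z *\<^sub>R F n z"]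
      show ?thesis using B F[OF x(1)] by (auto simp: B_def)
    next
      case False
      define B where "B = {z'. norm (P z' - P z) < h n / 4}"
      have B: "open B" "z \<in> B" unfolding B_def by (rule near_open) (simp add: h)
      have "\<xi> n z' = 0" if z': "z' \<in> B" for z'
      proof (rule ccontr)
        assume "\<xi> n z' \<noteq> 0"
        then have "a n z' \<noteq> 0" by (auto simp: \<xi>_def seq_part_def)
        then obtain x where x: "x \<in> V n" "norm (P z' - P x) < 3 * h n / 4" using a(5) by blast
        then have "norm (P z - P x) < h n"
          using z' norm_triangle_ineq4[of "P z' - P x" "P z' - P z"] by (simp add: B_def)
        then show False using False x(1) by (auto simp: W_def)
      qed
      then have "C1_with B (\<lambda>z. \<xi> n z *\<^sub>R F n z) (\<lambda>z. 0)"
        by (intro C1_with_cong[OF C1_with_const[of B 0] B(1)]) auto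
      then show ?thesis using B by blast
    qed
  qed
  then obtain D where D: "\<And>n. C1_with UNIV (\<lambda>z. \<xi> n z *\<^sub>R F n z) (D n)" by metis
  define O' where "O' n = (\<Union>x\<in>V n. {z. norm (P z - P x) < h n / 4})" for n
  have O'_open: "open (O' n)" for n unfolding O'_def by (intro open_UN near_open ballI)
  have aO: "a n z = 1" if "z \<in> O' n" for n z using that a(4) by (force simp: O'_def)
  \<comment> \<open>On \<open>O' n\<close> the factor \<open>a n\<close> is 1, so all later weights
    vanish; truncating at the first such index defines the infinite sum, and on \<open>O' N\<close>
    truncation at \<open>N\<close> gives the same values.\<close>
  define m where "m z = (LEAST n. z \<in> O' n)" for z
  define g where "g z = (\<Sum>n<Suc (m z). \<xi> n z *\<^sub>R F n z)" for z
  have gO: "g z = (\<Sum>n<Suc N. \<xi> n z *\<^sub>R F n z)" if z: "z \<in> O' N" for z N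
  proof -
    have m: "z \<in> O' (m z)" "m z \<le> N" unfolding m_def using z by (auto intro: LeastI Least_le)
    have "\<xi> n z *\<^sub>R F n z = 0" if "n \<in> {..<Suc N} - {..<Suc (m z)}" for n
      using seq_part_eq_0[of "m z" n a z] aO[OF m(1)] that by (auto simp: \<xi>_def)
    then show ?thesis unfolding g_def using m(2) by (intro sum.mono_neutral_left) auto
  qed
  define W0 where "W0 = (\<Union>n. O' n)"
  have "open W0" unfolding W0_def using O'_open by blast
  moreover have "S \<subseteq> W0"
  proof
    fix x assume "x \<in> S"
    then obtain n where "x \<in> V n" using Vcover by blast
    then have "x \<in> O' n" using h[of n] by (auto simp: O'_def intro!: bexI[of _ x])
    then show "x \<in> W0" by (auto simp: W0_def)
  qed
  moreover have "\<exists>d. C1_with W0 g d"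
  proof (rule C1_with_local)
    fix z assume "z \<in> W0"
    then obtain N where N: "z \<in> O' N" by (auto simp: W0_def)
    have "C1_with (O' N) (\<lambda>z. \<Sum>n<Suc N. \<xi> n z *\<^sub>R F n z) (\<lambda>z. \<Sum>n<Suc N. D n z)"
      by (rule C1_with_sum) (rule C1_with_subset[OF D subset_UNIV])
    then have "C1_with (O' N) g (\<lambda>z. \<Sum>n<Suc N. D n z)"
      by (rule C1_with_cong) (use O'_open gO in auto)
    then show "\<exists>V d. open V \<and> z \<in> V \<and> C1_with V g d" using N O'_open by blast
  qed
  moreover have "norm (g z - f z) \<le> \<epsilon>" if z: "z \<in> S" for z
  proof -
    obtain N where N: "z \<in> O' N" using z \<open>S \<subseteq> W0\<close> by (auto simp: W0_def)
    have s1: "(\<Sum>n<Suc N. \<xi> n z) = 1"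
      unfolding \<xi>_def by (rule seq_part_sum_eq_1[of N]) (use aO[OF N] in auto)
    show ?thesis unfolding gO[OF N]
    proof (rule norm_convex_combination_le[OF \<xi>0 s1])
      fix n assume "\<xi> n z \<noteq> 0"
      then have "a n z \<noteq> 0" by (auto simp: \<xi>_def seq_part_def)
      then obtain x where x: "x \<in> V n" "norm (P z - P x) < 3 * h n / 4" using a(5) by blast
      have "F n z = \<alpha> x" using F[OF x(1)] x(2) h[of n] by simp
      moreover have "norm (f z - \<alpha> x) < \<epsilon>"
        using x z h[of n] by (auto simp: V_def norm_minus_commute)
      ultimately show "norm (F n z - f z) \<le> \<epsilon>" by (simp add: norm_minus_commute)
    qed
  qed
  ultimately show ?thesis unfolding smoothly_approximable_def by blast
qed

text \<open>The derivative is bounded on a tube around K, and balls of the tube radius are convex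
  subsets of it, so one constant serves all of K.\<close>

lemma C1_with_locally_lipschitz_near_compact:
  assumes f: "C1_with W f f'" and W: "open W" "K \<subseteq> W" "compact K"
  shows "\<exists>r>0. \<exists>C>0. \<forall>m\<in>K. \<forall>x\<in>ball m r. \<forall>y\<in>ball m r. norm (f x - f y) \<le> C * norm (x - y)"
proof -
  obtain r M where r: "r > 0" "M > 0" "tube K r \<subseteq> W" "\<forall>x\<in>tube K r. norm (f' x) \<le> M"
    using compact_tube_bound[OF W(3,1,2) C1_withD(2)[OF f]] by blast
  have "norm (f x - f y) \<le> M * norm (x - y)" if "m \<in> K" "x \<in> ball m r" "y \<in> ball m r" for m x y
  proof -
    have "ball m r \<subseteq> tube K r" using that(1) by (auto simp: tube_def)
    then show ?thesis using C1_with_bound[OF f convex_ball _ _ that(2,3), of M] r(3,4) by blast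
  qed
  then show ?thesis using r(1,2) by blast
qed

lemma C1_map_on_submanifold_restrict:
  assumes f: "C1_with W f f'" and W: "open W" "S \<subseteq> W" and S: "C1_submanifold S"
  shows "C1_map_on_submanifold S f"
  unfolding C1_map_on_submanifold_def
proof
  fix m assume "m \<in> S"
  then obtain P U \<phi> where c: "m \<in> U" "slice_chart S P U \<phi>" using S unfolding C1_submanifold_def by blast
  have op: "open (\<phi> ` U)" and inj: "inj_on \<phi> U" and C: "C1_on (\<phi> ` U) (inv_into U \<phi>)"
    using c(2) by (auto simp: slice_chart_def)
  obtain g' where g': "C1_with (\<phi> ` U) (inv_into U \<phi>) g'" using C op by (auto simp: C1_on_open)
  define D where "D = \<phi> ` U \<inter> inv_into U \<phi> -` W"
  have "C1_with D (\<lambda>x. f (inv_into U \<phi> x)) (\<lambda>x. f' (inv_into U \<phi> x) o\<^sub>L g' x)"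
    by (rule C1_with_compose[OF C1_with_subset[OF g'] f]) (auto simp: D_def)
  moreover have "\<phi> ` (U \<inter> S) \<subseteq> D" using W(2) inj by (auto simp: D_def)
  ultimately have "C1_on (\<phi> ` (U \<inter> S)) (\<lambda>x. f (inv_into U \<phi> x))" by (rule C1_with_imp_C1_on)
  then show "\<exists>P U \<phi>. m \<in> U \<and> slice_chart S P U \<phi> \<and> C1_on (\<phi> ` (U \<inter> S)) (f \<circ> inv_into U \<phi>)"
    using c by (auto simp: o_def)
qed

subsection \<open>The manifold and its projections\<close>

context tangent_field
begin

text \<open>With \<open>Z = E H\<close> and \<open>G\<close> the completion of
  \<open>H \<Theta> E H\<close> by \<open>id - H\<close>, \<open>T = Z G\<inverse>\<close> inverts
  \<open>\<Theta>\<close> at zeros in the sense \<open>\<Theta> T = H\<close> and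
  \<open>T H = T\<close>. Together with \<open>H \<Theta> = \<Theta>\<close> this gives both
  identities. The exactness of \<open>E\<close> on K yields \<open>T \<Theta> = Pih\<close>
  there.\<close>

lemma invariant_manifold:
  "\<exists>\<rho>>0. \<exists>\<Phi> (\<Theta> :: 'a \<Rightarrow> 'a \<Rightarrow>\<^sub>L 'a) (T :: 'a \<Rightarrow> 'a \<Rightarrow>\<^sub>L 'a). C1_with (tube K \<rho>) \<Phi> \<Theta> \<and> continuous_on (tube K \<rho>) T \<and>
    (\<forall>m\<in>tube K \<rho>. \<Phi> m = 0 \<longrightarrow> (\<Theta> m o\<^sub>L T m o\<^sub>L \<Theta> m = \<Theta> m \<and> T m o\<^sub>L \<Theta> m o\<^sub>L T m = T m) \<and>
       (\<exists>r>0. \<forall>x\<in>tube K \<rho> \<inter> ball m r. blinfun_apply (T m) (\<Phi> x) = 0 \<longrightarrow> \<Phi> x = 0)) \<and>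
    (\<forall>y\<in>K. \<Phi> y = 0 \<and> T y o\<^sub>L \<Theta> y = Pih y \<and> norm (\<Theta> y - Pih y) \<le> 1/8) \<and>
    (\<forall>y\<in>K. \<forall>x. dist y x < \<rho> \<longrightarrow> Pic y = id_blinfun \<longrightarrow> T x = 0)"
proof -
  obtain M where M: "M \<ge> 1" "\<And>m. m \<in> K \<Longrightarrow> norm (Pih m) \<le> M" using Pih_bound by blast
  \<comment> \<open>On K the distance of \<open>G\<close> from the identity is at most
    \<open>2 * e * (M + 1) = 1/4\<close>, strictly below 1/2, so it stays below 1/2 on an open
    neighbourhood.\<close>
  define e where "e = 1 / (8 * (M + 1))"
  have e: "e > 0" "e \<le> 1/8" "2 * e * (M + 1) = 1/4" using M by (auto simp: e_def divide_simps)
  then have e1: "e \<le> 1" by simp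
  obtain \<rho>1 \<Phi> \<Theta> H H' where \<rho>1: "\<rho>1 > 0" and \<Phi>: "C1_with (tube K \<rho>1) \<Phi> \<Theta>" and H: "C1_with (tube K \<rho>1) H H'"
    and HP: "\<forall>x\<in>tube K \<rho>1. bounded_projection (H x) \<and> H x (\<Phi> x) = \<Phi> x"
    and Hn: "\<forall>y\<in>K. \<forall>x. dist y x < \<rho>1 \<longrightarrow> norm (H x - Pih y) \<le> e"
    and atK: "\<forall>y\<in>K. \<Phi> y = 0 \<and> (\<forall>v. \<Theta> y (Pic y v) = 0) \<and> norm (\<Theta> y - Pih y) \<le> e"
    using defining_map[OF e(1) e1] by (elim exE conjE) (rule that)
  obtain \<rho>2 E where \<rho>2: "\<rho>2 > 0" and E: "continuous_on (tube K \<rho>2) E" "\<forall>y\<in>K. E y = Pih y"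
    using Pih_continuous_extension by blast
  define U0 where "U0 = tube K (min \<rho>1 \<rho>2)"
  have U0: "U0 \<subseteq> tube K \<rho>1" "U0 \<subseteq> tube K \<rho>2" "open U0" "K \<subseteq> U0"
    unfolding U0_def using tube_mono[of "min \<rho>1 \<rho>2" \<rho>1 K] tube_mono[of "min \<rho>1 \<rho>2" \<rho>2 K]
      subset_tube[of "min \<rho>1 \<rho>2" K] \<rho>1 \<rho>2 by auto
  have HH: "H x (H x v) = H x v" if "x \<in> tube K \<rho>1" for x v
    using HP that bounded_projection_apply by blast
  define Z where "Z x = E x o\<^sub>L H x" for x
  define G where "G x = (H x o\<^sub>L \<Theta> x o\<^sub>L Z x) + (id_blinfun - H x)" for x
  have cont: "continuous_on U0 E" "continuous_on U0 H" "continuous_on U0 \<Theta>"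
    using E(1) C1_with_continuous_on[OF H] C1_withD(2)[OF \<Phi>] U0 by (auto intro: continuous_on_subset)
  have Zc: "continuous_on U0 Z" unfolding Z_def by (intro continuous_intros cont)
  have Gc: "continuous_on U0 G" unfolding G_def by (intro continuous_intros cont Zc)
  define U1 where "U1 = U0 \<inter> (\<lambda>x. norm (G x - id_blinfun)) -` {..<1/2}"
  have "open U1" unfolding U1_def using U0 Gc by (intro continuous_open_preimage continuous_intros) auto
  \<comment> \<open>Differentiate \<open>H x (\<Phi> x) = \<Phi> x\<close>; at a zero the term with
    the derivative of \<open>H\<close> is evaluated at 0.\<close>
  have H\<Theta>: "H x (\<Theta> x v) = \<Theta> x v" if x: "x \<in> tube K \<rho>1" "\<Phi> x = 0" for x v
  proof -
    have "((\<lambda>x. H x (\<Phi> x)) has_derivative (\<lambda>v. H x (\<Theta> x v) + H' x v (\<Phi> x))) (at x)"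
      by (rule bounded_bilinear.FDERIV[OF bounded_bilinear_blinfun_apply C1_withD(1)[OF H x(1)] C1_withD(1)[OF \<Phi> x(1)]])
    then have "(\<Phi> has_derivative (\<lambda>v. H x (\<Theta> x v) + H' x v (\<Phi> x))) (at x)"
      by (rule has_derivative_transform_within_open[OF _ open_tube x(1)]) (use HP in auto)
    then have "blinfun_apply (\<Theta> x) = (\<lambda>v. H x (\<Theta> x v) + H' x v (\<Phi> x))"
      using C1_withD(1)[OF \<Phi> x(1)] has_derivative_unique by blast
    then show ?thesis using x(2) blinfun.zero_right[of "H' x v"] by (simp add: fun_eq_iff)
  qed
  have KU1: "K \<subseteq> U1"
  proof
    fix y assume y: "y \<in> K"
    then have yt: "y \<in> tube K \<rho>1" using U0 by blast
    have \<Theta>Q: "\<Theta> y (Pih y v) = \<Theta> y v" for v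
      using atK y by (simp add: Pih_apply blinfun.bilinear_simps)
    have "G y - id_blinfun = (\<Theta> y - H y) o\<^sub>L H y"
      using E(2) y atK by (intro blinfun_eqI) (simp add: G_def Z_def blinfun.bilinear_simps \<Theta>Q HH[OF yt] H\<Theta>[OF yt])
    then have "norm (G y - id_blinfun) \<le> norm (\<Theta> y - H y) * norm (H y)" using norm_blinfun_compose by metis
    also have "\<dots> \<le> (2 * e) * (M + 1)"
    proof (rule mult_mono)
      have Hy: "norm (H y - Pih y) \<le> e" using Hn y \<rho>1 by simp
      then show "norm (\<Theta> y - H y) \<le> 2 * e"
        using atK y norm_triangle_ineq4[of "\<Theta> y - Pih y" "H y - Pih y"] by fastforce
      show "norm (H y) \<le> M + 1" using norm_triangle_sub[of "H y" "Pih y"] Hy M(2)[OF y] e1 by simp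
    qed (use e in auto)
    finally show "y \<in> U1" using y U0 e by (auto simp: U1_def)
  qed
  obtain \<rho>3 where \<rho>3: "\<rho>3 > 0" "tube K \<rho>3 \<subseteq> U1" using compact_tube_subset[OF compact_K \<open>open U1\<close> KU1] by blast
  define \<rho> where "\<rho> = min \<rho>3 \<rho>1"
  have \<rho>: "\<rho> > 0" "tube K \<rho> \<subseteq> U1" "\<rho> \<le> \<rho>1"
    using \<rho>1 \<rho>3 tube_mono[of \<rho> \<rho>3 K] by (auto simp: \<rho>_def)
  define T where "T x = Z x o\<^sub>L binv (G x)" for x
  have Gn: "norm (G x - id_blinfun) \<le> 1/2" if "x \<in> U1" for x using that by (auto simp: U1_def)
  have "continuous_on U1 (\<lambda>x. binv (G x))"
    by (rule continuous_on_binv) (use Gc Gn in \<open>auto simp: U1_def intro: continuous_on_subset\<close>)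
  then have "continuous_on U1 T" unfolding T_def
    using Zc by (intro continuous_intros) (auto simp: U1_def intro: continuous_on_subset)
  then have Tc: "continuous_on (tube K \<rho>) T" using \<rho>(2) by (rule continuous_on_subset)
  have sub: "tube K \<rho> \<subseteq> tube K \<rho>1" using \<rho>(2) U0 by (auto simp: U1_def)
  have C\<Phi>: "C1_with (tube K \<rho>) \<Phi> \<Theta>" by (rule C1_with_subset[OF \<Phi> sub])
  have main: "\<Theta> m (T m v) = H m v \<and> T m (H m v) = T m v" if m: "m \<in> tube K \<rho>" "\<Phi> m = 0" for m v
  proof -
    have mU: "m \<in> U1" "m \<in> tube K \<rho>1" using m \<rho>(2) sub by auto
    note HH = HH[OF mU(2)] and H\<Theta> = H\<Theta>[OF mU(2) m(2)] and inv = near_id_inverse_apply[OF Gn[OF mU(1)]]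
    \<comment> \<open>At a zero \<open>G\<close> commutes with \<open>H\<close>, hence so does its
      inverse; \<open>\<Theta> T = H\<close> and \<open>T H = T\<close> follow.\<close>
    have GH: "G m (H m w) = \<Theta> m (Z m w)" for w
      by (simp add: G_def Z_def blinfun.bilinear_simps HH H\<Theta>)
    have HG: "H m (G m w) = \<Theta> m (Z m w)" for w
      by (simp add: G_def Z_def blinfun.bilinear_simps HH H\<Theta>)
    have "G m (H m (binv (G m) v)) = H m v" using GH HG inv(1) by metis
    then have Hb: "H m (binv (G m) v) = binv (G m) (H m v)" using inv(2) by metis
    have "\<Theta> m (T m v) = H m v" using HG[of "binv (G m) v"] inv(1) by (simp add: T_def)
    moreover have "T m (H m v) = T m v"
      using HH by (simp add: T_def Z_def Hb[symmetric])
    ultimately show ?thesis by blast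
  qed
  have c1: "\<Theta> m (T m (\<Theta> m v)) = \<Theta> m v \<and> T m (\<Theta> m (T m v)) = T m v" if m: "m \<in> tube K \<rho>" "\<Phi> m = 0" for m v
    using main[OF m] H\<Theta>[of m] m sub by auto
  \<comment> \<open>\<open>T m (\<Phi> x) = 0\<close> gives \<open>H m (\<Phi> x) = 0\<close>,
    whereas \<open>H x\<close> fixes \<open>\<Phi> x\<close>; two projections at distance at most
    1/2 leave only \<open>\<Phi> x = 0\<close>.\<close>
  have c2: "\<exists>r>0. \<forall>x\<in>tube K \<rho> \<inter> ball m r. T m (\<Phi> x) = 0 \<longrightarrow> \<Phi> x = 0" if m: "m \<in> tube K \<rho>" "\<Phi> m = 0" for m
  proof -
    have "continuous_on (tube K \<rho>) H" using C1_with_continuous_on[OF H] sub by (rule continuous_on_subset)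
    then obtain r where r: "r > 0" "\<forall>x\<in>tube K \<rho>. dist x m < r \<longrightarrow> norm (H x - H m) \<le> 1/2"
      using continuous_on_at_point[OF _ m(1), of H "1/2"] by auto
    have "\<Phi> x = 0" if x: "x \<in> tube K \<rho>" "dist m x < r" "T m (\<Phi> x) = 0" for x
    proof -
      have "H m (\<Phi> x) = 0" using main[OF m, of "\<Phi> x"] x(3) by (metis blinfun.zero_right)
      moreover have "H x (\<Phi> x) = \<Phi> x" using HP x(1) sub by blast
      ultimately have "\<Phi> x = (H x - H m) (\<Phi> x)" by (simp add: blinfun.bilinear_simps)
      then have "norm (\<Phi> x) \<le> norm (H x - H m) * norm (\<Phi> x)" using norm_blinfun by metis
      also have "\<dots> \<le> 1/2 * norm (\<Phi> x)" using r(2) x by (intro mult_right_mono) (auto simp: dist_commute)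
      finally show ?thesis by simp
    qed
    then show ?thesis using r(1) by auto
  qed
  have c3: "\<Phi> y = 0 \<and> T y o\<^sub>L \<Theta> y = Pih y \<and> norm (\<Theta> y - Pih y) \<le> 1/8" if y: "y \<in> K" for y
  proof -
    have yt: "y \<in> tube K \<rho>" using subset_tube[OF \<rho>(1)] y by blast
    have \<Phi>y: "\<Phi> y = 0" and \<Theta>n: "norm (\<Theta> y - Pih y) \<le> 1/8"
      and \<Theta>P: "\<Theta> y (Pic y v) = 0" for v
      using atK y e(2) by (auto intro: order_trans)
    have \<Theta>Q: "\<Theta> y (Pih y v) = \<Theta> y v" for v using \<Theta>P by (simp add: Pih_apply blinfun.bilinear_simps)
    have "T y (\<Theta> y v) = Pih y v" for v
    proof -
      \<comment> \<open>Range \<open>T y\<close> lies in range \<open>E y\<close>, that is range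
        \<open>Pih y\<close>, and \<open>\<Theta> y w = 0\<close>; on range \<open>Pih y\<close> the
        operator \<open>\<Theta> y\<close> is within 1/8 of the identity, so
        \<open>w = 0\<close>.\<close>
      define w where "w = T y (\<Theta> y v) - Pih y v"
      have "Pih y w = w" using E(2) y
        by (simp add: w_def T_def Z_def blinfun.bilinear_simps Pih_Pic[OF y])
      moreover have "\<Theta> y w = 0"
        using c1[OF yt \<Phi>y, of v] by (simp add: w_def blinfun.bilinear_simps \<Theta>Q)
      ultimately have "w = - (\<Theta> y - Pih y) w" by (simp add: blinfun.bilinear_simps)
      then have "norm w \<le> norm (\<Theta> y - Pih y) * norm w"
        using norm_blinfun[of "\<Theta> y - Pih y" w] by (metis norm_minus_cancel blinfun.minus_left)
      also have "\<dots> \<le> 1/8 * norm w" using \<Theta>n by (intro mult_right_mono) auto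
      finally have "w = 0" by simp
      then show ?thesis by (simp add: w_def)
    qed
    then have "T y o\<^sub>L \<Theta> y = Pih y" by (intro blinfun_eqI) simp
    then show ?thesis using \<Phi>y \<Theta>n by blast
  qed
  have c5: "\<Theta> m o\<^sub>L T m o\<^sub>L \<Theta> m = \<Theta> m \<and> T m o\<^sub>L \<Theta> m o\<^sub>L T m = T m" if "m \<in> tube K \<rho>" "\<Phi> m = 0" for m
    using c1[OF that] by (auto intro!: blinfun_eqI)
  \<comment> \<open>Near a point with \<open>Pih y = 0\<close> the projection \<open>H x\<close> has
    norm below 1 and must be 0.\<close>
  have c4: "T x = 0" if y: "y \<in> K" "dist y x < \<rho>" "Pic y = id_blinfun" for x y
  proof -
    have xt: "x \<in> tube K \<rho>1" using tubeI[OF y(1,2)] sub by blast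
    have "norm (H x - Pih y) \<le> e" using Hn y \<rho>(3) by (meson order_less_le_trans)
    then have Hx: "norm (H x) \<le> 1/2" using y(3) e(2) by (simp add: Pih_def)
    have "H x v = 0" for v
    proof -
      have "norm (H x v) \<le> norm (H x) * norm (H x v)" using norm_blinfun[of "H x" "H x v"] HH[OF xt] by simp
      also have "\<dots> \<le> 1/2 * norm (H x v)" using Hx by (intro mult_right_mono) auto
      finally show ?thesis by simp
    qed
    then have "H x = 0" by (intro blinfun_eqI) simp
    then show ?thesis by (simp add: T_def Z_def)
  qed
  show ?thesis
    by (rule exI[of _ \<rho>], rule conjI[OF \<rho>(1)], rule exI[of _ \<Phi>], rule exI[of _ \<Theta>], rule exI[of _ T])
      (use C\<Phi> Tc c5 c2 c3 c4 in blast)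
qed

text \<open>
  The slope bound makes \<open>Pic (p j)\<close> bi-Lipschitz on the part of the zero set near \<open>p j\<close>, so functions
  of \<open>Pic (p j) x\<close> suffice to approximate there; these local approximations are then averaged.
\<close>

lemma zero_set_uniform_approx:
  assumes \<rho>0: "\<rho>0 > 0" and \<Phi>: "C1_with (tube K \<rho>0) \<Phi> \<Theta>" and \<Theta>n: "\<forall>y\<in>K. norm (\<Theta> y - Pih y) \<le> 1/8"
  shows "\<exists>\<rho>>0. \<rho> \<le> \<rho>0 \<and> (\<forall>(f :: 'a \<Rightarrow> 'a \<Rightarrow>\<^sub>L 'a) \<eta>. \<eta> > 0 \<and> continuous_on {x\<in>tube K \<rho>. \<Phi> x = 0} f \<and>
      (\<forall>y\<in>K. \<forall>x. dist y x < \<rho> \<longrightarrow> Pic y = id_blinfun \<longrightarrow> f x = id_blinfun) \<longrightarrow>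
      smoothly_approximable {x\<in>tube K \<rho>. \<Phi> x = 0} f \<eta>)"
proof -
  have "\<exists>r>0. ball m r \<subseteq> tube K \<rho>0 \<and> (\<forall>x\<in>ball m r. norm (\<Theta> x - Pih m) \<le> 1/4)" if m: "m \<in> K" for m
  proof -
    have mt: "m \<in> tube K \<rho>0" using subset_tube[OF \<rho>0] m by blast
    obtain r1 where r1: "r1 > 0" "\<forall>x\<in>tube K \<rho>0. dist x m < r1 \<longrightarrow> norm (\<Theta> x - \<Theta> m) \<le> 1/8"
      using continuous_on_at_point[OF C1_withD(2)[OF \<Phi>] mt, of "1/8"] by auto
    have sub: "ball m (min r1 \<rho>0) \<subseteq> tube K \<rho>0" using m by (auto intro: tubeI)
    have "norm (\<Theta> x - Pih m) \<le> 1/4" if x: "x \<in> ball m (min r1 \<rho>0)" for x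
    proof -
      have "norm (\<Theta> x - \<Theta> m) \<le> 1/8" using r1(2) x sub by (auto simp: dist_commute)
      then show ?thesis using \<Theta>n m norm_triangle_ineq[of "\<Theta> x - \<Theta> m" "\<Theta> m - Pih m"] by fastforce
    qed
    then show ?thesis using r1(1) \<rho>0 sub by (intro exI[of _ "min r1 \<rho>0"]) auto
  qed
  then have "\<forall>m. \<exists>r. m \<in> K \<longrightarrow> r > 0 \<and> ball m r \<subseteq> tube K \<rho>0 \<and> (\<forall>x\<in>ball m r. norm (\<Theta> x - Pih m) \<le> 1/4)"
    by blast
  then obtain r where r: "\<forall>m. m \<in> K \<longrightarrow> r m > 0 \<and> ball m (r m) \<subseteq> tube K \<rho>0 \<and>
      (\<forall>x\<in>ball m (r m). norm (\<Theta> x - Pih m) \<le> 1/4)"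
    unfolding choice_iff by (elim exE) (rule that)
  then have rp: "\<forall>m\<in>K. r m / 2 > 0" by simp
  obtain \<rho>1 n p \<phi> \<phi>' where \<rho>1: "\<rho>1 > 0" and pt: "partition_at \<rho>1 (\<lambda>m. r m / 2) n p \<phi> \<phi>'"
    using partition_near_K[OF rp] by (elim exE conjE) (rule that)
  note \<phi> = pt[unfolded partition_at_def, THEN conjunct1]
    and one = pt[unfolded partition_at_def, THEN conjunct2]
  define \<rho> where "\<rho> = min \<rho>0 \<rho>1"
  have \<rho>: "\<rho> > 0" "\<rho> \<le> \<rho>0" "\<rho> \<le> \<rho>1" using \<rho>0 \<rho>1 by (auto simp: \<rho>_def)
  define \<Sigma> where "\<Sigma> = {x\<in>tube K \<rho>. \<Phi> x = 0}"
  \<comment> \<open>1/8 on K and 1/8 from continuity keep \<open>\<Theta>\<close> within 1/4 of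
    \<open>Pih (p j)\<close>. Since \<open>\<Phi>\<close> vanishes at \<open>x\<close> and
    \<open>y\<close>, the chord has a \<open>Pih (p j)\<close>-part of at most a quarter of its
    length.\<close>
  have slope: "norm (x - y) \<le> 2 * norm (Pic (p j) x - Pic (p j) y)"
    if j: "j < n" and x: "x \<in> \<Sigma> \<inter> ball (p j) (r (p j))" and y: "y \<in> \<Sigma> \<inter> ball (p j) (r (p j))" for j x y
  proof -
    have pj: "p j \<in> K" using \<phi> j by blast
    have "norm (\<Phi> x - \<Phi> y - Pih (p j) (x - y)) \<le> 1/4 * norm (x - y)"
      by (rule C1_with_bound_linear[OF \<Phi> convex_ball[of "p j" "r (p j)"]]) (use r pj x y in auto)
    then have "norm (Pih (p j) (x - y)) \<le> 1/4 * norm (x - y)" using x y by (simp add: \<Sigma>_def)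
    moreover have "norm (x - y) \<le> norm (Pic (p j) (x - y)) + norm (Pih (p j) (x - y))"
      unfolding Pih_apply by (rule norm_triangle_sub)
    ultimately have "norm (x - y) \<le> 2 * norm (Pic (p j) (x - y))"
      using norm_ge_zero[of "Pic (p j) (x - y)"] by linarith
    then show ?thesis by (simp add: blinfun.diff_right)
  qed
  have "smoothly_approximable \<Sigma> f \<eta>"
    if \<eta>: "\<eta> > 0" and f: "continuous_on \<Sigma> f"
      and fid: "\<forall>y\<in>K. \<forall>x. dist y x < \<rho> \<longrightarrow> Pic y = id_blinfun \<longrightarrow> f x = id_blinfun"
    for f :: "'a \<Rightarrow> 'a \<Rightarrow>\<^sub>L 'a" and \<eta>
  proof -
    have "smoothly_approximable (\<Sigma> \<inter> ball (p j) (r (p j))) f \<eta>" if j: "j < n" for j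
    proof (rule uniform_C1_approx[where P = "Pic (p j)"])
      have pj: "p j \<in> K" "Pic (p j) \<noteq> id_blinfun" using \<phi> j by auto
      show "bounded_projection (Pic (p j))" by (rule proj[OF pj(1)])
      show "property_star (range (blinfun_apply (Pic (p j)))) (range (blinfun_apply (id_blinfun - Pic (p j))))"
        by (rule star[OF pj(1)])
      show "Pic (p j) \<noteq> id_blinfun" by (rule pj(2))
      show "continuous_on (\<Sigma> \<inter> ball (p j) (r (p j))) f" using f by (rule continuous_on_subset) auto
    qed (use slope[OF j] \<eta> in auto)
    then obtain W g g' where W: "\<And>j. j < n \<Longrightarrow> open (W j)"
      "\<And>j. j < n \<Longrightarrow> \<Sigma> \<inter> ball (p j) (r (p j)) \<subseteq> W j"
      and g: "\<And>j. j < n \<Longrightarrow> C1_with (W j) (g j) (g' j)"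
      "\<And>j x. j < n \<Longrightarrow> x \<in> \<Sigma> \<inter> ball (p j) (r (p j)) \<Longrightarrow> norm (g j x - f x) \<le> \<eta>"
      unfolding smoothly_approximable_def by metis
    \<comment> \<open>Each \<open>g j\<close> is controlled only on \<open>W j\<close>. At any point
      of \<open>V\<close> either this holds or the point lies outside the closed half ball, where
      the weight vanishes in a neighbourhood.\<close>
    define V where "V = tube K \<rho> \<inter> (\<Inter>j<n. W j \<union> - cball (p j) (r (p j) / 2))"
    have "open V" unfolding V_def
      using W(1) by (intro open_Int open_INT open_Un open_tube) (auto simp: open_Compl)
    have C\<phi>: "C1_with V (\<phi> j) (\<phi>' j)" if "j < n" for j
    proof -
      have "V \<subseteq> tube K \<rho>1" using tube_mono[OF \<rho>(3)] by (auto simp: V_def)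
      then show ?thesis using \<phi> that C1_with_subset by blast
    qed
    have "\<exists>d. C1_with V (\<lambda>x. \<phi> j x *\<^sub>R g j x) d" if j: "j < n" for j
    proof (rule C1_with_local)
      fix x assume x: "x \<in> V"
      show "\<exists>B d. open B \<and> x \<in> B \<and> C1_with B (\<lambda>x. \<phi> j x *\<^sub>R g j x) d"
      proof (cases "x \<in> W j")
        case True
        have "C1_with (V \<inter> W j) (\<lambda>x. \<phi> j x *\<^sub>R g j x)
            (\<lambda>x. \<phi> j x *\<^sub>R g' j x + (blinfun_scaleR_left (g j x) o\<^sub>L \<phi>' j x))"
          using C\<phi>[OF j] g(1)[OF j] by (intro C1_with_scaleR) (auto intro: C1_with_subset)
        then show ?thesis using True x \<open>open V\<close> W(1)[OF j] by blast
      next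
        case False
        then have xB: "x \<in> - cball (p j) (r (p j) / 2)" using x j by (auto simp: V_def)
        have "\<phi> j z = 0" if "z \<in> - cball (p j) (r (p j) / 2)" for z
          using \<phi> j that by fastforce
        then have "C1_with (- cball (p j) (r (p j) / 2)) (\<lambda>x. \<phi> j x *\<^sub>R g j x) (\<lambda>x. 0)"
          by (intro C1_with_cong[OF C1_with_const[of _ 0]]) auto
        then show ?thesis using xB by (meson closed_cball open_Compl)
      qed
    qed
    then obtain d where d: "\<And>j. j < n \<Longrightarrow> C1_with V (\<lambda>x. \<phi> j x *\<^sub>R g j x) (d j)" by metis
    \<comment> \<open>Around points where \<open>Pic\<close> is the identity all weights vanish, and
      the last summand supplies the value \<open>id_blinfun\<close> that \<open>f\<close> has
      there.\<close>
    define h where "h x = (\<Sum>j<n. \<phi> j x *\<^sub>R g j x) + (1 - (\<Sum>j<n. \<phi> j x)) *\<^sub>R id_blinfun" for x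
    have "\<exists>h'. C1_with V h h'"
    proof -
      have "C1_with V (\<lambda>x. \<Sum>j<n. \<phi> j x *\<^sub>R g j x) (\<lambda>x. \<Sum>j<n. d j x)" by (rule C1_with_sum) (use d in auto)
      moreover have "C1_with V (\<lambda>x. 1 - (\<Sum>j<n. \<phi> j x)) (\<lambda>x. 0 - (\<Sum>j<n. \<phi>' j x))"
        by (intro C1_with_diff C1_with_const C1_with_sum) (use C\<phi> in auto)
      ultimately show ?thesis unfolding h_def
        using C1_with_add[OF _ C1_with_scaleR[OF _ C1_with_const]] by blast
    qed
    moreover have "\<Sigma> \<subseteq> V"
    proof
      fix x assume x: "x \<in> \<Sigma>"
      have "x \<in> W j" if j: "j < n" "dist (p j) x \<le> r (p j) / 2" for j
      proof -
        have "p j \<in> K" using \<phi> j by blast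
        then have "0 < r (p j)" using r by blast
        then show ?thesis using W(2)[OF j(1)] x j(2) by force
      qed
      then show "x \<in> V" using x by (auto simp: V_def \<Sigma>_def)
    qed
    moreover have "norm (h x - f x) \<le> \<eta>" if x: "x \<in> \<Sigma>" for x
    proof -
      obtain y where y: "y \<in> K" "dist y x < \<rho>" using x by (auto simp: \<Sigma>_def tube_def)
      show ?thesis
      proof (cases "Pic y = id_blinfun")
        case True
        then have "\<phi> j x = 0" if "j < n" for j using one y \<rho>(3) that by (meson order_less_le_trans)
        then have "h x = id_blinfun" by (simp add: h_def)
        then show ?thesis using fid y True \<eta> by simp
      next
        case False
        then have s1: "(\<Sum>j<n. \<phi> j x) = 1" using one y \<rho>(3) by (meson order_less_le_trans)
        have "norm ((\<Sum>j<n. \<phi> j x *\<^sub>R g j x) - f x) \<le> \<eta>"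
        proof (rule norm_convex_combination_le[OF _ s1])
          fix j assume j: "j < n"
          then show "0 \<le> \<phi> j x" using \<phi> by blast
          assume "\<phi> j x \<noteq> 0"
          then have "dist (p j) x < r (p j) / 2" using \<phi> j by blast
          moreover have "0 < r (p j)" using r \<phi> j by blast
          ultimately show "norm (g j x - f x) \<le> \<eta>" using g(2)[OF j] x by simp
        qed
        then show ?thesis by (simp add: h_def s1)
      qed
    qed
    ultimately show ?thesis using \<open>open V\<close> unfolding smoothly_approximable_def by blast
  qed
  then show ?thesis using \<rho>(1,2) unfolding \<Sigma>_def by (intro exI[of _ \<rho>] conjI allI impI) auto
qed

end

theorem theorem10p15:
  fixes K :: "'a::banach set" and Pic :: "'a \<Rightarrow> 'a \<Rightarrow>\<^sub>L 'a"
  assumes "compact K"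
    and "\<And>m. m \<in> K \<Longrightarrow> bounded_projection (Pic m)"
    and "continuous_on K Pic"
    and "\<And>m. m \<in> K \<Longrightarrow> whitney_tangent_subset K m (Pic m)"
    and "\<And>m. m \<in> K \<Longrightarrow>
           property_star (range (blinfun_apply (Pic m)))
                         (range (blinfun_apply (id_blinfun - Pic m)))"
  shows "\<exists>(\<Sigma> :: 'a set) (Pit :: 'a \<Rightarrow> 'a \<Rightarrow>\<^sub>L 'a).
     (C1_submanifold \<Sigma> \<and> K \<subseteq> \<Sigma> \<and>
      (\<forall>m\<in>K. whitney_tangent_eq \<Sigma> m (Pic m)) \<and>
      (\<forall>m\<in>\<Sigma>. bounded_projection (Pit m) \<and> whitney_tangent_eq \<Sigma> m (Pit m)) \<and>
      continuous_on \<Sigma> Pit \<and>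
      (\<forall>m\<in>K. Pit m = Pic m)) \<and>
     (\<forall>\<epsilon>>0. \<exists>Pih :: 'a \<Rightarrow> 'a \<Rightarrow>\<^sub>L 'a.
        (\<forall>m\<in>\<Sigma>. bounded_projection (Pih m)) \<and>
        C1_map_on_submanifold \<Sigma> Pih \<and>
        (\<forall>m\<in>\<Sigma>. norm (Pih m - Pit m) \<le> \<epsilon>) \<and>
        (\<exists>r>0. \<exists>C2>0. \<forall>m\<in>K. \<forall>m1\<in>\<Sigma> \<inter> ball m r. \<forall>m2\<in>\<Sigma> \<inter> ball m r.
           norm (Pih m1 - Pih m2) \<le> C2 * norm (m1 - m2)))"
proof -
  interpret tangent_field K Pic by unfold_locales (use assms in auto)
  obtain \<rho>1 \<Phi> and \<Theta> T :: "'a \<Rightarrow> 'a \<Rightarrow>\<^sub>L 'a" where \<rho>1: "\<rho>1 > 0" and \<Phi>1: "C1_with (tube K \<rho>1) \<Phi> \<Theta>" and T1: "continuous_on (tube K \<rho>1) T"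
    and on_zero: "\<forall>m\<in>tube K \<rho>1. \<Phi> m = 0 \<longrightarrow> (\<Theta> m o\<^sub>L T m o\<^sub>L \<Theta> m = \<Theta> m \<and> T m o\<^sub>L \<Theta> m o\<^sub>L T m = T m) \<and>
       (\<exists>r>0. \<forall>x\<in>tube K \<rho>1 \<inter> ball m r. blinfun_apply (T m) (\<Phi> x) = 0 \<longrightarrow> \<Phi> x = 0)"
    and on_K: "\<forall>y\<in>K. \<Phi> y = 0 \<and> T y o\<^sub>L \<Theta> y = local.Pih y \<and> norm (\<Theta> y - local.Pih y) \<le> 1/8"
    and triv: "\<forall>y\<in>K. \<forall>x. dist y x < \<rho>1 \<longrightarrow> Pic y = id_blinfun \<longrightarrow> T x = 0"
    using invariant_manifold by (elim exE conjE) (rule that)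
  \<comment> \<open>The projections must be bounded on the whole manifold, which is not compact, so
    that one tolerance \<open>\<eta>\<close> of the retraction serves all of it; hence the further
    shrinking to \<open>\<rho>2\<close>.\<close>
  have "continuous_on (tube K \<rho>1) (\<lambda>x. id_blinfun - (T x o\<^sub>L \<Theta> x))"
    by (intro continuous_intros T1 C1_withD(2)[OF \<Phi>1])
  from compact_tube_bound[OF compact_K open_tube subset_tube[OF \<rho>1] this]
  obtain \<rho>2 M where \<rho>2: "\<rho>2 > 0" "M > 0" "\<forall>x\<in>tube K \<rho>2. norm (id_blinfun - (T x o\<^sub>L \<Theta> x)) \<le> M" by blast
  define \<rho>0 where "\<rho>0 = min \<rho>1 \<rho>2"
  have \<rho>0: "\<rho>0 > 0" "\<rho>0 \<le> \<rho>1" "\<rho>0 \<le> \<rho>2" using \<rho>1 \<rho>2 by (auto simp: \<rho>0_def)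
  \<comment> \<open>The radius is fixed before the accuracy \<open>\<eta>\<close>, so the manifold
    does not depend on the \<open>\<epsilon>\<close> of part (2).\<close>
  obtain \<rho> where \<rho>: "\<rho> > 0" "\<rho> \<le> \<rho>0" and approx: "\<forall>(f :: 'a \<Rightarrow> 'a \<Rightarrow>\<^sub>L 'a) \<eta>.
      \<eta> > 0 \<and> continuous_on {x\<in>tube K \<rho>. \<Phi> x = 0} f \<and>
      (\<forall>y\<in>K. \<forall>x. dist y x < \<rho> \<longrightarrow> Pic y = id_blinfun \<longrightarrow> f x = id_blinfun) \<longrightarrow>
      smoothly_approximable {x\<in>tube K \<rho>. \<Phi> x = 0} f \<eta>"
  proof -
    have "\<forall>y\<in>K. norm (\<Theta> y - local.Pih y) \<le> 1/8" using on_K by blast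
    from zero_set_uniform_approx[OF \<rho>0(1) C1_with_subset[OF \<Phi>1 tube_mono[OF \<rho>0(2)]] this]
    show ?thesis by (elim exE conjE) (rule that)
  qed
  define U where "U = tube K \<rho>"
  define \<Sigma> where "\<Sigma> = {x\<in>U. \<Phi> x = 0}"
  define Pit where "Pit x = id_blinfun - (T x o\<^sub>L \<Theta> x)" for x
  have U: "open U" "U \<subseteq> tube K \<rho>1" "U \<subseteq> tube K \<rho>2" "K \<subseteq> U"
    unfolding U_def using tube_mono[of \<rho> \<rho>1 K] tube_mono[of \<rho> \<rho>2 K] subset_tube[OF \<rho>(1)] \<rho> \<rho>0 by auto
  have \<Phi>: "C1_with U \<Phi> \<Theta>" using \<Phi>1 U(2) by (rule C1_with_subset)
  have T: "continuous_on U T" using T1 U(2) by (rule continuous_on_subset)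
  have zero: "\<Theta> m (T m (\<Theta> m v)) = \<Theta> m v" "T m (\<Theta> m (T m v)) = T m v"
    "\<exists>r>0. \<forall>x\<in>U \<inter> ball m r. T m (\<Phi> x) = 0 \<longrightarrow> \<Phi> x = 0" if m: "m \<in> U" "\<Phi> m = 0" for m v
  proof -
    have *: "\<Theta> m o\<^sub>L T m o\<^sub>L \<Theta> m = \<Theta> m" "T m o\<^sub>L \<Theta> m o\<^sub>L T m = T m"
      "\<exists>r>0. \<forall>x\<in>tube K \<rho>1 \<inter> ball m r. T m (\<Phi> x) = 0 \<longrightarrow> \<Phi> x = 0"
      using on_zero m U(2) by blast+
    show "\<Theta> m (T m (\<Theta> m v)) = \<Theta> m v" "T m (\<Theta> m (T m v)) = T m v"
      using *(1,2) by (metis blinfun_apply_blinfun_compose)+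
    show "\<exists>r>0. \<forall>x\<in>U \<inter> ball m r. T m (\<Phi> x) = 0 \<longrightarrow> \<Phi> x = 0"
      using *(3) U(2) by blast
  qed
  note chart = zero_set_chart[OF U(1) \<Phi> T, folded \<Sigma>_def]
  have sub: "C1_submanifold \<Sigma>" unfolding \<Sigma>_def by (rule zero_set_submanifold[OF U(1) \<Phi> T zero])
  have K\<Sigma>: "K \<subseteq> \<Sigma>" using U(4) on_K by (auto simp: \<Sigma>_def)
  have Pit: "bounded_projection (Pit m)" "whitney_tangent_eq \<Sigma> m (Pit m)" if "m \<in> \<Sigma>" for m
  proof -
    have m: "m \<in> U" "\<Phi> m = 0" using that by (simp_all add: \<Sigma>_def)
    show "bounded_projection (Pit m)" unfolding Pit_def using m by (intro chart(1) zero)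
    show "whitney_tangent_eq \<Sigma> m (Pit m)" unfolding Pit_def using m by (intro chart(2) zero)
  qed
  have Pitc: "continuous_on \<Sigma> Pit"
    unfolding \<Sigma>_def Pit_def by (rule zero_set_tangent_continuous[OF U(1) \<Phi> T zero])
  have PitK: "Pit m = Pic m" if "m \<in> K" for m
    using on_K that by (simp add: Pit_def local.Pih_def)
  have part1: "C1_submanifold \<Sigma> \<and> K \<subseteq> \<Sigma> \<and>
      (\<forall>m\<in>K. whitney_tangent_eq \<Sigma> m (Pic m)) \<and>
      (\<forall>m\<in>\<Sigma>. bounded_projection (Pit m) \<and> whitney_tangent_eq \<Sigma> m (Pit m)) \<and>
      continuous_on \<Sigma> Pit \<and> (\<forall>m\<in>K. Pit m = Pic m)"
    using sub K\<Sigma> Pit Pitc PitK by (metis subsetD)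
  have part2: "\<exists>Pih :: 'a \<Rightarrow> 'a \<Rightarrow>\<^sub>L 'a. (\<forall>m\<in>\<Sigma>. bounded_projection (Pih m)) \<and>
        C1_map_on_submanifold \<Sigma> Pih \<and> (\<forall>m\<in>\<Sigma>. norm (Pih m - Pit m) \<le> \<epsilon>) \<and>
        (\<exists>r>0. \<exists>C2>0. \<forall>m\<in>K. \<forall>m1\<in>\<Sigma> \<inter> ball m r. \<forall>m2\<in>\<Sigma> \<inter> ball m r.
           norm (Pih m1 - Pih m2) \<le> C2 * norm (m1 - m2))" if \<epsilon>: "\<epsilon> > 0" for \<epsilon>
  proof -
    obtain \<eta> \<Omega> R R' where \<eta>: "\<eta> > 0" and \<Omega>: "open \<Omega>" "C1_with \<Omega> R R'"
      and R: "\<forall>P S :: 'a \<Rightarrow>\<^sub>L 'a. bounded_projection P \<and> norm P \<le> M \<and> norm (S - P) \<le> \<eta> \<longrightarrow>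
         S \<in> \<Omega> \<and> bounded_projection (R S) \<and> norm (R S - P) \<le> \<epsilon>"
      using projection_retraction_near[OF less_imp_le[OF \<rho>2(2)] \<epsilon>, where 'a = 'a] by (elim exE conjE) (rule that)
    have "Pit x = id_blinfun" if "y \<in> K" "dist y x < \<rho>" "Pic y = id_blinfun" for x y
      using triv that \<rho>(2) \<rho>0(2) by (simp add: Pit_def)
    then have pre: "\<eta> > 0 \<and> continuous_on {x\<in>tube K \<rho>. \<Phi> x = 0} Pit \<and>
      (\<forall>y\<in>K. \<forall>x. dist y x < \<rho> \<longrightarrow> Pic y = id_blinfun \<longrightarrow> Pit x = id_blinfun)"
      using \<eta> Pitc unfolding \<Sigma>_def U_def by blast
    obtain W g g' where W: "open W" "\<Sigma> \<subseteq> W" and g: "C1_with W g g'" "\<forall>x\<in>\<Sigma>. norm (g x - Pit x) \<le> \<eta>"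
      using approx[rule_format, OF pre] unfolding smoothly_approximable_def \<Sigma>_def U_def by blast
    have gR: "g m \<in> \<Omega> \<and> bounded_projection (R (g m)) \<and> norm (R (g m) - Pit m) \<le> \<epsilon>" if m: "m \<in> \<Sigma>" for m
    proof -
      have "norm (Pit m) \<le> M" using \<rho>2(3) m U(3) by (auto simp: Pit_def \<Sigma>_def)
      then show ?thesis using R Pit(1)[OF m] g(2) m by blast
    qed
    \<comment> \<open>The smoothed projection is C1 on an open set of the ambient space containing
      the manifold; both the C1 property in charts and the Lipschitz bound near K are read off from
      there.\<close>
    define W' where "W' = W \<inter> g -` \<Omega>"
    have W': "open W'" "\<Sigma> \<subseteq> W'"
      unfolding W'_def using continuous_open_preimage[OF C1_with_continuous_on[OF g(1)] W(1) \<Omega>(1)] W(2) gR by auto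
    have C: "C1_with W' (\<lambda>x. R (g x)) (\<lambda>x. R' (g x) o\<^sub>L g' x)"
      by (rule C1_with_compose[OF C1_with_subset[OF g(1)] \<Omega>(2)]) (auto simp: W'_def)
    have C1map: "C1_map_on_submanifold \<Sigma> (\<lambda>x. R (g x))"
      by (rule C1_map_on_submanifold_restrict[OF C W' sub])
    obtain r C2 where lip: "r > 0" "C2 > 0"
      "\<forall>m\<in>K. \<forall>x\<in>ball m r. \<forall>y\<in>ball m r. norm (R (g x) - R (g y)) \<le> C2 * norm (x - y)"
      using C1_with_locally_lipschitz_near_compact[OF C W'(1) order_trans[OF K\<Sigma> W'(2)] compact_K] by blast
    have "\<exists>r>0. \<exists>C2>0. \<forall>m\<in>K. \<forall>m1\<in>\<Sigma> \<inter> ball m r. \<forall>m2\<in>\<Sigma> \<inter> ball m r.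
           norm (R (g m1) - R (g m2)) \<le> C2 * norm (m1 - m2)"
      by (intro exI[of _ r] exI[of _ C2] conjI lip(1,2)) (use lip(3) in blast)
    then show ?thesis using gR C1map by (intro exI[of _ "\<lambda>x. R (g x)"]) blast
  qed
  show ?thesis using part1 part2 by blast
qed

end
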